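(* Let $n\ge 1$ and $p>0$. Let $u:\mathbb{R}^n\to(-\infty,+\infty]$ be a convex function whose effective domain $\operatorname{dom}u=\{x: u(x)<+\infty\}$ is compact, such that $u$ is Lipschitz on $\operatorname{int}(\operatorname{dom}u)$, and such that $u$ is of class $C^2_+$ in $\operatorname{int}(\operatorname{dom}u)$. Let $\omega:\mathbb{R}^{n+1}\to\mathbb{R}$ be continuous and positive. Then there exists a constant $\delta_{p,n}$, depending only on $n$ and $p$, such that \[ \lim_{m\to+\infty} m^{\frac{2p}{n}}\,\triangle_p(u,P^c_{(m)},\omega)=\frac{\delta_{p,n}}{2^p}\left(\int_{\operatorname{dom}u}(\det D^2u(x))^{\frac{p}{n+2p}}\,\omega(x,u(x))^{\frac{n}{n+2p}}\,\mathrm{d}x\right)^{\frac{n+2p}{n}}. \]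
   Context: $C^2_+$ means twice continuously differentiable with positive definite Hessian $D^2u$. $P^c_{(m)}=P^c_{(m)}(u)$ is the class of functions $l_m:\mathbb{R}^n\to\mathbb{R}$ of the form $l_m(x)=\max_{1\le j\le m}\psi_j(x)$ for at most $m$ affine functions $\psi_j:\mathbb{R}^n\to\mathbb{R}$, satisfying $l_m(x)\le u(x)$ for all $x\in\operatorname{dom}u$. For $m$ sufficiently large, \[ \triangle_p(u,P^c_{(m)},\omega)=\inf\Big\{\int_{\operatorname{dom}u}(u(x)-l_m(x))^p\,\omega(x,u(x))\,\mathrm{d}x:\ l_m\in P^c_{(m)}\Big\}. \] (The constant $\delta_{p,n}$ is the one arising from Zador's quantization theorem: for every Jordan measurable compact $J\subset\mathbb{R}^n$ of positive volume, $\lim_{m\to\infty}m^{2p/n}\inf_{S\subset J,\#S=m}\int_J\min_{s\in S}\|x-s\|^{2p}\,\mathrm{d}x=\delta_{p,n}V_n(J)^{(n+2p)/n}$.) *)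

theory Defs
  imports "HOL-Analysis.Analysis"
begin

definition edom :: "('a \<Rightarrow> ereal) \<Rightarrow> 'a set" where
  "edom u = {x. u x < \<infinity>}"

definition convex_ext :: "('a::real_vector \<Rightarrow> ereal) \<Rightarrow> bool" where
  "convex_ext u \<longleftrightarrow> (\<forall>x y t. 0 \<le> t \<and> t \<le> 1 \<longrightarrow>
      u ((1 - t) *\<^sub>R x + t *\<^sub>R y) \<le> ereal (1 - t) * u x + ereal t * u y)"

definition C2_plus_on ::
  "(real^'n \<Rightarrow> real) \<Rightarrow> (real^'n \<Rightarrow> real^'n) \<Rightarrow> (real^'n \<Rightarrow> real^'n^'n) \<Rightarrow> (real^'n) set \<Rightarrow> bool" where
  "C2_plus_on f Df D2f S \<longleftrightarrow>
     (\<forall>x\<in>S. (f has_derivative (\<lambda>h. Df x \<bullet> h)) (at x)) \<and>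
     (\<forall>x\<in>S. (Df has_derivative (\<lambda>h. D2f x *v h)) (at x)) \<and>
     continuous_on S D2f \<and>
     (\<forall>x\<in>S. \<forall>v. v \<noteq> 0 \<longrightarrow> v \<bullet> (D2f x *v v) > 0)"

definition poly_lower :: "(real^'n \<Rightarrow> ereal) \<Rightarrow> nat \<Rightarrow> (real^'n \<Rightarrow> real) set" where
  "poly_lower u m = {l. \<exists>A :: ((real^'n) \<times> real) set. finite A \<and> A \<noteq> {} \<and> card A \<le> m \<and>
       (\<forall>x. l x = Max ((\<lambda>(a, b). a \<bullet> x + b) ` A)) \<and>
       (\<forall>x\<in>edom u. ereal (l x) \<le> u x)}"

definition approx_error ::
  "real \<Rightarrow> (real^'n \<Rightarrow> ereal) \<Rightarrow> nat \<Rightarrow> (real^'n \<Rightarrow> real \<Rightarrow> real) \<Rightarrow> real" where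
  "approx_error p u m \<omega> = Inf ((\<lambda>l. integral (edom u)
      (\<lambda>x. (real_of_ereal (u x) - l x) powr p * \<omega> x (real_of_ereal (u x)))) ` poly_lower u m)"

text \<open>Zador's constant delta_{p,n}, computed on the unit cube J = [0,1]^n (volume 1).\<close>
definition zador_delta :: "real \<Rightarrow> 'n::finite itself \<Rightarrow> real" where
  "zador_delta p _ = lim (\<lambda>m. real m powr (2 * p / real CARD('n)) *
     Inf ((\<lambda>S. integral (cbox 0 (\<chi> i. 1)) (\<lambda>x::real^'n. Min ((\<lambda>s. norm (x - s) powr (2 * p)) ` S)))
          ` {S. S \<subseteq> cbox 0 (\<chi> i. 1) \<and> finite S \<and> card S = m}))"

end

theory Submission
  imports Defs
begin

text \<open>
  On a small parallelepiped on which the Hessian of \<open>u\<close> is almost constant, the gap between \<open>u\<close> and its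
  tangent at \<open>s\<close> is almost half the squared distance to \<open>s\<close> in the Hessian metric, so approximating by
  tangents is quantising the unit cube. Dyadic subdivision of the cube makes
  \<open>m powr (2 * p / n)\<close> times the quantisation error converge to its infimum, Zador's constant. Almost all
  of the domain is packed with finitely many such cells, and distributing the tangents optimally over
  the cells turns their errors into the power \<open>(n + 2 * p) / n\<close> of a Riemann sum of the integral.

  For the upper bound, the small uncovered part is treated with a fraction of the tangents: as
  \<open>x \<mapsto> x + Du x\<close> is expansive with bounded range, \<open>k\<close> tangents approximate \<open>u\<close> uniformly up to
  \<open>O(k powr (- 2 / n))\<close>, even where the Hessian is unbounded. For the lower bound, gradients of \<open>u\<close> at
  different points differ, so each affine minorant is effective in at most one cell.
\<close>

text \<open>The exponents come from normalising the Hessian. If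
  \<open>transpose B ** (D2u x ** B)\<close> is the identity, then |det B| is det (D2u x) to the
  power -1/2, and on a cell with matrix h B, volume v and weight w0 the use of k tangents costs
  about \<delta> * w0 * (h^2 / 2)^p * v * k^(-r) with r = 2p/n. With w0 * (h^2 / 2)^p * v written as
  b^(1 + r), Hoelder's inequality shows that m tangents distributed over the cells cost at least
  \<delta> * (sum of the b)^(1 + r) * m^(-r), with equality for numbers proportional to b; and b is
  v times the integrand of the theorem, up to a constant power of 2.

  The obstacle is the boundary, where D2u may be unbounded. The integral is finite all the same,
  because det D2u is the Jacobian of the gradient map, which is injective with bounded range. A
  finite packing stays fixed while m tends to infinity and is refined only afterwards, so constants
  that depend on it disappear. At boundary points of the domain u need not be continuous; they form
  a null set for the integrals, and convexity alone keeps interior tangents below u there.\<close>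

section \<open>Change of variables for arbitrary finite index types\<close>

text \<open>The library has the change of variables formula only for well-ordered index types; it is
  transported along a bijection between \<^typ>\<open>'n\<close> and \<open>'n ranked\<close>.\<close>

typedef (overloaded) 'a ranked = "{0..<CARD('a::finite)}"
  by (intro exI[of _ 0]) simp

instance ranked :: (finite) finite
proof
  have "(UNIV :: 'a ranked set) = Abs_ranked ` {0..<CARD('a)}"
    using type_definition.Abs_image[OF type_definition_ranked] by blast
  then show "finite (UNIV :: 'a ranked set)"
    by (metis finite_imageI finite_atLeastLessThan)
qed

instantiation ranked :: (finite) linorder
begin
definition "a < b \<longleftrightarrow> Rep_ranked a < Rep_ranked b"
definition "a \<le> b \<longleftrightarrow> Rep_ranked a \<le> Rep_ranked b"
instance
  by intro_classes (auto simp: less_eq_ranked_def less_ranked_def Rep_ranked_inject)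
end

instance ranked :: (finite) wellorder
proof
  fix P :: "'a ranked \<Rightarrow> bool" and a
  assume *: "\<And>x. (\<And>y. y < x \<Longrightarrow> P y) \<Longrightarrow> P x"
  show "P a"
    by (induction a rule: measure_induct_rule[where f = Rep_ranked])
      (use * in \<open>auto simp: less_ranked_def\<close>)
qed

lemma card_ranked: "CARD('a::finite ranked) = CARD('a)"
  using type_definition.card[OF type_definition_ranked] by simp

definition reindex :: "('k \<Rightarrow> 'n) \<Rightarrow> 'a^'n \<Rightarrow> 'a^'k" where
  "reindex \<phi> x = (\<chi> k. x $ \<phi> k)"

lemma reindex_nth [simp]: "reindex \<phi> x $ k = x $ \<phi> k"
  by (simp add: reindex_def)

lemma linear_reindex: "linear (reindex \<phi> :: real^'n \<Rightarrow> real^'k)"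
  by (intro linearI) (auto simp: vec_eq_iff)

lemma reindex_inv:
  assumes "bij \<phi>"
  shows "reindex \<phi> (reindex (inv \<phi>) x) = x" "reindex (inv \<phi>) (reindex \<phi> y) = y"
  using assms by (simp_all add: vec_eq_iff bij_is_inj bij_is_surj surj_f_inv_f)

text \<open>Conjugation by \<open>\<phi>\<close> turns permutations of one index type into
  permutations of the other. It preserves the sign, and the matching products differ only in the
  order of their factors.\<close>

lemma det_reindex:
  fixes A :: "real^'n^'n" and \<phi> :: "'k::finite \<Rightarrow> 'n"
  assumes \<phi>: "bij \<phi>"
  shows "det (\<chi> i j. A $ \<phi> i $ \<phi> j) = det A"
proof -
  have inj: "inj_on \<phi> UNIV" and surj: "range \<phi> = UNIV"
    using \<phi> by (auto simp: bij_def)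
  have bb: "bij_betw \<phi> UNIV UNIV" "bij_betw (inv \<phi>) UNIV UNIV"
    using \<phi> bij_imp_bij_inv by auto
  show ?thesis
    unfolding det_def
  proof (rule sum.reindex_bij_witness[of _ "map_permutation UNIV (inv \<phi>)" "map_permutation UNIV \<phi>"])
    fix p :: "'k \<Rightarrow> 'k" assume p: "p \<in> {p. p permutes UNIV}"
    show "map_permutation UNIV (inv \<phi>) (map_permutation UNIV \<phi> p) = p"
      by (rule map_permutation_compose_inv[OF bb(1)]) (use p inj in auto)
    show "map_permutation UNIV \<phi> p \<in> {p. p permutes UNIV}"
      using map_permutation_permutes[OF bb(1)] p by auto
    have "(\<Prod>i\<in>UNIV. A $ i $ map_permutation UNIV \<phi> p i)
        = (\<Prod>i\<in>UNIV. A $ \<phi> i $ map_permutation UNIV \<phi> p (\<phi> i))"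
      by (rule prod.reindex_bij_betw[OF bb(1), symmetric])
    also have "\<dots> = (\<Prod>i\<in>UNIV. A $ \<phi> i $ \<phi> (p i))"
      using inj by (simp add: map_permutation_apply)
    finally show "of_int (sign (map_permutation UNIV \<phi> p)) * (\<Prod>i\<in>UNIV. A $ i $ map_permutation UNIV \<phi> p i)
       = of_int (sign p) * (\<Prod>i\<in>UNIV. (\<chi> i j. A $ \<phi> i $ \<phi> j) $ i $ p i)"
      using inj p by (simp add: sign_map_permutation)
  next
    fix p :: "'n \<Rightarrow> 'n" assume p: "p \<in> {p. p permutes UNIV}"
    show "map_permutation UNIV \<phi> (map_permutation UNIV (inv \<phi>) p) = p"
      by (rule map_permutation_compose_inv[OF bb(2)]) (use p \<phi> in \<open>auto simp: bij_is_surj surj_f_inv_f\<close>)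
    show "map_permutation UNIV (inv \<phi>) p \<in> {p. p permutes UNIV}"
      using map_permutation_permutes[OF bb(2)] p by auto
  qed
qed

lemma reindex_cbox:
  fixes u v :: "real^'n" and \<phi> :: "'k::finite \<Rightarrow> 'n"
  assumes \<phi>: "bij \<phi>"
  shows "reindex \<phi> ` cbox u v = cbox (reindex \<phi> u) (reindex \<phi> v)"
proof (intro set_eqI iffI)
  fix x assume x: "x \<in> cbox (reindex \<phi> u) (reindex \<phi> v)"
  have "reindex (inv \<phi>) x \<in> cbox u v"
    unfolding mem_box_cart
  proof
    fix i
    show "u $ i \<le> reindex (inv \<phi>) x $ i \<and> reindex (inv \<phi>) x $ i \<le> v $ i"
      using x \<phi> by (auto simp: mem_box_cart bij_is_surj surj_f_inv_f dest: spec[of _ "inv \<phi> i"])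
  qed
  then show "x \<in> reindex \<phi> ` cbox u v"
    using reindex_inv(1)[OF \<phi>, of x] by (metis imageI)
qed (auto simp: mem_box_cart)

lemma content_reindex_cbox:
  fixes u v :: "real^'n" and \<phi> :: "'k::finite \<Rightarrow> 'n"
  assumes \<phi>: "bij \<phi>"
  shows "Henstock_Kurzweil_Integration.content (reindex \<phi> ` cbox u v) = Henstock_Kurzweil_Integration.content (cbox u v)"
proof (cases "cbox u v = {}")
  case False
  then have "cbox (reindex \<phi> u) (reindex \<phi> v) \<noteq> {}"
    using reindex_cbox[OF \<phi>] by (metis image_is_empty)
  then have "Henstock_Kurzweil_Integration.content (reindex \<phi> ` cbox u v) = (\<Prod>k\<in>UNIV. v $ \<phi> k - u $ \<phi> k)"
    by (simp add: reindex_cbox[OF \<phi>] content_cbox_cart)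
  also have "\<dots> = (\<Prod>i\<in>UNIV. v $ i - u $ i)"
    using prod.reindex_bij_betw[of \<phi> UNIV UNIV "\<lambda>i. v $ i - u $ i"] \<phi> by simp
  finally show ?thesis
    using False by (simp add: content_cbox_cart)
qed auto

text \<open>\<open>reindex \<phi>\<close> maps boxes to boxes of equal content, so the substitution
  rule for boxes applies with factor 1. Boundedness of \<open>S\<close> provides a box to which the
  function is extended by zero.\<close>

lemma has_integral_reindex:
  fixes f :: "real^'n \<Rightarrow> 'b::banach" and \<phi> :: "'k::finite \<Rightarrow> 'n"
  assumes \<phi>: "bij \<phi>" and S: "bounded S" and f: "(f has_integral i) S"
  shows "((\<lambda>x. f (reindex (inv \<phi>) x)) has_integral i) (reindex \<phi> ` S)"
proof -
  obtain a b where ab: "S \<subseteq> cbox a b"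
    using S bounded_subset_cbox_symmetric by blast
  have \<psi>: "bij (inv \<phi>)" using \<phi> by (simp add: bij_imp_bij_inv)
  have "((\<lambda>x. if x \<in> S then f x else 0) has_integral i) (cbox a b)"
    using f ab by (simp add: has_integral_restrict)
  then have "((\<lambda>x. if reindex (inv \<phi>) x \<in> S then f (reindex (inv \<phi>) x) else 0)
      has_integral (1/1) *\<^sub>R i) (reindex \<phi> ` cbox a b)"
    by (rule has_integral_twiddle[rotated -1])
      (auto simp: reindex_inv[OF \<phi>] content_reindex_cbox[OF \<psi>, unfolded reindex_cbox[OF \<psi>]] reindex_cbox[OF \<phi>] reindex_cbox[OF \<psi>]
        intro!: linear_continuous_at linear_reindex[unfolded linear_conv_bounded_linear])
  moreover have "reindex (inv \<phi>) x \<in> S \<longleftrightarrow> x \<in> reindex \<phi> ` S" for x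
    using reindex_inv[OF \<phi>] by (metis (no_types, lifting) imageE imageI)
  ultimately show ?thesis
    using ab by (simp add: has_integral_restrict image_mono)
qed

lemma has_integral_reindex_iff:
  fixes f :: "real^'n \<Rightarrow> 'b::banach" and \<phi> :: "'k::finite \<Rightarrow> 'n"
  assumes \<phi>: "bij \<phi>" and S: "bounded S"
  shows "((\<lambda>x. f (reindex (inv \<phi>) x)) has_integral i) (reindex \<phi> ` S) \<longleftrightarrow> (f has_integral i) S"
proof
  assume *: "((\<lambda>x. f (reindex (inv \<phi>) x)) has_integral i) (reindex \<phi> ` S)"
  have "bounded (reindex \<phi> ` S)"
    by (rule bounded_linear_image[OF S linear_reindex[unfolded linear_conv_bounded_linear]])
  from has_integral_reindex[OF bij_imp_bij_inv[OF \<phi>] this *] show "(f has_integral i) S"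
    using \<phi> by (simp add: image_comp o_def reindex_inv inv_inv_eq)
qed (rule has_integral_reindex[OF assms])

lemma absolutely_integrable_reindex_iff:
  fixes f :: "real^'n \<Rightarrow> real" and \<phi> :: "'k::finite \<Rightarrow> 'n"
  assumes \<phi>: "bij \<phi>" and S: "bounded S"
  shows "(\<lambda>x. f (reindex (inv \<phi>) x)) absolutely_integrable_on (reindex \<phi> ` S) \<longleftrightarrow> f absolutely_integrable_on S"
  unfolding absolutely_integrable_on_def integrable_on_def
  using has_integral_reindex_iff[OF assms, of f] has_integral_reindex_iff[OF assms, of "\<lambda>x. norm (f x)"]
  by simp

lemma integral_reindex:
  fixes f :: "real^'n \<Rightarrow> real" and \<phi> :: "'k::finite \<Rightarrow> 'n"
  assumes \<phi>: "bij \<phi>" and S: "bounded S"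
  shows "integral (reindex \<phi> ` S) (\<lambda>x. f (reindex (inv \<phi>) x)) = integral S f"
  unfolding integral_def integrable_on_def
  using has_integral_reindex_iff[OF assms, of f] by simp

lemma change_of_variables_wellorder:
  fixes f :: "real^'m::{finite,wellorder} \<Rightarrow> real" and g :: "real^'m::_ \<Rightarrow> real^'m::_"
  assumes S: "S \<in> sets lebesgue"
    and der_g: "\<And>x. x \<in> S \<Longrightarrow> (g has_derivative g' x) (at x within S)"
    and inj: "inj_on g S"
  shows "(\<lambda>x. \<bar>det (matrix (g' x))\<bar> * f (g x)) absolutely_integrable_on S \<and>
           integral S (\<lambda>x. \<bar>det (matrix (g' x))\<bar> * f (g x)) = b
     \<longleftrightarrow> f absolutely_integrable_on (g ` S) \<and> integral (g ` S) f = b"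
  using has_absolute_integral_change_of_variables [OF assms, of "\<lambda>x. vec (f x) :: real^1" "vec b"]
  unfolding absolutely_integrable_on_1_iff integral_on_1_eq
  by (simp add: vec_eq_iff)

text \<open>The two boundedness conditions let integrals over \<open>S\<close> and over its image
  pass through \<open>reindex\<close>, which works inside boxes.\<close>

lemma change_of_variables:
  fixes f :: "real^'n \<Rightarrow> real" and g :: "real^'n \<Rightarrow> real^'n"
  assumes S: "S \<in> sets lebesgue" "bounded S" "bounded (g ` S)"
    and der_g: "\<And>x. x \<in> S \<Longrightarrow> (g has_derivative g' x) (at x within S)"
    and inj: "inj_on g S"
  shows "(\<lambda>x. \<bar>det (matrix (g' x))\<bar> * f (g x)) absolutely_integrable_on S \<and>
           integral S (\<lambda>x. \<bar>det (matrix (g' x))\<bar> * f (g x)) = b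
     \<longleftrightarrow> f absolutely_integrable_on (g ` S) \<and> integral (g ` S) f = b"
proof -
  obtain \<phi> :: "'n ranked \<Rightarrow> 'n" where \<phi>: "bij \<phi>"
    using finite_same_card_bij[of "UNIV::'n ranked set" "UNIV :: 'n set"] card_ranked by auto
  define P :: "real^'n \<Rightarrow> real^'n ranked" where "P = reindex \<phi>"
  define Q :: "real^'n ranked \<Rightarrow> real^'n" where "Q = reindex (inv \<phi>)"
  have PQ [simp]: "P (Q x) = x" "Q (P y) = y" for x y
    using reindex_inv[OF \<phi>] by (simp_all add: P_def Q_def)
  have blP: "bounded_linear P" and blQ: "bounded_linear Q"
    using linear_reindex by (simp_all add: P_def Q_def linear_conv_bounded_linear[symmetric])
  define G where "G = (\<lambda>x. P (g (Q x)))"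
  define G' where "G' = (\<lambda>x h. P (g' (Q x) (Q h)))"
  \<comment> \<open>Measurability is carried to the image of \<open>S\<close> under \<open>P\<close>
    through integrability of the constant 1, which transfers under \<open>reindex\<close>.\<close>
  have "S \<in> lmeasurable"
    using S bounded_set_imp_lmeasurable by blast
  then have "(\<lambda>x::real^'n. 1::real) absolutely_integrable_on S"
    using absolutely_integrable_on_const by blast
  then have "(\<lambda>x::real^'n ranked. 1::real) integrable_on P ` S"
    using absolutely_integrable_reindex_iff[OF \<phi> S(2), of "\<lambda>x. 1"]
    by (auto simp: P_def absolutely_integrable_on_def)
  then have PS: "P ` S \<in> sets lebesgue"
    by (simp add: integrable_on_const lmeasurable_iff_integrable_on fmeasurableD)
  have derG: "(G has_derivative G' x) (at x within P ` S)" if "x \<in> P ` S" for x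
  proof -
    have Q: "(Q has_derivative Q) (at x within P ` S)"
      by (rule bounded_linear_imp_has_derivative[OF blQ])
    have "Q x \<in> S" "Q ` P ` S = S" using that by (auto simp: image_comp)
    then have "(g has_derivative g' (Q x)) (at (Q x) within Q ` P ` S)"
      using der_g by simp
    from diff_chain_within[OF Q this] have "((\<lambda>x. g (Q x)) has_derivative (\<lambda>h. g' (Q x) (Q h))) (at x within P ` S)"
      by (simp add: o_def)
    from bounded_linear.has_derivative[OF blP this] show ?thesis
      unfolding G_def G'_def .
  qed
  have injG: "inj_on G (P ` S)"
    unfolding G_def using inj by (auto simp: inj_on_def) (metis PQ)
  \<comment> \<open>\<open>P\<close> and \<open>Q\<close> permute coordinates, so the matrix of
    \<open>G' x\<close> arises from that of \<open>g' (Q x)\<close> by renumbering rows and columns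
    alike.\<close>
  have det: "det (matrix (G' x)) = det (matrix (g' (Q x)))" for x
  proof -
    have axis: "Q (axis k 1) = axis (\<phi> k) 1" for k
      using \<phi> by (auto simp: Q_def vec_eq_iff axis_def bij_is_inj bij_is_surj surj_f_inv_f)
    have "matrix (G' x) = (\<chi> i j. matrix (g' (Q x)) $ \<phi> i $ \<phi> j)"
      by (simp add: matrix_def G'_def vec_eq_iff axis) (simp add: P_def)
    then show ?thesis using det_reindex[OF \<phi>] by metis
  qed
  have GPS: "G ` P ` S = P ` g ` S"
    by (auto simp: G_def image_comp)
  let ?h = "\<lambda>x. \<bar>det (matrix (g' x))\<bar> * f (g x)"
  have "(\<lambda>x. \<bar>det (matrix (G' x))\<bar> * f (Q (G x))) absolutely_integrable_on P ` S \<and>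
           integral (P ` S) (\<lambda>x. \<bar>det (matrix (G' x))\<bar> * f (Q (G x))) = b
     \<longleftrightarrow> (\<lambda>x. f (Q x)) absolutely_integrable_on (G ` P ` S) \<and> integral (G ` P ` S) (\<lambda>x. f (Q x)) = b"
    by (rule change_of_variables_wellorder[OF PS derG injG])
  moreover have "(\<lambda>x. \<bar>det (matrix (G' x))\<bar> * f (Q (G x))) = (\<lambda>x. ?h (Q x))"
    by (simp add: det G_def)
  ultimately show ?thesis
    using absolutely_integrable_reindex_iff[OF \<phi> S(2), of ?h] integral_reindex[OF \<phi> S(2), of ?h]
      absolutely_integrable_reindex_iff[OF \<phi> S(3), of f] integral_reindex[OF \<phi> S(3), of f]
    unfolding GPS P_def[symmetric] Q_def[symmetric] by simp
qed

section \<open>Quantisation of the unit cube\<close>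

lemma integral_affine_image:
  fixes f :: "real^'n \<Rightarrow> real" and M :: "real^'n^'n"
  assumes X: "X \<in> sets lebesgue" "bounded X" and M: "invertible M"
    and f: "(\<lambda>y. f (a + M *v y)) absolutely_integrable_on X"
  shows "f absolutely_integrable_on (\<lambda>y. a + M *v y) ` X"
    and "integral ((\<lambda>y. a + M *v y) ` X) f = \<bar>det M\<bar> * integral X (\<lambda>y. f (a + M *v y))"
proof -
  let ?g = "\<lambda>y. a + M *v y"
  have bl: "bounded_linear (\<lambda>y. M *v y)"
    by (simp add: linear_conv_bounded_linear[symmetric] matrix_vector_mul_linear)
  have der: "(?g has_derivative (\<lambda>h. M *v h)) (at x within X)" for x
    by (rule has_derivative_add_const[OF bounded_linear_imp_has_derivative[OF bl], of a, unfolded add.commute[of _ a]])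
  have inj: "inj_on ?g X"
    using inj_matrix_vector_mult[OF M] by (auto simp: inj_on_def)
  have bd: "bounded (?g ` X)"
  proof -
    have "?g ` X = (+) a ` ((*v) M ` X)" by auto
    then show ?thesis
      using bounded_translation[OF bounded_linear_image[OF X(2) bl]] by simp
  qed
  have dm: "det (matrix (\<lambda>h. M *v h)) = det M" by simp
  have "(\<lambda>x. \<bar>det M\<bar> * f (?g x)) absolutely_integrable_on X"
    using f by (simp add: set_integrable_mult_right)
  then have "f absolutely_integrable_on ?g ` X \<and> integral (?g ` X) f = integral X (\<lambda>x. \<bar>det M\<bar> * f (?g x))"
    using change_of_variables[OF X bd der inj, of f] unfolding dm by blast
  then show "f absolutely_integrable_on ?g ` X" "integral (?g ` X) f = \<bar>det M\<bar> * integral X (\<lambda>y. f (?g y))"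
    by simp_all
qed

lemma integral_le_sum_cover:
  fixes f :: "'a::euclidean_space \<Rightarrow> real"
  assumes I: "finite I" and S: "S \<subseteq> (\<Union>i\<in>I. V i)"
    and f: "f integrable_on S" "\<And>i. i \<in> I \<Longrightarrow> f integrable_on V i"
    and nn: "\<And>i x. i \<in> I \<Longrightarrow> x \<in> V i \<Longrightarrow> 0 \<le> f x"
  shows "integral S f \<le> (\<Sum>i\<in>I. integral (V i) f)"
proof -
  let ?r = "\<lambda>S x. if x \<in> S then f x else 0"
  have "integral UNIV (?r S) \<le> integral UNIV (\<lambda>x. \<Sum>i\<in>I. ?r (V i) x)"
  proof (rule integral_le)
    show "?r S integrable_on UNIV" using f(1) by (simp add: integrable_restrict_UNIV)
    show "(\<lambda>x. \<Sum>i\<in>I. ?r (V i) x) integrable_on UNIV"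
      using f(2) I by (intro integrable_sum) (simp_all add: integrable_restrict_UNIV)
    fix x
    show "?r S x \<le> (\<Sum>i\<in>I. ?r (V i) x)"
    proof (cases "x \<in> S")
      case True
      then obtain i where i: "i \<in> I" "x \<in> V i" using S by auto
      have "?r (V i) x \<le> (\<Sum>i\<in>I. ?r (V i) x)"
        by (rule member_le_sum[OF i(1)]) (use nn I in auto)
      then show ?thesis using i True by simp
    qed (auto intro!: sum_nonneg nn)
  qed
  also have "\<dots> = (\<Sum>i\<in>I. integral (V i) f)"
    using f(2) I by (subst integral_sum) (simp_all add: integrable_restrict_UNIV integral_restrict_UNIV)
  finally show ?thesis by (simp add: integral_restrict_UNIV)
qed

lemma integral_le_remainder_plus_sum_cover:
  fixes f :: "'a::euclidean_space \<Rightarrow> real"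
  assumes I: "finite I" and S: "S \<subseteq> Y \<union> (\<Union>i\<in>I. V i)"
    and f: "f integrable_on S" "f integrable_on Y" "\<And>i. i \<in> I \<Longrightarrow> f integrable_on V i"
    and nn: "\<And>x. x \<in> Y \<Longrightarrow> 0 \<le> f x" "\<And>i x. i \<in> I \<Longrightarrow> x \<in> V i \<Longrightarrow> 0 \<le> f x"
  shows "integral S f \<le> integral Y f + (\<Sum>i\<in>I. integral (V i) f)"
proof -
  \<comment> \<open>The index \<open>None\<close> stands for the remainder \<open>Y\<close>, which
    reduces the claim to the plain covering estimate.\<close>
  let ?V = "\<lambda>j. case j of None \<Rightarrow> Y | Some i \<Rightarrow> V i"
  have "integral S f \<le> (\<Sum>j\<in>insert None (Some ` I). integral (?V j) f)"
  proof (rule integral_le_sum_cover)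
    show "S \<subseteq> (\<Union>j\<in>insert None (Some ` I). ?V j)" using S by fastforce
  qed (use I f nn in auto)
  also have "\<dots> = integral Y f + (\<Sum>i\<in>I. integral (V i) f)"
    using I by (simp add: sum.reindex)
  finally show ?thesis .
qed

lemma sum_integral_le_disjoint:
  fixes f :: "'a::euclidean_space \<Rightarrow> real"
  assumes I: "finite I" and S: "\<And>i. i \<in> I \<Longrightarrow> V i \<subseteq> S" and disj: "disjoint_family_on V I"
    and f: "f integrable_on S" "\<And>i. i \<in> I \<Longrightarrow> f integrable_on V i"
    and nn: "\<And>x. x \<in> S \<Longrightarrow> 0 \<le> f x"
  shows "(\<Sum>i\<in>I. integral (V i) f) \<le> integral S f"
proof -
  let ?r = "\<lambda>S x. if x \<in> S then f x else 0"
  have "(\<Sum>i\<in>I. integral (V i) f) = integral UNIV (\<lambda>x. \<Sum>i\<in>I. ?r (V i) x)"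
    using f(2) I by (subst integral_sum) (simp_all add: integrable_restrict_UNIV integral_restrict_UNIV)
  also have "\<dots> \<le> integral UNIV (?r S)"
  proof (rule integral_le)
    show "?r S integrable_on UNIV" using f(1) by (simp add: integrable_restrict_UNIV)
    show "(\<lambda>x. \<Sum>i\<in>I. ?r (V i) x) integrable_on UNIV"
      using f(2) I by (intro integrable_sum) (simp_all add: integrable_restrict_UNIV)
    fix x
    show "(\<Sum>i\<in>I. ?r (V i) x) \<le> ?r S x"
    proof (cases "\<exists>i\<in>I. x \<in> V i")
      case True
      then obtain i where i: "i \<in> I" "x \<in> V i" by auto
      have "x \<notin> V j" if "j \<in> I - {i}" for j
        using disj that i unfolding disjoint_family_on_def by blast
      then have "(\<Sum>j\<in>I - {i}. ?r (V j) x) = 0" by (intro sum.neutral) auto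
      then show ?thesis using i S[OF i(1)] I by (auto simp: sum.remove)
    next
      case False
      then have "(\<Sum>i\<in>I. ?r (V i) x) = 0" by (intro sum.neutral) auto
      then show ?thesis using nn by auto
    qed
  qed
  finally show ?thesis by (simp add: integral_restrict_UNIV)
qed

text \<open>Hoelder's inequality: the summed cost is least when \<open>m i\<close> is proportional
  to \<open>b i\<close>. Each summand is bounded below by means of the tangent of
  \<open>t powr (-r)\<close> at t = 1, where \<open>t\<close> is the ratio of \<open>m i\<close> to
  its proportional share M * b i / B.\<close>

lemma power_mean_sum:
  fixes b m :: "'i \<Rightarrow> real"
  assumes I: "finite I" and b: "\<And>i. i \<in> I \<Longrightarrow> b i > 0" and m: "\<And>i. i \<in> I \<Longrightarrow> m i > 0"
    and M: "(\<Sum>i\<in>I. m i) \<le> M" "M > 0" and r: "r > 0"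
  shows "(\<Sum>i\<in>I. b i) powr (1 + r) * M powr (-r) \<le> (\<Sum>i\<in>I. b i powr (1 + r) * m i powr (-r))"
proof (cases "I = {}")
  case False
  define B where "B = (\<Sum>i\<in>I. b i)"
  have B: "B > 0" unfolding B_def using I False b by (intro sum_pos) auto
  have pt: "(B / M) powr r * (b i * (1 + r) - r * m i * (B / M)) \<le> b i powr (1 + r) * m i powr (-r)" if i: "i \<in> I" for i
  proof -
    define t where "t = m i * B / (M * b i)"
    have t: "t > 0" using b[OF i] m[OF i] B M by (simp add: t_def)
    \<comment> \<open>The inequalities \<open>ln t \<le> t - 1\<close> and
      \<open>1 + x \<le> exp x\<close> at x = -r * ln t combine to the tangent bound for the convex
      power.\<close>
    have "1 - r * (t - 1) \<le> 1 + (-r) * ln t"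
      using ln_le_minus_one[OF t] r by (simp add: mult_left_mono)
    also have "\<dots> \<le> t powr (-r)"
      using t exp_ge_add_one_self[of "-r * ln t"] by (simp add: powr_def)
    finally have "1 + r - r * t \<le> t powr (-r)" by (simp add: algebra_simps)
    then have "(B / M) powr r * b i * (1 + r - r * t) \<le> (B / M) powr r * b i * t powr (-r)"
      using b[OF i] by (intro mult_left_mono) auto
    also have "t powr (-r) = m i powr (-r) * (B / M) powr (-r) * b i powr r"
    proof -
      have "t = m i * (B / M) / b i" by (simp add: t_def)
      then have "t powr (-r) = (m i * (B / M)) powr (-r) / b i powr (-r)"
        using b[OF i] m[OF i] B M by (simp only: powr_divide)
      then show ?thesis
        using b[OF i] m[OF i] B M by (simp add: powr_mult powr_minus divide_inverse)
    qed
    also have "(B / M) powr r * b i * (m i powr (-r) * (B / M) powr (-r) * b i powr r)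
         = b i powr (1 + r) * m i powr (-r)"
      using b[OF i] B M by (simp add: powr_add powr_minus field_simps)
    finally have "(B / M) powr r * b i * (1 + r - r * t) \<le> b i powr (1 + r) * m i powr (-r)" .
    moreover have "b i * t = m i * (B / M)"
      using b[OF i] M by (simp add: t_def)
    then have "b i * (1 + r - r * t) = b i * (1 + r) - r * m i * (B / M)"
      by (metis (no_types, opaque_lifting) mult.assoc mult.left_commute right_diff_distrib)
    then have "(B / M) powr r * b i * (1 + r - r * t)
        = (B / M) powr r * (b i * (1 + r) - r * m i * (B / M))"
      by (simp only: mult.assoc)
    ultimately show ?thesis by simp
  qed
  have "B powr (1 + r) * M powr (-r) = (B / M) powr r * B"
    using B M by (simp add: powr_add powr_minus powr_divide field_simps)
  also have "\<dots> \<le> (B / M) powr r * (B * (1 + r) - r * (\<Sum>i\<in>I. m i) * (B / M))"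
  proof (rule mult_left_mono)
    have "r * (\<Sum>i\<in>I. m i) * (B / M) \<le> r * M * (B / M)"
      using M B r by (intro mult_right_mono mult_left_mono) auto
    then show "B \<le> B * (1 + r) - r * (\<Sum>i\<in>I. m i) * (B / M)"
      using M by (simp add: algebra_simps)
  qed simp
  also have "\<dots> = (\<Sum>i\<in>I. (B / M) powr r * (b i * (1 + r) - r * m i * (B / M)))"
  proof -
    have "(\<Sum>i\<in>I. b i * (1 + r)) = B * (1 + r)"
      unfolding B_def by (rule sum_distrib_right[symmetric])
    moreover have "(\<Sum>i\<in>I. r * m i * (B / M)) = r * (\<Sum>i\<in>I. m i) * (B / M)"
      by (simp only: sum_distrib_left sum_distrib_right)
    ultimately show ?thesis
      by (simp only: sum_distrib_left[symmetric] sum_subtractf)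
  qed
  also have "\<dots> \<le> (\<Sum>i\<in>I. b i powr (1 + r) * m i powr (-r))"
    by (rule sum_mono) (rule pt)
  finally show ?thesis by (simp add: B_def)
qed auto

section \<open>Quantisation error and Zador's constant\<close>

definition ucube :: "(real^'n) set" where
  "ucube = cbox 0 (\<chi> i. 1)"

definition min_dist_powr :: "real \<Rightarrow> (real^'n) set \<Rightarrow> real^'n \<Rightarrow> real" where
  "min_dist_powr p S x = Min ((\<lambda>s. norm (x - s) powr (2 * p)) ` S)"

definition qerr :: "real \<Rightarrow> (real^'n) set \<Rightarrow> real" where
  "qerr p S = integral ucube (min_dist_powr p S)"

definition qmin :: "real \<Rightarrow> nat \<Rightarrow> 'n::finite itself \<Rightarrow> real" where
  "qmin p m _ = Inf (qerr p ` {S::(real^'n) set. S \<subseteq> ucube \<and> finite S \<and> card S = m})"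

lemma zador_delta_qmin:
  "zador_delta p TYPE('n) = lim (\<lambda>m. real m powr (2 * p / real CARD('n)) * qmin p m TYPE('n::finite))"
  unfolding zador_delta_def qmin_def qerr_def[abs_def] ucube_def min_dist_powr_def[abs_def] ..

lemma ucube_basics:
  "compact (ucube :: (real^'n) set)" "convex (ucube :: (real^'n) set)" "(ucube :: (real^'n) set) \<noteq> {}"
  "(0::real^'n) \<in> ucube" "(ucube :: (real^'n) set) \<in> sets lebesgue" "bounded (ucube :: (real^'n) set)"
  "infinite (ucube :: (real^'n) set)" "measure lebesgue (ucube :: (real^'n) set) = 1"
proof -
  show 0: "(0::real^'n) \<in> ucube" by (simp add: ucube_def mem_box_cart)
  show "infinite (ucube :: (real^'n) set)"
  proof
    assume "finite (ucube :: (real^'n) set)"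
    moreover have "(\<lambda>t::real. (\<chi> i. t) :: real^'n) ` {0..1} \<subseteq> ucube"
      by (auto simp: ucube_def mem_box_cart)
    moreover have "inj_on (\<lambda>t::real. (\<chi> i. t) :: real^'n) {0..1}"
      by (auto simp: inj_on_def vec_eq_iff)
    ultimately have "finite {0..1::real}" using finite_imageD finite_subset by blast
    then show False by (simp add: infinite_Icc)
  qed
  show "measure lebesgue (ucube :: (real^'n) set) = 1"
    using 0 content_cbox_cart[of "0::real^'n" "\<chi> i. 1"] unfolding ucube_def by auto
qed (auto simp: ucube_def interval_ne_empty_cart)

lemma min_dist_powr_le:
  "finite S \<Longrightarrow> s \<in> S \<Longrightarrow> min_dist_powr p S x \<le> norm (x - s) powr (2 * p)"
  unfolding min_dist_powr_def by (intro Min_le) auto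

lemma min_dist_powr_ge:
  assumes "finite S" "S \<noteq> {}" "\<And>s. s \<in> S \<Longrightarrow> c \<le> norm (x - s) powr (2 * p)"
  shows "c \<le> min_dist_powr p S x"
  unfolding min_dist_powr_def using assms by (intro Min.boundedI) auto

lemma min_dist_powr_nonneg: "finite S \<Longrightarrow> S \<noteq> {} \<Longrightarrow> 0 \<le> min_dist_powr p S x"
  by (intro min_dist_powr_ge) auto

lemma min_dist_powr_mono:
  assumes "finite S" "finite T" "T \<noteq> {}" "p > 0"
    and "\<And>t. t \<in> T \<Longrightarrow> \<exists>s\<in>S. norm (x - s) \<le> norm (x - t)"
  shows "min_dist_powr p S x \<le> min_dist_powr p T x"
proof (rule min_dist_powr_ge)
  fix t assume "t \<in> T"
  then obtain s where s: "s \<in> S" "norm (x - s) \<le> norm (x - t)" using assms by blast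
  have "norm (x - s) powr (2 * p) \<le> norm (x - t) powr (2 * p)"
    using s assms by (intro powr_mono2) auto
  then show "min_dist_powr p S x \<le> norm (x - t) powr (2 * p)"
    using min_dist_powr_le[OF assms(1) s(1), of p x] by simp
qed (use assms in auto)

lemma continuous_on_min_dist_powr:
  fixes S :: "(real^'n) set"
  assumes "finite S" "S \<noteq> {}" "p > 0"
  shows "continuous_on T (min_dist_powr p S)"
  using assms(1,2)
proof (induction rule: finite_ne_induct)
  case (singleton s)
  then show ?case
    unfolding min_dist_powr_def[abs_def] using assms(3) by (auto intro!: continuous_intros continuous_on_powr')
next
  case (insert s F)
  have "min_dist_powr p (insert s F) = (\<lambda>x. min (norm (x - s) powr (2 * p)) (min_dist_powr p F x))"
    using insert(1,2) by (simp add: min_dist_powr_def fun_eq_iff)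
  then show ?case
    using insert assms(3) by (auto intro!: continuous_intros continuous_on_powr' continuous_on_min)
qed

lemma min_dist_powr_integrable:
  fixes S :: "(real^'n) set"
  assumes "finite S" "S \<noteq> {}" "p > 0"
  shows "min_dist_powr p S integrable_on cbox a b" "min_dist_powr p S absolutely_integrable_on cbox a b"
    "min_dist_powr p S integrable_on ucube" "min_dist_powr p S absolutely_integrable_on ucube"
  unfolding ucube_def
  using integrable_continuous[OF continuous_on_min_dist_powr[OF assms]]
    absolutely_integrable_continuous[OF continuous_on_min_dist_powr[OF assms]] by auto

lemma qerr_nonneg: "finite S \<Longrightarrow> S \<noteq> {} \<Longrightarrow> p > 0 \<Longrightarrow> 0 \<le> qerr p S"
  unfolding qerr_def ucube_def
  by (intro integral_nonneg min_dist_powr_integrable min_dist_powr_nonneg)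

lemma qerr_mono:
  fixes S T :: "(real^'n) set"
  assumes "finite S" "S \<noteq> {}" "finite T" "T \<noteq> {}" "p > 0"
    and "\<And>x t. x \<in> ucube \<Longrightarrow> t \<in> T \<Longrightarrow> \<exists>s\<in>S. norm (x - s) \<le> norm (x - t)"
  shows "qerr p S \<le> qerr p T"
  using assms unfolding qerr_def ucube_def
  by (intro integral_le min_dist_powr_integrable min_dist_powr_mono) auto

text \<open>Projecting points to the cube does not increase their distance from points of the cube,
  because the projection is 1-Lipschitz and fixes the cube. Points can be added to reach cardinality
  \<open>m\<close>, as the cube is infinite. Hence competitors may lie anywhere and may be fewer
  than \<open>m\<close>.\<close>

lemma qmin_le_qerr:
  fixes S :: "(real^'n) set"
  assumes S: "finite S" "S \<noteq> {}" "card S \<le> m" and p: "p > 0"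
  shows "qmin p m TYPE('n) \<le> qerr p S"
proof -
  let ?c = "closest_point (ucube :: (real^'n) set)"
  have cl: "closed (ucube :: (real^'n) set)" using ucube_basics(1) compact_imp_closed by blast
  define S1 where "S1 = ?c ` S"
  have S1: "finite S1" "S1 \<noteq> {}" "card S1 \<le> m" "S1 \<subseteq> ucube"
    using S card_image_le[OF S(1), of ?c] closest_point_in_set[OF cl ucube_basics(3)]
    by (auto simp: S1_def)
  have "infinite (ucube - S1)" using S1 ucube_basics(7) by simp
  then obtain T where T: "T \<subseteq> ucube - S1" "finite T" "card T = m - card S1"
    using infinite_arbitrarily_large by metis
  have adm: "S1 \<union> T \<subseteq> ucube \<and> finite (S1 \<union> T) \<and> card (S1 \<union> T) = m"
    using S1 T by (subst card_Un_disjoint) auto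
  have "m \<noteq> 0" using S1 by auto
  have "qmin p m TYPE('n) \<le> qerr p (S1 \<union> T)"
    unfolding qmin_def
  proof (rule cInf_lower)
    show "bdd_below (qerr p ` {S::(real^'n) set. S \<subseteq> ucube \<and> finite S \<and> card S = m})"
      using \<open>m \<noteq> 0\<close> p by (intro bdd_belowI[of _ 0]) (auto intro!: qerr_nonneg)
  qed (use adm in auto)
  also have "\<dots> \<le> qerr p S"
  proof (rule qerr_mono)
    fix x t assume x: "x \<in> (ucube :: (real^'n) set)" and t: "t \<in> S"
    have "dist (?c x) (?c t) \<le> dist x t"
      by (rule closest_point_lipschitz[OF ucube_basics(2) cl ucube_basics(3)])
    then have "norm (x - ?c t) \<le> norm (x - t)"
      using closest_point_self[OF x] by (simp add: dist_norm)
    then show "\<exists>s\<in>S1 \<union> T. norm (x - s) \<le> norm (x - t)"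
      using t by (auto simp: S1_def)
  qed (use S S1 T p in auto)
  finally show ?thesis .
qed

lemma qmin_admissible_nonempty:
  "{S::(real^'n) set. S \<subseteq> ucube \<and> finite S \<and> card S = m} \<noteq> {}"
  using infinite_arbitrarily_large[OF ucube_basics(7), of m] by blast

lemma qmin_nonneg: "m > 0 \<Longrightarrow> p > 0 \<Longrightarrow> 0 \<le> qmin p m TYPE('n::finite)"
  unfolding qmin_def using qmin_admissible_nonempty
  by (intro cInf_greatest) (auto intro!: qerr_nonneg)

lemma qmin_antimono:
  assumes "0 < m" "m \<le> m'" "p > 0"
  shows "qmin p m' TYPE('n::finite) \<le> qmin p m TYPE('n)"
  unfolding qmin_def[of p m]
  using assms qmin_admissible_nonempty by (intro cInf_greatest) (auto intro!: qmin_le_qerr)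

lemma mat_vector_mult: "(mat t :: real^'n^'n) *v y = t *\<^sub>R y"
  by (simp add: vec_eq_iff matrix_vector_mult_def mat_def if_distrib if_distribR cong: if_cong)

lemma det_mat: "det (mat t :: real^'n^'n) = t ^ CARD('n)"
  by (subst det_diagonal) (auto simp: mat_def)

lemma invertible_mat: "t \<noteq> 0 \<Longrightarrow> invertible (mat t :: real^'n^'n)"
  by (simp add: invertible_det_nz det_mat)

lemma min_dist_powr_affine:
  fixes S :: "(real^'n) set" and p :: real
  assumes t: "t > 0" and S: "finite S" "S \<noteq> {}"
  shows "min_dist_powr p ((\<lambda>s. a + t *\<^sub>R s) ` S) (a + t *\<^sub>R y) = t powr (2 * p) * min_dist_powr p S y"
proof -
  have eq: "norm (a + t *\<^sub>R y - (a + t *\<^sub>R s)) powr (2 * p) = t powr (2 * p) * norm (y - s) powr (2 * p)" for s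
  proof -
    have "norm (a + t *\<^sub>R y - (a + t *\<^sub>R s)) = t * norm (y - s)"
      using t by (simp add: scaleR_diff_right[symmetric])
    then show ?thesis using t by (simp add: powr_mult)
  qed
  have "mono (\<lambda>v. t powr (2 * p) * v)" by (intro monoI mult_left_mono) auto
  from mono_Min_commute[OF this, of "(\<lambda>s. norm (y - s) powr (2 * p)) ` S"]
  show ?thesis using S unfolding min_dist_powr_def image_image eq by simp
qed

text \<open>The exponent collects the dimension from the Jacobian and 2 * p from the homogeneity of
  the distance.\<close>

lemma integral_min_dist_powr_scale:
  fixes S :: "(real^'n) set" and p :: real
  assumes t: "t > 0" and S: "finite S" "S \<noteq> {}" and p: "p > 0"
  shows "integral ((\<lambda>y. a + t *\<^sub>R y) ` ucube) (min_dist_powr p ((\<lambda>s. a + t *\<^sub>R s) ` S))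
    = t powr (CARD('n) + 2 * p) * qerr p S" (is "?L = _")
proof -
  let ?S = "(\<lambda>s. a + t *\<^sub>R s) ` S"
  have "?L = t ^ CARD('n) * integral ucube (\<lambda>y. min_dist_powr p ?S (a + t *\<^sub>R y))"
    using integral_affine_image(2)[OF ucube_basics(5,6) invertible_mat, of t "min_dist_powr p ?S" a] t
      min_dist_powr_integrable(2)[OF S p]
    by (simp add: mat_vector_mult det_mat min_dist_powr_affine[OF t S] ucube_def)
  also have "\<dots> = t powr (CARD('n) + 2 * p) * qerr p S"
    using t by (simp add: min_dist_powr_affine[OF t S] qerr_def powr_add powr_realpow)
  finally show ?thesis .
qed

lemma affine_image_ucube:
  fixes a :: "real^'n"
  assumes "t > 0"
  shows "(\<lambda>y. a + t *\<^sub>R y) ` ucube = cbox a (a + t *\<^sub>R (\<chi> i. 1))"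
proof -
  have "cbox 0 (\<chi> i. 1) \<noteq> ({} :: (real^'n) set)" by (simp add: interval_ne_empty_cart)
  then show ?thesis
    unfolding ucube_def using assms image_affinity_cbox[of t a 0 "(\<chi> i. 1) :: real^'n"] by (simp add: add.commute)
qed

text \<open>The cube is cut into k^n subcubes of side 1/k, each with a scaled copy of
  \<open>S\<close>. The k^n errors, each smaller by the factor k^(-(n + 2p)), add up to k^(-2p)
  times the error of \<open>S\<close>.\<close>

lemma qmin_self_similar:
  assumes k: "k > 0" and m: "m > 0" and p: "p > 0"
  shows "real k powr (2 * p) * qmin p (k ^ CARD('n) * m) TYPE('n::finite) \<le> qmin p m TYPE('n)"
  unfolding qmin_def[of p m]
proof (rule cInf_greatest)
  fix v assume "v \<in> qerr p ` {S::(real^'n) set. S \<subseteq> ucube \<and> finite S \<and> card S = m}"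
  then obtain S :: "(real^'n) set" where S: "finite S" "card S = m" "v = qerr p S" by auto
  then have S': "S \<noteq> {}" using m by auto
  define J where "J = (UNIV :: 'n set) \<rightarrow>\<^sub>E {..<k}"
  define c where "c j = (\<chi> i. real (j i) / real k) " for j :: "'n \<Rightarrow> nat"
  define t where "t = 1 / real k"
  have t: "t > 0" using k by (simp add: t_def)
  have J: "finite J" "card J = k ^ CARD('n)" by (auto simp: J_def card_PiE intro: finite_PiE)
  define Sj where "Sj j = (\<lambda>s. c j + t *\<^sub>R s) ` S" for j
  define T where "T = (\<Union>j\<in>J. Sj j)"
  have Jne: "J \<noteq> {}" using J k by (metis card.empty power_eq_0_iff less_irrefl)
  have Sj: "finite (Sj j)" "Sj j \<noteq> {}" for j using S S' by (auto simp: Sj_def)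
  have T: "finite T" "T \<noteq> {}" using J Jne Sj by (auto simp: T_def)
  have "card T \<le> (\<Sum>j\<in>J. card (Sj j))" unfolding T_def by (rule card_UN_le[OF J(1)])
  also have "\<dots> \<le> (\<Sum>j\<in>J. m)" unfolding Sj_def by (intro sum_mono) (use S card_image_le in blast)
  finally have cT: "card T \<le> k ^ CARD('n) * m" using J by simp
  let ?V = "\<lambda>j. (\<lambda>y. c j + t *\<^sub>R y) ` (ucube :: (real^'n) set)"
  have cover: "ucube \<subseteq> (\<Union>j\<in>J. ?V j)"
  proof
    fix x :: "real^'n" assume x: "x \<in> ucube"
    \<comment> \<open>Points with \<open>x $ i = 1\<close> are put into the last subcube, since the
      floor would give the index k.\<close>
    define j where "j = (\<lambda>i. if x $ i = 1 then k - 1 else nat \<lfloor>real k * x $ i\<rfloor>)"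
    have xi: "0 \<le> x $ i" "x $ i \<le> 1" for i using x by (auto simp: ucube_def mem_box_cart)
    have ji: "j i < k \<and> real (j i) \<le> real k * x $ i \<and> real k * x $ i \<le> real (j i) + 1" for i
    proof (cases "x $ i = 1")
      case False
      then have "real k * x $ i < real k" using xi[of i] k by simp
      moreover have "0 \<le> real k * x $ i" using xi by simp
      ultimately show ?thesis using False unfolding j_def by (auto; linarith)
    qed (use k in \<open>auto simp: j_def\<close>)
    have "x \<in> cbox (c j) (c j + t *\<^sub>R (\<chi> i. 1))"
      unfolding mem_box_cart c_def t_def using ji k by (auto simp: field_simps)
    then have "x \<in> ?V j" using affine_image_ucube[OF t, of "c j"] by blast
    moreover have "j \<in> J" using ji by (auto simp: J_def)
    ultimately show "x \<in> (\<Union>j\<in>J. ?V j)" by blast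
  qed
  have "qmin p (k ^ CARD('n) * m) TYPE('n) \<le> qerr p T"
    by (rule qmin_le_qerr[OF T cT p])
  also have "\<dots> \<le> (\<Sum>j\<in>J. integral (?V j) (min_dist_powr p T))"
    unfolding qerr_def
    by (rule integral_le_sum_cover[OF J(1) cover])
      (auto simp: affine_image_ucube[OF t] intro!: min_dist_powr_integrable T p min_dist_powr_nonneg)
  also have "\<dots> \<le> (\<Sum>j\<in>J. integral (?V j) (min_dist_powr p (Sj j)))"
    by (intro sum_mono integral_le)
      (auto simp: affine_image_ucube[OF t] T_def
        intro!: min_dist_powr_integrable T[unfolded T_def] p Sj min_dist_powr_mono)
  also have "\<dots> = (\<Sum>j\<in>J. t powr (CARD('n) + 2 * p) * qerr p S)"
    unfolding Sj_def by (simp add: integral_min_dist_powr_scale[OF t S(1) S' p])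
  also have "\<dots> = real k powr (- 2 * p) * qerr p S"
    using k by (simp add: J t_def powr_divide powr_add powr_minus powr_realpow field_simps)
  finally show "real k powr (2 * p) * qmin p (k ^ CARD('n) * m) TYPE('n) \<le> v"
    using k S by (simp add: powr_minus field_simps)
qed (use qmin_admissible_nonempty in auto)


text \<open>With a m = m^r * qmin m, self-similarity and n * r = 2p give a (k^n * m) \<le> a m. A
  large M lies between k^n * m and (k + 1)^n * m, and by monotonicity of \<open>qmin\<close> the
  interpolation costs at most the factor ((k + 1) / k)^(2p), which tends to 1. So \<open>a\<close>
  converges to its infimum, and every term bounds the limit from above.\<close>

lemma zador_limit:
  fixes p :: real
  assumes p: "p > 0"
  defines "r \<equiv> 2 * p / real CARD('n::finite)"
  shows "(\<lambda>m. real m powr r * qmin p m TYPE('n)) \<longlonglongrightarrow> zador_delta p TYPE('n)"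
    and "m > 0 \<Longrightarrow> zador_delta p TYPE('n) \<le> real m powr r * qmin p m TYPE('n)"
    and "0 \<le> zador_delta p TYPE('n)"
proof -
  let ?n = "CARD('n)"
  define a where "a = (\<lambda>m. real m powr r * qmin p m TYPE('n))"
  define d where "d = Inf (a ` {0<..})"
  have r: "r > 0" "real ?n * r = 2 * p" using p by (auto simp: r_def)
  have a0: "0 \<le> a m" if "m > 0" for m
    using that p by (simp add: a_def qmin_nonneg)
  have bdd: "bdd_below (a ` {0<..})"
    using a0 by (intro bdd_belowI[of _ 0]) auto
  have d_le: "d \<le> a m" if "m > 0" for m
    unfolding d_def using that bdd by (intro cInf_lower) auto
  have d0: "0 \<le> d" unfolding d_def using a0 by (intro cInf_greatest) auto
  have key: "\<forall>\<^sub>F M in sequentially. a M < e" if e: "d < e" for e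
  proof -
    have "a ` {0<..} \<noteq> {}" by (simp add: greaterThan_def) (meson zero_less_one)
    then obtain m where m: "m > 0" "a m < e"
      using cInf_lessD[of "a ` {0<..}" e] e unfolding d_def by auto
    \<comment> \<open>\<open>m\<close> is nearly optimal, and \<open>K\<close> is chosen so large
      that the interpolation factor still leaves the product below \<open>e\<close>.\<close>
    have "(\<lambda>K. ((real K + 1) / real K) powr (2 * p) * a m) \<longlonglongrightarrow> 1 powr (2 * p) * a m"
    proof (intro tendsto_intros)
      have "(\<lambda>K. 1 + 1 / real K) \<longlonglongrightarrow> 1 + 0"
        by (intro tendsto_intros lim_1_over_n)
      moreover have "\<forall>\<^sub>F K in sequentially. 1 + 1 / real K = (real K + 1) / real K"
        using eventually_gt_at_top[of 0] by eventually_elim (simp add: field_simps)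
      ultimately show "(\<lambda>K. (real K + 1) / real K) \<longlonglongrightarrow> 1"
        using Lim_transform_eventually by fastforce
    qed auto
    then have "\<forall>\<^sub>F K in sequentially. ((real K + 1) / real K) powr (2 * p) * a m < e"
      using m by (intro order_tendstoD(2)) auto
    from eventually_conj[OF eventually_gt_at_top[of 0] this]
    obtain K where K: "K > 0" "((real K + 1) / real K) powr (2 * p) * a m < e"
      using eventually_happens'[OF sequentially_bot] by blast
    show ?thesis
      using eventually_ge_at_top[of "K ^ ?n * m"]
    proof eventually_elim
      case (elim M)
      \<comment> \<open>The maximum exists because \<open>k\<close> is at most k^n * m for positive
        m; it is at least \<open>K\<close> because M is at least K^n * m.\<close>
      define k where "k = (GREATEST k. k ^ ?n * m \<le> M)"
      have bound: "k' \<le> M" if "k' ^ ?n * m \<le> M" for k'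
      proof -
        have "k' \<le> k' ^ ?n" by (cases "k' = 0") (auto intro: self_le_power)
        also have "\<dots> \<le> k' ^ ?n * m" using m by simp
        finally show ?thesis using that by simp
      qed
      have k1: "k ^ ?n * m \<le> M" unfolding k_def by (rule GreatestI_nat[of _ K M]) (use elim bound in auto)
      have kK: "K \<le> k" unfolding k_def by (rule Greatest_le_nat[of _ K M]) (use elim bound in auto)
      have k2: "M < (k + 1) ^ ?n * m"
      proof (rule ccontr)
        assume "\<not> ?thesis"
        then have "k + 1 \<le> k" unfolding k_def by (intro Greatest_le_nat[of _ _ M]) (use bound in auto)
        then show False by simp
      qed
      have kpos: "k > 0" using K kK by simp
      then have pos: "0 < k ^ ?n * m" using m by simp
      have pw: "real (j ^ ?n * m) powr r = real j powr (2 * p) * real m powr r" if "j > 0" for j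
        using that by (simp add: powr_mult powr_powr r(2)[symmetric] powr_realpow[symmetric])
      have "a M \<le> real M powr r * qmin p (k ^ ?n * m) TYPE('n)"
        unfolding a_def by (intro mult_left_mono qmin_antimono pos k1 p) simp
      also have "\<dots> \<le> real ((k + 1) ^ ?n * m) powr r * qmin p (k ^ ?n * m) TYPE('n)"
        using k2 r by (intro mult_right_mono powr_mono2 qmin_nonneg pos p) linarith+
      also have "\<dots> = real (k + 1) powr (2 * p) * real m powr r * qmin p (k ^ ?n * m) TYPE('n)"
        using pw[of "k + 1"] by simp
      also have "\<dots> = (real (k + 1) / real k) powr (2 * p) * (real m powr r * (real k powr (2 * p) * qmin p (k ^ ?n * m) TYPE('n)))"
        using kpos by (simp add: powr_divide)
      also have "\<dots> \<le> (real (k + 1) / real k) powr (2 * p) * a m"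
        unfolding a_def by (intro mult_left_mono qmin_self_similar kpos m p) auto
      also have "\<dots> \<le> ((real K + 1) / real K) powr (2 * p) * a m"
      proof (intro mult_right_mono powr_mono2 a0 m)
        show "real (k + 1) / real k \<le> (real K + 1) / real K"
          using K kK kpos by (simp add: field_simps)
      qed (use p in auto)
      finally show ?case using K by simp
    qed
  qed
  have lim: "a \<longlonglongrightarrow> d"
  proof (rule order_tendstoI)
    fix e assume e: "e < d"
    show "\<forall>\<^sub>F M in sequentially. e < a M"
      by (rule eventually_mono[OF eventually_gt_at_top[of 0]]) (rule less_le_trans[OF e d_le])
  qed (rule key)
  have "zador_delta p TYPE('n) = d"
    unfolding zador_delta_qmin using limI[OF lim] unfolding a_def r_def .
  then show "(\<lambda>m. real m powr r * qmin p m TYPE('n)) \<longlonglongrightarrow> zador_delta p TYPE('n)"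
    "m > 0 \<Longrightarrow> zador_delta p TYPE('n) \<le> real m powr r * qmin p m TYPE('n)"
    "0 \<le> zador_delta p TYPE('n)"
    using lim d_le d0 by (simp_all add: a_def)
qed

section \<open>Convex functions with positive definite Hessian\<close>

lemma sym_matrix_inner:
  fixes A :: "real^'n^'n"
  assumes "transpose A = A"
  shows "x \<bullet> (A *v y) = y \<bullet> (A *v x)"
  using assms by (metis dot_lmul_matrix inner_commute vector_transpose_matrix)

text \<open>Gram-Schmidt for the inner product that \<open>A\<close> defines, adding one index at a
  time. A vector outside the span exists because fewer than n vectors cannot span.\<close>

lemma orthonormal_basis_for_form:
  fixes A :: "real^'n^'n"
  assumes sym: "transpose A = A" and pos: "\<And>v. v \<noteq> 0 \<Longrightarrow> v \<bullet> (A *v v) > 0"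
  shows "\<exists>v::'n \<Rightarrow> real^'n. \<forall>i j. v i \<bullet> (A *v v j) = (if i = j then 1 else 0)"
proof -
  have "\<exists>v::'n \<Rightarrow> real^'n. \<forall>i\<in>I. \<forall>j\<in>I. v i \<bullet> (A *v v j) = (if i = j then 1 else 0)" for I :: "'n set"
    using finite[of I]
  proof (induction I rule: finite_induct)
    case (insert k I)
    then obtain v :: "'n \<Rightarrow> real^'n" where v: "\<And>i j. i \<in> I \<Longrightarrow> j \<in> I \<Longrightarrow> v i \<bullet> (A *v v j) = (if i = j then 1 else 0)"
      by blast
    have "dim (span (v ` I)) \<le> card (v ` I)" using insert by (simp add: dim_le_card')
    also have "\<dots> \<le> card I" using insert by (simp add: card_image_le)
    also have "\<dots> < card (UNIV :: 'n set)" using insert by (intro psubset_card_mono) auto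
    finally have "span (v ` I) \<noteq> UNIV" by (metis dim_UNIV DIM_cart DIM_real mult_1_right nat_less_le)
    then obtain w where w: "w \<notin> span (v ` I)" by auto
    define w' where "w' = w - (\<Sum>i\<in>I. (v i \<bullet> (A *v w)) *\<^sub>R v i)"
    have "(\<Sum>i\<in>I. (v i \<bullet> (A *v w)) *\<^sub>R v i) \<in> span (v ` I)"
      by (intro span_sum span_scale span_base) auto
    then have "w' \<noteq> 0" using w by (auto simp: w'_def)
    then have c: "w' \<bullet> (A *v w') > 0" by (rule pos)
    have orth: "v j \<bullet> (A *v w') = 0" if j: "j \<in> I" for j
    proof -
      have "A *v w' = A *v w - (\<Sum>i\<in>I. (v i \<bullet> (A *v w)) *\<^sub>R (A *v v i))"
        unfolding w'_def
        by (simp add: matrix_vector_mult_diff_distrib linear_sum[OF matrix_vector_mul_linear] 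
            linear_scale[OF matrix_vector_mul_linear])
      then have "v j \<bullet> (A *v w') = v j \<bullet> (A *v w) - (\<Sum>i\<in>I. (v i \<bullet> (A *v w)) * (v j \<bullet> (A *v v i)))"
        by (simp add: inner_diff_right inner_sum_right)
      also have "(\<Sum>i\<in>I. (v i \<bullet> (A *v w)) * (v j \<bullet> (A *v v i))) = (\<Sum>i\<in>I. if i = j then v j \<bullet> (A *v w) else 0)"
        using v j by (intro sum.cong) auto
      finally show ?thesis using j insert by simp
    qed
    define z where "z = (1 / sqrt (w' \<bullet> (A *v w'))) *\<^sub>R w'"
    have Az: "A *v z = (1 / sqrt (w' \<bullet> (A *v w'))) *\<^sub>R (A *v w')"
      unfolding z_def by (rule linear_scale[OF matrix_vector_mul_linear])
    have z1: "z \<bullet> (A *v z) = 1" using c unfolding Az by (simp add: z_def)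
    have z2: "v j \<bullet> (A *v z) = 0" "z \<bullet> (A *v v j) = 0" if "j \<in> I" for j
      using orth[OF that] sym_matrix_inner[OF sym, of z "v j"] unfolding Az by simp_all
    have "\<forall>i\<in>insert k I. \<forall>j\<in>insert k I. (v(k := z)) i \<bullet> (A *v (v(k := z)) j) = (if i = j then 1 else 0)"
      using z1 z2 v insert(2) by auto
    then show ?case by blast
  qed simp
  from this[of UNIV] show ?thesis by simp
qed

text \<open>The columns of \<open>B\<close> are orthonormal for the form of \<open>A\<close>, that
  is, \<open>transpose B ** (A ** B)\<close> is the identity; taking determinants gives the last
  relation.\<close>

lemma normalize_form:
  fixes A :: "real^'n^'n"
  assumes sym: "transpose A = A" and pos: "\<And>v. v \<noteq> 0 \<Longrightarrow> v \<bullet> (A *v v) > 0"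
  obtains B :: "real^'n^'n" where "invertible B" "\<And>y. (B *v y) \<bullet> (A *v (B *v y)) = (norm y)\<^sup>2"
    "(det B)\<^sup>2 * det A = 1"
proof -
  obtain v :: "'n \<Rightarrow> real^'n" where v: "\<And>i j. v i \<bullet> (A *v v j) = (if i = j then 1 else 0)"
    using orthonormal_basis_for_form[OF assms] by blast
  define B :: "real^'n^'n" where "B = (\<chi> i j. v j $ i)"
  have "(transpose B ** (A ** B)) $ i $ j = v i \<bullet> (A *v v j)" for i j
    by (simp add: B_def transpose_def matrix_matrix_mult_def matrix_vector_mult_def inner_vec_def)
  then have BAB: "transpose B ** (A ** B) = mat 1"
    using v by (simp add: mat_def vec_eq_iff)
  then have "det (transpose B ** (A ** B)) = 1" by (simp add: det_I)
  then have d: "(det B)\<^sup>2 * det A = 1"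
    by (simp add: det_mul det_transpose power2_eq_square mult.commute mult.left_commute)
  then have "invertible B" by (auto simp: invertible_det_nz)
  moreover have "(B *v y) \<bullet> (A *v (B *v y)) = (norm y)\<^sup>2" for y
  proof -
    have "(B *v y) \<bullet> (A *v (B *v y)) = y \<bullet> (transpose B *v (A *v (B *v y)))"
      by (metis dot_lmul_matrix inner_commute vector_transpose_matrix transpose_transpose)
    also have "\<dots> = y \<bullet> y"
      using BAB by (simp add: matrix_vector_mul_assoc)
    finally show ?thesis by (simp add: dot_square_norm)
  qed
  ultimately show thesis using that d by blast
qed

lemma bounded_linear_matrix_vector_mult:
  "bounded_linear (\<lambda>M::real^'n^'m. M *v b)"
  unfolding linear_conv_bounded_linear[symmetric]
  by (rule linearI) (simp_all add: matrix_vector_mult_add_rdistrib scaleR_matrix_vector_assoc)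

text \<open>\<open>C\<close> stands for the interior of the domain. The Lipschitz condition enters
  as the gradient bound \<open>L\<close>; the Hessian may be unbounded near the boundary of
  \<open>C\<close>.\<close>

locale convex_C2 =
  fixes f :: "real^'n \<Rightarrow> real" and Df :: "real^'n \<Rightarrow> real^'n" and D2f :: "real^'n \<Rightarrow> real^'n^'n"
    and C :: "(real^'n) set" and L :: real
  assumes C: "open C" "convex C" "bounded C" "C \<noteq> {}"
    and C2: "C2_plus_on f Df D2f C"
    and Lip: "\<And>x. x \<in> C \<Longrightarrow> norm (Df x) \<le> L"
begin

lemma der1: "x \<in> C \<Longrightarrow> (f has_derivative (\<lambda>h. Df x \<bullet> h)) (at x)"
  and der2: "x \<in> C \<Longrightarrow> (Df has_derivative (\<lambda>h. D2f x *v h)) (at x)"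
  and contD2: "continuous_on C D2f"
  and posD2: "x \<in> C \<Longrightarrow> v \<noteq> 0 \<Longrightarrow> v \<bullet> (D2f x *v v) > 0"
  using C2 unfolding C2_plus_on_def by auto

lemma deriv_along:
  assumes "z + t *\<^sub>R h \<in> C"
  shows "((\<lambda>t. f (z + t *\<^sub>R h)) has_real_derivative Df (z + t *\<^sub>R h) \<bullet> h) (at t)"
    and "((\<lambda>t. Df (z + t *\<^sub>R h) \<bullet> k) has_real_derivative k \<bullet> (D2f (z + t *\<^sub>R h) *v h)) (at t)"
proof -
  have line: "((\<lambda>t. z + t *\<^sub>R h) has_derivative (\<lambda>s. s *\<^sub>R h)) (at t)"
    by (auto intro!: derivative_eq_intros)
  from has_derivative_compose[OF line der1[OF assms]]
  show "((\<lambda>t. f (z + t *\<^sub>R h)) has_real_derivative Df (z + t *\<^sub>R h) \<bullet> h) (at t)"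
    by (simp add: has_field_derivative_def mult_commute_abs)
  have "((\<lambda>t. Df (z + t *\<^sub>R h)) has_derivative (\<lambda>s. D2f (z + t *\<^sub>R h) *v (s *\<^sub>R h))) (at t)"
    by (rule has_derivative_compose[OF line der2[OF assms]])
  then have "((\<lambda>t. Df (z + t *\<^sub>R h) \<bullet> k) has_derivative (\<lambda>s. (D2f (z + t *\<^sub>R h) *v (s *\<^sub>R h)) \<bullet> k)) (at t)"
    by (rule has_derivative_inner_left)
  moreover have "(\<lambda>s. (D2f (z + t *\<^sub>R h) *v (s *\<^sub>R h)) \<bullet> k) = (*) (k \<bullet> (D2f (z + t *\<^sub>R h) *v h))"
    by (auto simp: linear_scale[OF matrix_vector_mul_linear] inner_commute)
  ultimately show "((\<lambda>t. Df (z + t *\<^sub>R h) \<bullet> k) has_real_derivative k \<bullet> (D2f (z + t *\<^sub>R h) *v h)) (at t)"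
    by (simp add: has_field_derivative_def)
qed

lemma taylor2:
  assumes x: "x \<in> C" and z: "z \<in> C"
  obtains t where "0 < t" "t < 1"
    "f x = f z + Df z \<bullet> (x - z) + (x - z) \<bullet> (D2f (z + t *\<^sub>R (x - z)) *v (x - z)) / 2"
proof -
  let ?h = "x - z"
  let ?d = "\<lambda>m t. if m = 0 then f (z + t *\<^sub>R ?h) else if m = 1 then Df (z + t *\<^sub>R ?h) \<bullet> ?h
      else ?h \<bullet> (D2f (z + t *\<^sub>R ?h) *v ?h)"
  have inC: "z + t *\<^sub>R ?h \<in> C" if "0 \<le> t" "t \<le> 1" for t
    using convexD[OF C(2) z x, of "1 - t" t] that by (simp add: algebra_simps)
  have "\<exists>t>0. t < 1 \<and> f (z + 1 *\<^sub>R ?h) = (\<Sum>m<2. ?d m 0 / fact m * 1 ^ m) + ?d (2::nat) t / fact 2 * 1 ^ 2"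
  proof (rule Maclaurin)
    show "\<forall>m t. m < 2 \<and> 0 \<le> t \<and> t \<le> 1 \<longrightarrow> (?d m has_real_derivative ?d (Suc m) t) (at t)"
      using deriv_along inC by (auto simp: less_2_cases_iff)
  qed auto
  then show thesis using that by (auto simp: numeral_2_eq_2)
qed

lemma tangent_le:
  assumes "x \<in> C" "z \<in> C"
  shows "f z + Df z \<bullet> (x - z) \<le> f x"
    and "x \<noteq> z \<Longrightarrow> f z + Df z \<bullet> (x - z) < f x"
proof -
  obtain t where t: "0 < t" "t < 1"
    "f x = f z + Df z \<bullet> (x - z) + (x - z) \<bullet> (D2f (z + t *\<^sub>R (x - z)) *v (x - z)) / 2"
    by (rule taylor2[OF assms])
  have "z + t *\<^sub>R (x - z) \<in> C"
    using convexD[OF C(2) assms(2,1), of "1 - t" t] t by (simp add: algebra_simps)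
  then show "x \<noteq> z \<Longrightarrow> f z + Df z \<bullet> (x - z) < f x" using posD2[of _ "x - z"] t by simp
  then show "f z + Df z \<bullet> (x - z) \<le> f x" by (cases "x = z") auto
qed

text \<open>If the gradients at \<open>x\<close> and \<open>z\<close> agree, the two strict tangent
  inequalities contradict each other when added.\<close>

lemma inj_Df: "inj_on Df C"
proof (rule inj_onI, rule ccontr)
  fix x z assume "x \<in> C" "z \<in> C" "Df x = Df z" "x \<noteq> z"
  then show False
    using tangent_le(2)[of x z] tangent_le(2)[of z x] by (simp add: inner_diff_right)
qed

text \<open>The mean value theorem is applied twice, along \<open>h\<close> and then along
  \<open>k\<close>. The left side of the equation is symmetric in \<open>h\<close> and
  \<open>k\<close>, and the symmetry of the Hessian rests on this.\<close>

lemma second_difference: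
  assumes t: "t > 0" and ball: "cball x (t * (norm h + norm k)) \<subseteq> C"
  shows "\<exists>z. dist x z \<le> t * (norm h + norm k) \<and>
    f (x + t *\<^sub>R h + t *\<^sub>R k) - f (x + t *\<^sub>R h) - f (x + t *\<^sub>R k) + f x = t\<^sup>2 * (h \<bullet> (D2f z *v k))"
proof -
  have near: "dist x (x + a *\<^sub>R h + b *\<^sub>R k) \<le> t * (norm h + norm k)" if "0 \<le> a" "a \<le> t" "0 \<le> b" "b \<le> t" for a b
  proof -
    have "norm (a *\<^sub>R h + b *\<^sub>R k) \<le> a * norm h + b * norm k"
      using that by (metis norm_triangle_le norm_scaleR abs_of_nonneg order_refl)
    also have "\<dots> \<le> t * norm h + t * norm k"
      using that by (intro add_mono mult_right_mono) auto
    finally show ?thesis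
      by (simp add: dist_norm algebra_simps norm_minus_commute)
  qed
  have inC: "x + a *\<^sub>R h + b *\<^sub>R k \<in> C" if "0 \<le> a" "a \<le> t" "0 \<le> b" "b \<le> t" for a b
    using near[OF that] ball by auto
  let ?g = "\<lambda>s. f (x + t *\<^sub>R k + s *\<^sub>R h) - f (x + s *\<^sub>R h)"
  have "\<exists>s>0. s < t \<and> ?g t - ?g 0 = (t - 0) * (Df (x + t *\<^sub>R k + s *\<^sub>R h) \<bullet> h - Df (x + s *\<^sub>R h) \<bullet> h)"
  proof (rule MVT2[OF t])
    fix s assume "0 \<le> s" "s \<le> t"
    then show "(?g has_real_derivative (Df (x + t *\<^sub>R k + s *\<^sub>R h) \<bullet> h - Df (x + s *\<^sub>R h) \<bullet> h)) (at s)"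
      using inC[of s t] inC[of s 0] t by (intro DERIV_diff deriv_along) (auto simp: algebra_simps)
  qed
  then obtain s where s: "0 < s" "s < t"
    "?g t - ?g 0 = t * (Df (x + t *\<^sub>R k + s *\<^sub>R h) \<bullet> h - Df (x + s *\<^sub>R h) \<bullet> h)" by auto
  let ?e = "\<lambda>r. Df (x + s *\<^sub>R h + r *\<^sub>R k) \<bullet> h"
  have "\<exists>r>0. r < t \<and> ?e t - ?e 0 = (t - 0) * (h \<bullet> (D2f (x + s *\<^sub>R h + r *\<^sub>R k) *v k))"
    by (rule MVT2[OF t]) (use inC s in \<open>auto intro!: deriv_along\<close>)
  then obtain r where r: "0 < r" "r < t"
    "?e t - ?e 0 = t * (h \<bullet> (D2f (x + s *\<^sub>R h + r *\<^sub>R k) *v k))" by auto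
  have "x + t *\<^sub>R k + s *\<^sub>R h = x + s *\<^sub>R h + t *\<^sub>R k" "x + t *\<^sub>R k + t *\<^sub>R h = x + t *\<^sub>R h + t *\<^sub>R k"
    by simp_all
  then show ?thesis
    using s r near[of s r] by (intro exI[of _ "x + s *\<^sub>R h + r *\<^sub>R k"]) (auto simp: power2_eq_square algebra_simps)
qed

text \<open>Schwarz's theorem, since \<open>C2_plus_on\<close> does not state symmetry. The same
  mixed second difference, divided by t^2, is the Hessian form of (h, k) at one nearby point and of
  (k, h) at another; continuity brings both close to their values at \<open>x\<close>.\<close>

lemma transpose_D2f:
  assumes x: "x \<in> C"
  shows "transpose (D2f x) = D2f x"
proof -
  have "h \<bullet> (D2f x *v k) = k \<bullet> (D2f x *v h)" for h k
  proof (rule ccontr)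
    assume ne: "h \<bullet> (D2f x *v k) \<noteq> k \<bullet> (D2f x *v h)"
    define e where "e = \<bar>h \<bullet> (D2f x *v k) - k \<bullet> (D2f x *v h)\<bar> / 2"
    have e: "e > 0" using ne by (simp add: e_def)
    have iD: "isCont D2f x" using contD2 C(1) x continuous_on_eq_continuous_at by blast
    have ic: "isCont (\<lambda>z. a \<bullet> (D2f z *v b)) x" for a b
      by (intro continuous_intros isCont_o2[OF iD] linear_continuous_at bounded_linear_matrix_vector_mult)
    obtain d1 where d1: "d1 > 0" "\<And>z. dist z x < d1 \<Longrightarrow> \<bar>h \<bullet> (D2f z *v k) - h \<bullet> (D2f x *v k)\<bar> < e"
      using ic[of h k] e unfolding continuous_at_eps_delta by (auto simp: dist_real_def)
    obtain d2 where d2: "d2 > 0" "\<And>z. dist z x < d2 \<Longrightarrow> \<bar>k \<bullet> (D2f z *v h) - k \<bullet> (D2f x *v h)\<bar> < e"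
      using ic[of k h] e unfolding continuous_at_eps_delta by (auto simp: dist_real_def)
    obtain d3 where d3: "d3 > 0" "cball x d3 \<subseteq> C"
      using C(1) x open_contains_cball by blast
    define d where "d = min d3 (min d1 d2 / 2)"
    \<comment> \<open>The factor keeps both intermediate points within \<open>d\<close> of
      \<open>x\<close>; the summand 1 excludes division by zero.\<close>
    define t where "t = d / (norm h + norm k + 1)"
    have d: "d > 0" using d1 d2 d3 by (simp add: d_def)
    have hk: "norm h + norm k + 1 > 0" by (meson add_nonneg_pos norm_ge_zero add_nonneg_nonneg zero_less_one)
    have t: "t > 0" using d hk by (simp add: t_def)
    have "t * (norm h + norm k) \<le> t * (norm h + norm k + 1)" using t by simp
    also have "\<dots> = d" using hk by (simp add: t_def)
    finally have td: "t * (norm h + norm k) \<le> d" .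
    have cb: "cball x (t * (norm h + norm k)) \<subseteq> C" "cball x (t * (norm k + norm h)) \<subseteq> C"
      using td d3 by (auto simp: d_def add.commute)
    obtain z1 where z1: "dist x z1 \<le> t * (norm h + norm k)"
      "f (x + t *\<^sub>R h + t *\<^sub>R k) - f (x + t *\<^sub>R h) - f (x + t *\<^sub>R k) + f x = t\<^sup>2 * (h \<bullet> (D2f z1 *v k))"
      using second_difference[OF t cb(1)] by blast
    obtain z2 where z2: "dist x z2 \<le> t * (norm k + norm h)"
      "f (x + t *\<^sub>R k + t *\<^sub>R h) - f (x + t *\<^sub>R k) - f (x + t *\<^sub>R h) + f x = t\<^sup>2 * (k \<bullet> (D2f z2 *v h))"
      using second_difference[OF t cb(2)] by blast
    have swap: "x + t *\<^sub>R k + t *\<^sub>R h = x + t *\<^sub>R h + t *\<^sub>R k" by simp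
    have "t\<^sup>2 * (h \<bullet> (D2f z1 *v k)) = t\<^sup>2 * (k \<bullet> (D2f z2 *v h))"
      using z1(2) z2(2)[unfolded swap] by linarith
    then have "h \<bullet> (D2f z1 *v k) = k \<bullet> (D2f z2 *v h)" using t by simp
    moreover have "dist z1 x < d1" "dist z2 x < d2"
      using z1(1) z2(1) td d1(1) d2(1) by (auto simp: d_def dist_commute add.commute)
    from d1(2)[OF this(1)] d2(2)[OF this(2)]
    have "\<bar>h \<bullet> (D2f z1 *v k) - h \<bullet> (D2f x *v k)\<bar> < e" "\<bar>k \<bullet> (D2f z2 *v h) - k \<bullet> (D2f x *v h)\<bar> < e" .
    ultimately show False unfolding e_def by (smt (verit) field_sum_of_halves)
  qed
  from this[of "axis _ 1" "axis _ 1"] have "D2f x $ i $ j = D2f x $ j $ i" for i j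
    by (simp add: matrix_vector_mult_basis inner_axis' column_def)
  then show ?thesis by (simp add: transpose_def vec_eq_iff)
qed

text \<open>The map \<open>x \<mapsto> x + Df x\<close> is expansive and has bounded range; points with nearby images have
  nearby tangents (Bronshtein--Ivanov).\<close>

lemma tangent_net:
  obtains c where "c > 0" "\<And>m. m > 0 \<Longrightarrow> \<exists>S. S \<subseteq> C \<and> finite S \<and> S \<noteq> {} \<and> card S \<le> m \<and>
    (\<forall>x\<in>C. \<exists>s\<in>S. f x - (f s + Df s \<bullet> (x - s)) \<le> c * real m powr (- 2 / real CARD('n)))"
proof -
  let ?n = "CARD('n)"
  obtain R where R: "\<And>x. x \<in> C \<Longrightarrow> norm x \<le> R" using C(3) unfolding bounded_iff by blast
  define \<rho> where "\<rho> = \<bar>R\<bar> + \<bar>L\<bar> + 1"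
  define N where "N x = x + Df x" for x
  have \<rho>: "\<rho> > 0" by (simp add: \<rho>_def)
  have Nb: "\<bar>N x $ i\<bar> < \<rho>" if "x \<in> C" for x i
  proof -
    have "\<bar>N x $ i\<bar> \<le> norm (N x)" by (rule component_le_norm_cart)
    also have "\<dots> \<le> norm x + norm (Df x)" unfolding N_def by (rule norm_triangle_ineq)
    also have "\<dots> < \<rho>" using R[OF that] Lip[OF that] by (simp add: \<rho>_def)
    finally show ?thesis .
  qed
  \<comment> \<open>The tangent at \<open>x\<close> lies below \<open>f\<close> at \<open>s\<close>,
    so the gap is at most (Df x - Df s) . (x - s); twice this is the mixed term of |N x - N
    s|^2.\<close>
  have gap: "f x - (f s + Df s \<bullet> (x - s)) \<le> (norm (N x - N s))\<^sup>2 / 2" if "x \<in> C" "s \<in> C" for x s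
  proof -
    have "f x - (f s + Df s \<bullet> (x - s)) \<le> (Df x - Df s) \<bullet> (x - s)"
      using tangent_le(1)[OF that(2,1)] by (simp add: inner_diff_left inner_diff_right)
    moreover have "(norm (N x - N s))\<^sup>2 = (norm (x - s))\<^sup>2 + (norm (Df x - Df s))\<^sup>2 + 2 * ((Df x - Df s) \<bullet> (x - s))"
      unfolding N_def power2_norm_eq_inner
      by (simp add: inner_diff_left inner_diff_right inner_add_left inner_add_right inner_commute)
    ultimately show ?thesis
      using zero_le_power2[of "norm (x - s)"] zero_le_power2[of "norm (Df x - Df s)"] by linarith
  qed
  \<comment> \<open>A grid box of side 2\<rho>/k has squared diameter 4n\<rho>^2/k^2. Rounding \<mu>
    = m^(1/n) down to \<open>k\<close> loses at most a factor 2, and \<open>gap\<close> halves the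
    squared diameter, which leaves 8n\<rho>^2/\<mu>^2.\<close>
  define c where "c = 8 * real ?n * \<rho>\<^sup>2"
  show thesis
  proof (rule that)
    show "c > 0" using \<rho> by (simp add: c_def)
    fix m :: nat assume m: "m > 0"
    define \<mu> where "\<mu> = real m powr (1 / real ?n)"
    have \<mu>1: "1 \<le> \<mu>" using m by (simp add: \<mu>_def ge_one_powr_ge_zero)
    define k where "k = nat \<lfloor>\<mu>\<rfloor>"
    have k: "1 \<le> k" "real k \<le> \<mu>" "\<mu> < real k + 1" using \<mu>1 by (auto simp: k_def le_nat_iff)
    have "real k ^ ?n \<le> \<mu> ^ ?n" using k by (intro power_mono) auto
    also have "\<dots> = real m" using m by (simp add: \<mu>_def powr_realpow[symmetric] powr_powr)
    finally have km: "k ^ ?n \<le> m" by (metis of_nat_le_iff of_nat_power)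
    define J where "J = (UNIV :: 'n set) \<rightarrow>\<^sub>E {..<k}"
    have J: "finite J" "card J = k ^ ?n" by (auto simp: J_def card_PiE intro: finite_PiE)
    \<comment> \<open>The position of \<open>N x\<close> in a grid of k^n boxes filling the cube
      from -\<rho> to \<rho>. The strict bound on the coordinates of \<open>N x\<close> keeps every
      index below k.\<close>
    define \<iota> where "\<iota> x = (\<lambda>i. nat \<lfloor>(N x $ i + \<rho>) / (2 * \<rho>) * k\<rfloor>)" for x
    have lo: "0 \<le> (N x $ i + \<rho>) / (2 * \<rho>) * k" and hi: "(N x $ i + \<rho>) / (2 * \<rho>) * k < k" if "x \<in> C" for x i
    proof -
      show "0 \<le> (N x $ i + \<rho>) / (2 * \<rho>) * k" using Nb[OF that, of i] \<rho> by (intro mult_nonneg_nonneg) auto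
      have "(N x $ i + \<rho>) / (2 * \<rho>) < 1" using Nb[OF that, of i] \<rho> by (simp add: field_simps)
      then show "(N x $ i + \<rho>) / (2 * \<rho>) * k < k" using k by (metis mult_less_cancel_right_disj mult_1 of_nat_0_less_iff less_le_trans zero_less_one)
    qed
    have \<iota>J: "\<iota> ` C \<subseteq> J"
    proof
      fix j assume "j \<in> \<iota> ` C"
      then obtain x where x: "x \<in> C" "j = \<iota> x" by auto
      have "j i < k" for i using lo[OF x(1), of i] hi[OF x(1), of i] unfolding x(2) \<iota>_def by linarith
      then show "j \<in> J" by (auto simp: J_def)
    qed
    \<comment> \<open>One representative for each grid box that \<open>N\<close> reaches, chosen in
      \<open>C\<close> because tangents exist only there.\<close>
    define S where "S = inv_into C \<iota> ` \<iota> ` C"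
    have "finite (\<iota> ` C)" using \<iota>J J finite_subset by blast
    then have "card S \<le> card (\<iota> ` C)" "finite S" by (auto simp: S_def card_image_le)
    moreover have "card (\<iota> ` C) \<le> m" using card_mono[OF J(1) \<iota>J] J km by simp
    moreover have SC: "S \<subseteq> C" by (auto simp: S_def inv_into_into)
    moreover have "S \<noteq> {}" using C(4) by (simp add: S_def)
    moreover have "\<exists>s\<in>S. f x - (f s + Df s \<bullet> (x - s)) \<le> c * real m powr (- 2 / real ?n)" if x: "x \<in> C" for x
    proof -
      define s where "s = inv_into C \<iota> (\<iota> x)"
      have s: "s \<in> S" "s \<in> C" "\<iota> s = \<iota> x" using x SC by (auto simp: s_def S_def f_inv_into_f inv_into_into)
      have comp: "\<bar>(N x - N s) $ i\<bar> \<le> 2 * \<rho> / k" for i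
      proof -
        have "nat \<lfloor>(N s $ i + \<rho>) / (2 * \<rho>) * k\<rfloor> = nat \<lfloor>(N x $ i + \<rho>) / (2 * \<rho>) * k\<rfloor>"
          using s(3) unfolding \<iota>_def by (rule fun_cong)
        then have "\<bar>(N x $ i + \<rho>) / (2 * \<rho>) * k - (N s $ i + \<rho>) / (2 * \<rho>) * k\<bar> \<le> 1"
          using lo[OF x, of i] lo[OF s(2), of i] by linarith
        moreover have "(N x $ i + \<rho>) / (2 * \<rho>) * k - (N s $ i + \<rho>) / (2 * \<rho>) * k = (N x - N s) $ i * (k / (2 * \<rho>))"
          by (simp add: field_simps add_divide_distrib diff_divide_distrib)
        ultimately have "\<bar>(N x - N s) $ i\<bar> * (k / (2 * \<rho>)) \<le> 1"
          using \<rho> by (simp add: abs_mult)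
        then show ?thesis using \<rho> k by (simp add: field_simps)
      qed
      have "(norm (N x - N s))\<^sup>2 = (\<Sum>i\<in>UNIV. ((N x - N s) $ i)\<^sup>2)"
        by (simp add: norm_vec_def L2_set_def sum_nonneg)
      also have "\<dots> \<le> (\<Sum>i\<in>(UNIV::'n set). (2 * \<rho> / k)\<^sup>2)"
        by (intro sum_mono) (use comp abs_le_square_iff[of _ "2 * \<rho> / k"] \<rho> in auto)
      also have "\<dots> = 4 * real ?n * \<rho>\<^sup>2 / (real k)\<^sup>2"
        by (simp add: power_divide power_mult_distrib)
      also have "\<dots> \<le> 4 * real ?n * \<rho>\<^sup>2 / (\<mu> / 2)\<^sup>2"
      proof (intro divide_left_mono power_mono)
        show "\<mu> / 2 \<le> real k" using k by linarith
      qed (use \<mu>1 k in auto)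
      also have "\<dots> = 2 * (c * real m powr (- 2 / real ?n))"
      proof -
        have "real m powr (- 2 / real ?n) = (real m powr (1 / real ?n)) powr (- 2)"
          by (simp add: powr_powr)
        also have "\<dots> = 1 / \<mu>\<^sup>2"
          using m by (simp add: \<mu>_def powr_minus powr_numeral divide_inverse)
        finally show ?thesis using \<mu>1 by (simp add: c_def field_simps power2_eq_square)
      qed
      finally show ?thesis using gap[OF x s(2)] s(1) by (intro bexI[of _ s]) auto
    qed
    ultimately show "\<exists>S. S \<subseteq> C \<and> finite S \<and> S \<noteq> {} \<and> card S \<le> m \<and>
        (\<forall>x\<in>C. \<exists>s\<in>S. f x - (f s + Df s \<bullet> (x - s)) \<le> c * real m powr (- 2 / real CARD('n)))"
      by (intro exI[of _ S]) auto
  qed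
qed

end

section \<open>Packing an open set by affine images of cubes\<close>

lemma integrable_on_subset_nonneg:
  fixes g :: "'a::euclidean_space \<Rightarrow> real"
  assumes "g integrable_on U" "\<And>x. x \<in> U \<Longrightarrow> 0 \<le> g x" "X \<subseteq> U" "X \<in> sets lebesgue"
  shows "g integrable_on X"
proof -
  have "g absolutely_integrable_on U" using assms(1,2) by (simp add: absolutely_integrable_on_iff_nonneg)
  then have "g absolutely_integrable_on X" by (rule set_integrable_subset[OF _ assms(4,3)])
  then show ?thesis by (simp add: absolutely_integrable_on_def)
qed

text \<open>Closed cells serve for covering, the open cells \<open>ocell\<close> for disjointness;
  they differ by a null set.\<close>

definition acell :: "real^'n \<Rightarrow> real^'n^'n \<Rightarrow> (real^'n) set" where
  "acell a M = (\<lambda>y. a + M *v y) ` ucube"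

definition ocell :: "real^'n \<Rightarrow> real^'n^'n \<Rightarrow> (real^'n) set" where
  "ocell a M = (\<lambda>y. a + M *v y) ` box 0 (\<chi> i. 1)"

lemma ocell_subset: "ocell a M \<subseteq> acell a M"
  unfolding ocell_def acell_def ucube_def by (intro image_mono box_subset_cbox)

lemma affine_continuous: "continuous_on S (\<lambda>y. a + (M::real^'n^'n) *v y)"
  by (intro continuous_intros linear_continuous_on)
    (simp add: linear_conv_bounded_linear[symmetric] matrix_vector_mul_linear)

lemma compact_acell: "compact (acell a M)"
  unfolding acell_def by (intro compact_continuous_image affine_continuous ucube_basics)

lemma convex_acell: "convex (acell a M)"
proof -
  have "acell a M = (+) a ` ((*v) M ` ucube)" by (auto simp: acell_def)
  then show ?thesis
    by (simp add: convex_translation convex_linear_image ucube_basics matrix_vector_mul_linear)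
qed

lemma open_ocell:
  assumes "invertible M"
  shows "open (ocell a M)"
proof -
  have "ocell a M = (+) a ` ((*v) M ` box 0 (\<chi> i. 1))" by (auto simp: ocell_def)
  moreover have "surj ((*v) M)"
    using assms by (simp add: matrix_left_invertible_injective invertible_right_inverse matrix_right_invertible_surjective)
  ultimately show ?thesis
    by (simp add: open_translation open_surjective_linear_image open_box matrix_vector_mul_linear)
qed

lemma negligible_acell_diff:
  fixes M :: "real^'n^'n"
  shows "negligible (acell a M - ocell a M)"
proof -
  have "negligible (ucube - box 0 (\<chi> i. 1) :: (real^'n) set)"
    unfolding ucube_def by (rule negligible_frontier_interval)
  then have "negligible ((+) a ` ((*v) M ` (ucube - box 0 (\<chi> i. 1))))"
    by (intro negligible_translation negligible_differentiable_image_negligible[OF order_refl] linear_imp_differentiable_on matrix_vector_mul_linear)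
  moreover have "acell a M - ocell a M \<subseteq> (+) a ` ((*v) M ` (ucube - box 0 (\<chi> i. 1)))"
    by (auto simp: acell_def ocell_def)
  ultimately show ?thesis using negligible_subset by blast
qed

lemma cell_volume:
  fixes M :: "real^'n^'n"
  assumes "invertible M"
  shows "integral (acell a M) (\<lambda>x. 1::real) = \<bar>det M\<bar>" "integral (ocell a M) (\<lambda>x. 1::real) = \<bar>det M\<bar>"
proof -
  have "integral (ucube :: (real^'n) set) (\<lambda>x. 1::real) = 1"
    using ucube_basics(8) lmeasure_integral[of "ucube :: (real^'n) set"] by (simp add: ucube_def)
  moreover have "(\<lambda>x::real^'n. 1::real) absolutely_integrable_on ucube"
    by (simp add: ucube_def absolutely_integrable_on_const)
  ultimately show *: "integral (acell a M) (\<lambda>x. 1::real) = \<bar>det M\<bar>"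
    unfolding acell_def using integral_affine_image(2)[OF ucube_basics(5,6) assms, of "\<lambda>x. 1" a] by simp
  have "integral (ocell a M) (\<lambda>x. 1::real) = integral (acell a M) (\<lambda>x. 1)"
    using ocell_subset[of a M]
    by (intro integral_spike_set) (auto intro!: negligible_subset[OF negligible_acell_diff[of a M]])
  with * show "integral (ocell a M) (\<lambda>x. 1::real) = \<bar>det M\<bar>" by simp
qed

lemma scaleR_invertible:
  fixes B :: "real^'n^'n"
  assumes "invertible B" "h \<noteq> 0"
  shows "invertible (h *\<^sub>R B)"
proof -
  have "h *\<^sub>R B = mat h ** B"
    by (simp add: vec_eq_iff matrix_matrix_mult_def mat_def if_distrib if_distribR cong: if_cong)
  then show ?thesis using assms by (simp add: invertible_mult invertible_mat)
qed

lemma det_scaleR: "det (h *\<^sub>R B) = h ^ CARD('n) * det (B :: real^'n^'n)"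
proof -
  have "h *\<^sub>R B = mat h ** B"
    by (simp add: vec_eq_iff matrix_matrix_mult_def mat_def if_distrib if_distribR cong: if_cong)
  then show ?thesis by (simp add: det_mul det_mat)
qed

text \<open>In the coordinates given by the inverse of \<open>B\<close> the cells are cubes, and a
  covering by dyadic cubes subordinate to a gauge makes each as small as \<open>d\<close> demands.
  There are countably many of them, so by dominated convergence finitely many leave an arbitrarily
  small mass of \<open>g\<close>.\<close>

lemma affine_cube_packing:
  fixes U :: "(real^'n) set" and B :: "real^'n^'n"
  assumes U: "open U" "bounded U" and B: "invertible B"
    and d: "\<And>x. x \<in> U \<Longrightarrow> d x > 0"
    and g: "g integrable_on U" "\<And>x. x \<in> U \<Longrightarrow> (0::real) \<le> g x" and e: "e > 0"
  obtains F :: "((real^'n) \<times> real) set" where "finite F"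
    "\<And>c h. (c, h) \<in> F \<Longrightarrow> h > 0 \<and> acell c (h *\<^sub>R B) \<subseteq> U \<and> (\<exists>x\<in>U. acell c (h *\<^sub>R B) \<subseteq> ball x (d x))"
    "disjoint_family_on (\<lambda>(c, h). ocell c (h *\<^sub>R B)) F"
    "integral (U - (\<Union>(c, h)\<in>F. acell c (h *\<^sub>R B))) g < e"
proof -
  obtain B' where B': "B' ** B = mat 1" "B ** B' = mat 1" using B by (auto simp: invertible_def)
  have B'B: "B' *v (B *v y) = y" "B *v (B' *v y) = y" for y
    using B' by (simp_all add: matrix_vector_mul_assoc)
  have blB: "bounded_linear ((*v) B)" and blB': "bounded_linear ((*v) B')"
    by (simp_all add: linear_conv_bounded_linear[symmetric] matrix_vector_mul_linear)
  define U' where "U' = (*v) B' ` U"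
  have memU': "y \<in> U' \<longleftrightarrow> B *v y \<in> U" for y
    unfolding U'_def using B'B by (metis imageE imageI)
  have "bounded U'" unfolding U'_def by (rule bounded_linear_image[OF U(2) blB'])
  then obtain R where R: "\<And>y. y \<in> U' \<Longrightarrow> norm y \<le> R" "R > 0" unfolding bounded_pos by blast
  \<comment> \<open>The enclosing box has equal sides, so its dyadic pieces are cubes.\<close>
  define K :: "real^'n" where "K = (\<chi> i. R)"
  have UK: "U' \<subseteq> cbox (-K) K"
  proof
    fix y assume "y \<in> U'"
    then have "\<bar>y $ i\<bar> \<le> R" for i using R(1)[of y] component_le_norm_cart[of y i] by linarith
    then show "y \<in> cbox (-K) K" by (auto simp: mem_box_cart K_def abs_le_iff minus_le_iff)
  qed
  have Kne: "box (-K) K \<noteq> {}" using R by (auto simp: interval_ne_empty_cart K_def)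
  \<comment> \<open>The gauge confines each cube, once mapped by \<open>B\<close>, to
    \<open>U\<close> and to the ball that \<open>d\<close> prescribes at its tag.\<close>
  define \<gamma> where "\<gamma> y = (if y \<in> U' then (*v) B -` (U \<inter> ball (B *v y) (d (B *v y))) else UNIV)" for y
  have gauge: "gauge \<gamma>"
    unfolding gauge_def
  proof
    fix y
    have "open ((*v) B -` (U \<inter> ball (B *v y) (d (B *v y))))"
      using U(1) by (intro open_vimage linear_continuous_on[OF blB] open_Int) auto
    then show "y \<in> \<gamma> y \<and> open (\<gamma> y)" using d memU' by (auto simp: \<gamma>_def)
  qed
  obtain \<D> where \<D>: "countable \<D>" "\<Union>\<D> \<subseteq> cbox (-K) K"
    "\<And>D. D \<in> \<D> \<Longrightarrow> interior D \<noteq> {} \<and> (\<exists>c d. D = cbox c d)"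
    "pairwise (\<lambda>A B. interior A \<inter> interior B = {}) \<D>"
    "\<And>D. D \<in> \<D> \<Longrightarrow> \<exists>x \<in> U' \<inter> D. D \<subseteq> \<gamma> x"
    "\<And>u v. cbox u v \<in> \<D> \<Longrightarrow> \<exists>n. \<forall>i \<in> Basis. v \<bullet> i - u \<bullet> i = (K \<bullet> i - (-K) \<bullet> i) / 2^n"
    "U' \<subseteq> \<Union>\<D>"
    using covering_lemma[OF UK Kne gauge] by metis
  have cube: "\<exists>c h. h > 0 \<and> D = cbox c (c + h *\<^sub>R (\<chi> i. 1))" if D: "D \<in> \<D>" for D
  proof -
    obtain u v where uv: "D = cbox u v" using \<D>(3)[OF D] by blast
    then obtain n where n: "\<forall>i \<in> Basis. v \<bullet> i - u \<bullet> i = (K \<bullet> i - (-K) \<bullet> i) / 2^n" using \<D>(6) D by blast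
    have "v $ i - u $ i = 2 * R / 2 ^ n" for i
      using n[rule_format, of "axis i 1"] by (simp add: cart_eq_inner_axis[symmetric] K_def)
    then have "v = u + (2 * R / 2 ^ n) *\<^sub>R (\<chi> i. 1)" by (simp add: vec_eq_iff algebra_simps)
    moreover have "2 * R / 2 ^ n > 0" using R by simp
    ultimately show ?thesis using uv by blast
  qed
  then obtain c h where ch: "\<And>D. D \<in> \<D> \<Longrightarrow> h D > 0 \<and> D = cbox (c D) (c D + h D *\<^sub>R (\<chi> i. 1))"
    by metis
  have aff: "B *v c D + (h D *\<^sub>R B) *v y = B *v (c D + h D *\<^sub>R y)" for D y
    by (simp add: matrix_vector_right_distrib scaleR_matrix_vector_assoc[symmetric] linear_scale[OF matrix_vector_mul_linear])
  have ac: "acell (B *v c D) (h D *\<^sub>R B) = (*v) B ` D" if D: "D \<in> \<D>" for D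
  proof -
    have "acell (B *v c D) (h D *\<^sub>R B) = (*v) B ` ((\<lambda>y. c D + h D *\<^sub>R y) ` ucube)"
      unfolding acell_def aff by (simp add: image_image)
    then show ?thesis using affine_image_ucube[of "h D" "c D"] ch[OF D] by simp
  qed
  have oc: "ocell (B *v c D) (h D *\<^sub>R B) \<subseteq> (*v) B ` interior D" if D: "D \<in> \<D>" for D
  proof -
    have "interior D = box (c D) (c D + h D *\<^sub>R (\<chi> i. 1))" using ch[OF D] by (metis interior_cbox)
    moreover have "(\<lambda>y. c D + h D *\<^sub>R y) ` box 0 (\<chi> i. 1) \<subseteq> box (c D) (c D + h D *\<^sub>R (\<chi> i. 1))"
      using ch[OF D] by (auto simp: mem_box_cart)
    ultimately show ?thesis unfolding ocell_def aff by (auto simp: image_image)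
  qed
  have inU: "(*v) B ` D \<subseteq> U \<and> (\<exists>x\<in>U. (*v) B ` D \<subseteq> ball x (d x))" if D: "D \<in> \<D>" for D
  proof -
    obtain x where "x \<in> U'" "D \<subseteq> \<gamma> x" using \<D>(5)[OF D] by auto
    then show ?thesis using memU' by (auto simp: \<gamma>_def)
  qed
  have Ueq: "U = (\<Union>D\<in>\<D>. (*v) B ` D)"
  proof
    show "U \<subseteq> (\<Union>D\<in>\<D>. (*v) B ` D)"
    proof
      fix x assume "x \<in> U"
      then have "B' *v x \<in> U'" by (simp add: U'_def)
      then obtain D where "D \<in> \<D>" "B' *v x \<in> D" using \<D>(7) by auto
      then show "x \<in> (\<Union>D\<in>\<D>. (*v) B ` D)" using B'B(2)[of x] by (metis UN_I imageI)
    qed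
  qed (use inU in blast)
  show thesis
  proof (cases "\<D> = {}")
    case True
    then show thesis using Ueq e by (intro that[of "{}"]) (auto simp: disjoint_family_on_def)
  next
    case False
    define D where "D n = from_nat_into \<D> n" for n
    have D: "D n \<in> \<D>" for n unfolding D_def using False by (rule from_nat_into)
    have rD: "range D = \<D>" unfolding D_def using False \<D>(1) by (simp add: range_from_nat_into)
    define X where "X n = U - (\<Union>k<n. (*v) B ` D k)" for n
    have Xm: "X n \<in> sets lebesgue" for n
    proof -
      have "compact ((*v) B ` D k)" for k
        using compact_acell[of "B *v c (D k)" "h (D k) *\<^sub>R B"] ac[OF D] by simp
      then have "closed (\<Union>k<n. (*v) B ` D k)" by (intro closed_UN) (auto intro: compact_imp_closed)
      then have "X n \<in> sets borel" unfolding X_def using U(1) by (intro sets.Diff) auto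
      then show ?thesis by (intro sets_completionI_sets) simp
    qed
    let ?g = "\<lambda>n x. if x \<in> X n then g x else 0"
    have XU: "X n \<subseteq> U" for n by (auto simp: X_def)
    have Xi: "g integrable_on X n" for n
      by (rule integrable_on_subset_nonneg[OF g XU Xm])
    have "(\<lambda>n. integral U (?g n)) \<longlonglongrightarrow> integral U (\<lambda>x. 0)"
    proof (rule dominated_convergence(2)[OF _ g(1)])
      show "?g n integrable_on U" for n using Xi XU by (simp add: integrable_restrict_Int Int_absorb2 inf.absorb1)
      show "norm (?g n x) \<le> g x" if "x \<in> U" for n x using g(2) that by auto
      show "(\<lambda>n. ?g n x) \<longlonglongrightarrow> 0" if xU: "x \<in> U" for x
      proof -
        obtain k where k: "x \<in> (*v) B ` D k" using xU Ueq rD by blast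
        have "x \<notin> X n" if "n > k" for n using k that by (auto simp: X_def)
        then have "\<forall>\<^sub>F n in sequentially. ?g n x = 0"
          by (intro eventually_mono[OF eventually_gt_at_top[of k]]) auto
        then show ?thesis by (rule tendsto_eventually)
      qed
    qed
    then have "\<forall>\<^sub>F n in sequentially. integral U (?g n) < e" using e by (intro order_tendstoD(2)) auto
    then obtain n where n: "integral U (?g n) < e" using eventually_happens'[OF sequentially_bot] by blast
    define F where "F = (\<lambda>D. (B *v c D, h D)) ` D ` {..<n}"
    have "integral (U - (\<Union>(c, h)\<in>F. acell c (h *\<^sub>R B))) g = integral (X n) g"
      unfolding F_def X_def using ac[OF D] by (simp add: image_image)
    also have "\<dots> < e" using n XU[of n] by (simp add: integral_restrict_Int Int_absorb2 inf.absorb1)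
    finally have 4: "integral (U - (\<Union>(c, h)\<in>F. acell c (h *\<^sub>R B))) g < e" .
    show thesis
    proof (rule that[OF _ _ _ 4])
      show "finite F" by (simp add: F_def)
      fix c' h' assume "(c', h') \<in> F"
      then obtain k where k: "c' = B *v c (D k)" "h' = h (D k)" by (auto simp: F_def)
      then show "h' > 0 \<and> acell c' (h' *\<^sub>R B) \<subseteq> U \<and> (\<exists>x\<in>U. acell c' (h' *\<^sub>R B) \<subseteq> ball x (d x))"
        using ch[OF D, of k] ac[OF D, of k] inU[OF D, of k] by simp
    next
      show "disjoint_family_on (\<lambda>(c, h). ocell c (h *\<^sub>R B)) F"
        unfolding disjoint_family_on_def
      proof (intro ballI impI)
        fix P Q assume PQ: "P \<in> F" "Q \<in> F" "P \<noteq> Q"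
        from PQ(1,2) obtain j k where jk: "P = (B *v c (D j), h (D j))" "Q = (B *v c (D k), h (D k))"
          unfolding F_def by blast
        then have "D j \<noteq> D k" using PQ(3) by auto
        then have "interior (D j) \<inter> interior (D k) = {}" using \<D>(4) D by (simp add: pairwise_def)
        moreover have "inj ((*v) B)" by (rule inj_matrix_vector_mult[OF B])
        ultimately have "(*v) B ` interior (D j) \<inter> (*v) B ` interior (D k) = {}"
          by (metis image_Int image_empty)
        then show "(case P of (c, h) \<Rightarrow> ocell c (h *\<^sub>R B)) \<inter> (case Q of (c, h) \<Rightarrow> ocell c (h *\<^sub>R B)) = {}"
          using oc[OF D, of j] oc[OF D, of k] jk by auto
      qed
    qed
  qed
qed

section \<open>Cells adapted to the Hessian\<close>

text \<open>The norm of a matrix is here the Frobenius norm, so Cauchy-Schwarz in each row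
  suffices.\<close>

lemma norm_matrix_vector_mult_le:
  fixes M :: "real^'n^'m"
  shows "norm (M *v v) \<le> norm M * norm v"
proof -
  have "(norm (M *v v))\<^sup>2 = (\<Sum>i\<in>UNIV. (M $ i \<bullet> v)\<^sup>2)"
    by (simp add: norm_vec_def L2_set_def sum_nonneg matrix_vector_mul_component)
  also have "\<dots> \<le> (\<Sum>i\<in>UNIV. (norm (M $ i))\<^sup>2 * (norm v)\<^sup>2)"
  proof (rule sum_mono)
    fix i
    have "\<bar>M $ i \<bullet> v\<bar> \<le> \<bar>norm (M $ i) * norm v\<bar>" using Cauchy_Schwarz_ineq2[of "M $ i" v] by simp
    then show "(M $ i \<bullet> v)\<^sup>2 \<le> (norm (M $ i))\<^sup>2 * (norm v)\<^sup>2"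
      unfolding power_mult_distrib[symmetric] by (simp only: abs_le_square_iff)
  qed
  also have "\<dots> = (norm M * norm v)\<^sup>2"
    by (simp add: norm_vec_def[of M] L2_set_def sum_nonneg power_mult_distrib sum_distrib_right)
  finally show ?thesis by (rule power2_le_imp_le) simp
qed

lemma continuous_on_det:
  fixes M :: "'a::topological_space \<Rightarrow> real^'n^'n"
  assumes "continuous_on S M"
  shows "continuous_on S (\<lambda>x. det (M x))"
  unfolding det_def by (intro continuous_intros assms)

text \<open>\<open>n\<close> and \<open>\<delta>\<close> are parameters because a constant defined from the index type alone would carry a
  type argument.\<close>

locale weighted_C2 = convex_C2 f Df D2f C L
  for f :: "real^'n \<Rightarrow> real" and Df D2f C L +
  fixes p :: real and w :: "real^'n \<Rightarrow> real" and W n \<delta> :: real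
  assumes n_eq: "n = real CARD('n)" and \<delta>_eq: "\<delta> = zador_delta p TYPE('n)" and p: "p > 0" and w_cont: "continuous_on C w" and w: "\<And>x. x \<in> C \<Longrightarrow> 0 < w x \<and> w x \<le> W"
begin

definition "q = n / (n + 2 * p)"

text \<open>The integrand of the theorem with the factor 2^(-p * q). As \<open>q\<close> is the
  inverse of 1 + 2p/n, raising the integral to the power 1 + 2p/n turns this factor into the 2^(-p)
  of the formula.\<close>

definition G :: "real^'n \<Rightarrow> real" where
  "G x = 2 powr (- p * q) * det (D2f x) powr (p / (n + 2 * p)) * w x powr q"

lemma n_pos: "n > 0" by (simp add: n_eq)

lemma normal_form:
  assumes x: "x \<in> C"
  shows "\<exists>B. invertible B \<and> (\<forall>y. (B *v y) \<bullet> (D2f x *v (B *v y)) = (norm y)\<^sup>2) \<and> (det B)\<^sup>2 * det (D2f x) = 1"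
  by (rule normalize_form[OF transpose_D2f[OF x] posD2[OF x]]) blast+

lemma det_pos:
  assumes x: "x \<in> C"
  shows "det (D2f x) > 0"
proof (rule ccontr)
  assume "\<not> det (D2f x) > 0"
  moreover obtain B :: "real^'n^'n" where "(det B)\<^sup>2 * det (D2f x) = 1"
    using normal_form[OF x] by blast
  ultimately show False using mult_nonneg_nonpos[of "(det B)\<^sup>2" "det (D2f x)"] by simp
qed

lemma q_pos: "q > 0"
  using p n_pos by (simp add: q_def)

lemma G_pos: "x \<in> C \<Longrightarrow> G x > 0"
  using det_pos[of x] w[of x] by (simp add: G_def)

lemma continuous_on_G: "continuous_on C G"
  unfolding G_def[abs_def]
  by (intro continuous_intros continuous_on_det contD2 w_cont) (use det_pos w in fastforce)+

text \<open>The determinant is the Jacobian of \<open>Df\<close>, which is injective on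
  \<open>C\<close>, so its integral is the volume of the gradient image. That image is bounded by
  the Lipschitz constant and open by invariance of domain.\<close>

lemma det_integrable: "(\<lambda>x. det (D2f x)) integrable_on C"
proof -
  have contDf: "continuous_on C Df"
    using der2 by (meson has_derivative_continuous continuous_at_imp_continuous_on)
  have op: "open (Df ` C)" by (rule invariance_of_domain[OF contDf C(1) inj_Df])
  have bd: "bounded (Df ` C)" unfolding bounded_iff using Lip by auto
  have "(\<lambda>x. 1::real) absolutely_integrable_on Df ` C"
    using op bd by (intro absolutely_integrable_on_const lmeasurable_open)
  then have "(\<lambda>x. \<bar>det (matrix ((*v) (D2f x)))\<bar> * 1) absolutely_integrable_on C"
    using change_of_variables[OF _ C(3) bd _ inj_Df, of "\<lambda>x. (*v) (D2f x)" "\<lambda>x. 1"] C(1) der2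
    by (auto intro: has_derivative_at_withinI)
  then have "(\<lambda>x. \<bar>det (D2f x)\<bar>) integrable_on C" by (simp add: absolutely_integrable_on_def)
  then show ?thesis by (rule integrable_eq) (use det_pos in force)
qed

lemma lmeasurable_C: "C \<in> lmeasurable"
  using C by (simp add: lmeasurable_open)

lemma integrable_continuous_bounded:
  fixes g :: "real^'n \<Rightarrow> real"
  assumes "continuous_on C g" "\<And>x. x \<in> C \<Longrightarrow> \<bar>g x\<bar> \<le> h x" "h integrable_on C"
  shows "g integrable_on C"
proof (rule measurable_bounded_by_integrable_imp_integrable_real[OF _ assms(3,2)])
  show "C \<in> sets lebesgue" using lmeasurable_C by auto
  then show "g \<in> borel_measurable (lebesgue_on C)"
    by (rule continuous_imp_measurable_on_sets_lebesgue[OF assms(1)])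
qed

lemma const_integrable: "(\<lambda>x. c::real) integrable_on C"
  using lmeasurable_C by (simp add: integrable_on_const)

lemma G_integrable: "G integrable_on C"
proof (rule integrable_continuous_bounded[OF continuous_on_G])
  define K where "K = 2 powr (- p * q) * W powr q"
  show "(\<lambda>x. K * (1 + det (D2f x))) integrable_on C"
    using const_integrable[of 1] det_integrable by (intro integrable_on_mult_right integrable_add)
  fix x assume x: "x \<in> C"
  \<comment> \<open>Adding 1 makes the base at least 1, so that the exponent, which is below 1, may
    be raised to 1.\<close>
  have "det (D2f x) powr (p / (n + 2 * p)) \<le> (1 + det (D2f x)) powr (p / (n + 2 * p))"
    using det_pos[OF x] p n_pos by (intro powr_mono2) auto
  also have "\<dots> \<le> (1 + det (D2f x)) powr 1"
    using det_pos[OF x] p n_pos by (intro powr_mono) (auto simp: field_simps)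
  finally have 1: "det (D2f x) powr (p / (n + 2 * p)) \<le> 1 + det (D2f x)" using det_pos[OF x] by simp
  have 2: "w x powr q \<le> W powr q" using w[OF x] q_pos by (intro powr_mono2) auto
  have "G x \<le> 2 powr (- p * q) * (1 + det (D2f x)) * W powr q"
    unfolding G_def using 1 2 det_pos[OF x] by (intro mult_mono) auto
  then show "\<bar>G x\<bar> \<le> K * (1 + det (D2f x))"
    using G_pos[OF x] by (simp add: K_def mult_ac)
qed

text \<open>A cell is \<open>(a, M, h, w0)\<close>: on the parallelepiped \<open>acell a M\<close> the function is, up to \<open>1 \<plusminus> \<epsilon>\<close>,
  a quadratic form that \<open>M\<close> pulls back to \<open>h\<^sup>2\<close> times the Euclidean one, and the weight is \<open>w0\<close>.
  The optimal number of tangents for the cell is proportional to \<open>cellb\<close>.\<close>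

definition cellb :: "real^'n^'n \<Rightarrow> real \<Rightarrow> real \<Rightarrow> real" where
  "cellb M h w0 = (w0 * (h\<^sup>2 / 2) powr p * \<bar>det M\<bar>) powr q"

definition good_cell :: "real \<Rightarrow> real^'n \<Rightarrow> real^'n^'n \<Rightarrow> real \<Rightarrow> real \<Rightarrow> bool" where
  "good_cell \<epsilon> a M h w0 \<longleftrightarrow> acell a M \<subseteq> C \<and> h > 0 \<and> w0 > 0 \<and> invertible M \<and>
    (\<forall>y\<in>ucube. \<forall>y'\<in>ucube. let x = a + M *v y; z = a + M *v y' in
       (1 - \<epsilon>) * (h\<^sup>2 / 2 * (norm (y - y'))\<^sup>2) \<le> f x - (f z + Df z \<bullet> (x - z)) \<and>
       f x - (f z + Df z \<bullet> (x - z)) \<le> (1 + \<epsilon>) * (h\<^sup>2 / 2 * (norm (y - y'))\<^sup>2)) \<and>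
    (\<forall>x\<in>acell a M. (1 - \<epsilon>) * w0 \<le> w x \<and> w x \<le> (1 + \<epsilon>) * w0) \<and>
    (\<forall>x\<in>acell a M. (1 - \<epsilon>) * cellb M h w0 \<le> \<bar>det M\<bar> * G x \<and> \<bar>det M\<bar> * G x \<le> (1 + \<epsilon>) * cellb M h w0)"

definition controlled :: "real \<Rightarrow> real^'n \<Rightarrow> real^'n \<Rightarrow> bool" where
  "controlled \<epsilon> x y \<longleftrightarrow> y \<in> C \<and>
     (\<forall>v. (1 - \<epsilon>) * (v \<bullet> (D2f x *v v)) \<le> v \<bullet> (D2f y *v v) \<and> v \<bullet> (D2f y *v v) \<le> (1 + \<epsilon>) * (v \<bullet> (D2f x *v v))) \<and>
     (1 - \<epsilon>) * w x \<le> w y \<and> w y \<le> (1 + \<epsilon>) * w x \<and> (1 - \<epsilon>) * G x \<le> G y \<and> G y \<le> (1 + \<epsilon>) * G x"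

text \<open>Continuity gives absolute bounds, but relative ones are required. The normal form bounds
  |v|^2 by \<open>K\<close> times the Hessian form at \<open>x\<close>, so an error \<epsilon> / K
  in the Hessian becomes a relative error \<epsilon>.\<close>

lemma local_control:
  assumes x: "x \<in> C" and e: "0 < \<epsilon>"
  shows "\<exists>d>0. \<forall>y\<in>ball x d. controlled \<epsilon> x y"
proof -
  obtain B :: "real^'n^'n" where B: "invertible B" "\<And>y. (B *v y) \<bullet> (D2f x *v (B *v y)) = (norm y)\<^sup>2"
    using normal_form[OF x] by blast
  obtain B' where B': "B ** B' = mat 1" using B(1) by (auto simp: invertible_def)
  define K where "K = (norm B)\<^sup>2 + 1"
  have K: "K > 0" by (simp add: K_def add_nonneg_pos)
  have vK: "(norm v)\<^sup>2 \<le> K * (v \<bullet> (D2f x *v v))" for v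
  proof -
    define y where "y = B' *v v"
    have v: "v = B *v y" using B' by (simp add: y_def matrix_vector_mul_assoc)
    have "(norm v)\<^sup>2 \<le> (norm B * norm y)\<^sup>2"
      unfolding v by (intro power_mono norm_matrix_vector_mult_le) auto
    also have "\<dots> \<le> K * (norm y)\<^sup>2" by (simp add: K_def power_mult_distrib mult_right_mono)
    finally show ?thesis using B(2)[of y] v by simp
  qed
  have at: "isCont D2f x" "isCont w x" "isCont G x"
    using contD2 w_cont continuous_on_G C(1) x continuous_on_eq_continuous_at by blast+
  obtain d1 where d1: "d1 > 0" "\<And>y. dist y x < d1 \<Longrightarrow> norm (D2f y - D2f x) < \<epsilon> / K"
    using at(1) e K unfolding continuous_at_eps_delta dist_norm by (metis divide_pos_pos)
  obtain d2 where d2: "d2 > 0" "\<And>y. dist y x < d2 \<Longrightarrow> \<bar>w y - w x\<bar> < \<epsilon> * w x"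
    using at(2) e w[OF x] unfolding continuous_at_eps_delta dist_real_def by (metis mult_pos_pos)
  obtain d3 where d3: "d3 > 0" "\<And>y. dist y x < d3 \<Longrightarrow> \<bar>G y - G x\<bar> < \<epsilon> * G x"
    using at(3) e G_pos[OF x] unfolding continuous_at_eps_delta dist_real_def by (metis mult_pos_pos)
  obtain d4 where d4: "d4 > 0" "ball x d4 \<subseteq> C" using C(1) x open_contains_ball by blast
  define d where "d = min (min d1 d2) (min d3 d4)"
  show ?thesis
    unfolding controlled_def
  proof (intro exI[of _ d] conjI ballI allI)
    show "d > 0" using d1 d2 d3 d4 by (simp add: d_def)
    fix y assume y: "y \<in> ball x d"
    show "y \<in> C" using y d4 by (auto simp: d_def)
    show "(1 - \<epsilon>) * w x \<le> w y" "w y \<le> (1 + \<epsilon>) * w x"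
      using d2(2)[of y] y by (auto simp: d_def dist_commute algebra_simps)
    show "(1 - \<epsilon>) * G x \<le> G y" "G y \<le> (1 + \<epsilon>) * G x"
      using d3(2)[of y] y by (auto simp: d_def dist_commute algebra_simps)
    fix v
    have "\<bar>v \<bullet> ((D2f y - D2f x) *v v)\<bar> \<le> norm v * norm ((D2f y - D2f x) *v v)"
      by (rule Cauchy_Schwarz_ineq2)
    also have "\<dots> \<le> norm v * (norm (D2f y - D2f x) * norm v)"
      by (intro mult_left_mono norm_matrix_vector_mult_le) auto
    also have "\<dots> \<le> norm v * (\<epsilon> / K * norm v)"
      using d1(2)[of y] y by (intro mult_left_mono mult_right_mono) (auto simp: d_def dist_commute)
    also have "\<dots> = \<epsilon> / K * (norm v)\<^sup>2" by (simp add: power2_eq_square)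
    also have "\<dots> \<le> \<epsilon> / K * (K * (v \<bullet> (D2f x *v v)))" using e K vK by (intro mult_left_mono) auto
    finally have "\<bar>v \<bullet> (D2f y *v v) - v \<bullet> (D2f x *v v)\<bar> \<le> \<epsilon> * (v \<bullet> (D2f x *v v))"
      using K by (simp add: matrix_vector_mult_diff_rdistrib inner_diff_right)
    then show "(1 - \<epsilon>) * (v \<bullet> (D2f x *v v)) \<le> v \<bullet> (D2f y *v v)" "v \<bullet> (D2f y *v v) \<le> (1 + \<epsilon>) * (v \<bullet> (D2f x *v v))"
      by (simp_all add: algebra_simps abs_le_iff)
  qed
qed

text \<open>This identity ties the allocation to the integral: \<open>cellb\<close> is the volume of
  the cell times \<open>G\<close>. The powers of h agree since (2p + n) * q = n; those of |det B|
  agree since |det B| = det (D2f x)^(-1/2) and q = 1 - 2p / (n + 2p).\<close>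

lemma cellb_eq:
  assumes x: "x \<in> C" and d: "(det B)\<^sup>2 * det (D2f x) = 1" and h: "h > 0"
  shows "cellb (h *\<^sub>R B) h (w x) = \<bar>det (h *\<^sub>R B)\<bar> * G x"
proof -
  define D where "D = \<bar>det B\<bar>"
  have D: "D > 0" using d unfolding D_def by (metis abs_0 mult_zero_left power_zero_numeral zero_less_abs_iff zero_neq_one)
  have detA: "det (D2f x) = D powr (-2)"
    using d D by (simp add: D_def powr_minus powr_numeral field_simps)
  have q1: "1 - 2 * p / (n + 2 * p) = q" "(2 * p + n) * q = n" using p n_pos by (simp_all add: q_def field_simps)
  have dM: "\<bar>det (h *\<^sub>R B)\<bar> = h powr n * D"
    using h by (simp add: det_scaleR abs_mult D_def powr_realpow n_eq)
  have h2: "(h\<^sup>2 / 2) powr p = h powr (2 * p) * 2 powr (-p)"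
  proof -
    have "h\<^sup>2 = h powr 2" using h by (simp add: powr_numeral)
    then have "(h\<^sup>2) powr p = h powr (2 * p)" by (simp only: powr_powr)
    moreover have "(h\<^sup>2 / 2) powr p = (h\<^sup>2) powr p / 2 powr p"
      by (rule powr_divide)
    ultimately show ?thesis by (simp only: powr_minus divide_inverse)
  qed
  have "cellb (h *\<^sub>R B) h (w x) = (w x * (h powr (2 * p + n) * 2 powr (-p)) * D) powr q"
  proof -
    have "w x * (h powr (2 * p) * 2 powr (-p)) * (h powr n * D) = w x * (h powr (2 * p + n) * 2 powr (-p)) * D"
      unfolding powr_add by (simp only: mult_ac)
    then show ?thesis unfolding cellb_def dM h2 by (simp only:)
  qed
  also have "\<dots> = w x powr q * h powr ((2 * p + n) * q) * 2 powr (-p * q) * D powr q"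
    using w[OF x] h D by (simp add: powr_mult powr_powr)
  also have "\<dots> = h powr n * (D powr 1 * D powr (- (2 * p / (n + 2 * p)))) * 2 powr (-p * q) * w x powr q"
  proof -
    have "D powr 1 * D powr (- (2 * p / (n + 2 * p))) = D powr q"
      using q1(1) by (simp only: powr_add[symmetric] diff_conv_add_uminus)
    then show ?thesis unfolding q1(2) by (simp only: mult_ac)
  qed
  also have "\<dots> = h powr n * D * G x"
  proof -
    have "det (D2f x) powr (p / (n + 2 * p)) = D powr (- (2 * p / (n + 2 * p)))"
      unfolding detA powr_powr by simp
    then show ?thesis using D unfolding G_def by (simp only: powr_one mult_ac less_imp_le)
  qed
  finally show ?thesis unfolding dM .
qed

text \<open>There are two levels, because one application of \<open>affine_cube_packing\<close>
  works with a single matrix. Coordinate cubes are so small that the data on each are controlled by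
  one point \<open>t Q\<close>; each cube is then packed with cells shaped by the normal form
  \<open>B (t Q)\<close>. The weight 1 + G makes the remainder small in volume and in
  \<open>G\<close>-mass at once.\<close>

lemma packing:
  assumes e: "0 < \<epsilon>" and e2: "0 < \<epsilon>2"
  obtains F where "finite F" "\<And>a M h w0. (a, M, h, w0) \<in> F \<Longrightarrow> good_cell \<epsilon> a M h w0"
    "disjoint_family_on (\<lambda>(a, M, h, w0). ocell a M) F"
    "integral (C - (\<Union>(a, M, h, w0)\<in>F. acell a M)) (\<lambda>x. 1 + G x) < \<epsilon>2"
proof -
  have "\<forall>x\<in>C. \<exists>d>0. \<forall>y\<in>ball x d. controlled \<epsilon> x y"
    using local_control[OF _ e] by blast
  then obtain d where d: "\<And>x. x \<in> C \<Longrightarrow> d x > 0" and ctl: "\<And>x y. x \<in> C \<Longrightarrow> y \<in> ball x (d x) \<Longrightarrow> controlled \<epsilon> x y"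
    by metis
  have "\<forall>x\<in>C. \<exists>B. invertible B \<and> (\<forall>y. (B *v y) \<bullet> (D2f x *v (B *v y)) = (norm y)\<^sup>2) \<and> (det B)\<^sup>2 * det (D2f x) = 1"
    using normal_form by blast
  then obtain B where B: "\<And>x. x \<in> C \<Longrightarrow> invertible (B x)"
    "\<And>x y. x \<in> C \<Longrightarrow> (B x *v y) \<bullet> (D2f x *v (B x *v y)) = (norm y)\<^sup>2"
    "\<And>x. x \<in> C \<Longrightarrow> (det (B x))\<^sup>2 * det (D2f x) = 1" by metis
  define g where "g x = 1 + G x" for x
  have gi: "g integrable_on C" unfolding g_def[abs_def] by (intro integrable_add const_integrable G_integrable)
  have g0: "0 \<le> g x" if "x \<in> C" for x using G_pos[OF that] by (simp add: g_def)
  have sub: "g integrable_on X" if "X \<subseteq> C" "X \<in> sets lebesgue" for X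
    by (rule integrable_on_subset_nonneg[OF gi g0 that])
  have I1: "invertible (mat 1 :: real^'n^'n)" by (rule invertible_mat) simp
  obtain F1 where F1: "finite F1"
    "\<And>c h. (c, h) \<in> F1 \<Longrightarrow> h > 0 \<and> acell c (h *\<^sub>R mat 1) \<subseteq> C \<and> (\<exists>x\<in>C. acell c (h *\<^sub>R mat 1) \<subseteq> ball x (d x))"
    "disjoint_family_on (\<lambda>(c, h). ocell c (h *\<^sub>R mat 1)) F1"
    "integral (C - (\<Union>(c, h)\<in>F1. acell c (h *\<^sub>R mat 1))) g < \<epsilon>2 / 2"
    by (rule affine_cube_packing[where d = d and g = g, OF C(1,3) I1 d gi g0 half_gt_zero[OF e2]]) (blast intro: that)+
  define V where "V Q = acell (fst Q) (snd Q *\<^sub>R mat 1)" for Q :: "(real^'n) \<times> real"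
  define U where "U Q = ocell (fst Q) (snd Q *\<^sub>R mat 1)" for Q :: "(real^'n) \<times> real"
  have Q: "snd Q > 0 \<and> V Q \<subseteq> C \<and> (\<exists>x\<in>C. V Q \<subseteq> ball x (d x))" if "Q \<in> F1" for Q
    using F1(2)[of "fst Q" "snd Q"] that unfolding V_def by simp
  then obtain t where t: "\<And>Q. Q \<in> F1 \<Longrightarrow> t Q \<in> C \<and> V Q \<subseteq> ball (t Q) (d (t Q))" by metis
  have UV: "U Q \<subseteq> V Q" for Q unfolding U_def V_def by (rule ocell_subset)
  have Uo: "open (U Q)" "bounded (U Q)" if "Q \<in> F1" for Q
  proof -
    show "open (U Q)" unfolding U_def using Q[OF that] by (intro open_ocell scaleR_invertible I1) auto
    show "bounded (U Q)"
      using UV compact_imp_bounded[OF compact_acell] unfolding V_def by (meson bounded_subset)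
  qed
  have Uo_sets: "U Q \<in> sets lebesgue" if "Q \<in> F1" for Q using Uo[OF that] by auto
  \<comment> \<open>Half of the budget is for the complement of the cubes, the other half is shared
    by the cubes; the summand 1 keeps the denominator positive for an empty
    \<open>F1\<close>.\<close>
  define \<epsilon>3 where "\<epsilon>3 = \<epsilon>2 / (2 * (real (card F1) + 1))"
  have e3: "\<epsilon>3 > 0" using e2 by (simp add: \<epsilon>3_def)
  have "\<exists>F2. finite F2 \<and> (\<forall>c h. (c, h) \<in> F2 \<longrightarrow> h > 0 \<and> acell c (h *\<^sub>R B (t Q)) \<subseteq> U Q) \<and>
    disjoint_family_on (\<lambda>(c, h). ocell c (h *\<^sub>R B (t Q))) F2 \<and>
    integral (U Q - (\<Union>(c, h)\<in>F2. acell c (h *\<^sub>R B (t Q)))) g < \<epsilon>3" if QF: "Q \<in> F1" for Q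
  proof -
    have UC: "U Q \<subseteq> C" using UV Q[OF QF] by blast
    have gU: "g integrable_on U Q" "\<And>x. x \<in> U Q \<Longrightarrow> 0 \<le> g x" using sub[OF UC Uo_sets[OF QF]] g0 UC by auto
    show ?thesis
    \<comment> \<open>The radius 1 is a placeholder: inside \<open>U Q\<close> the control by
      \<open>t Q\<close> already holds.\<close>
    proof (rule affine_cube_packing[where d = "\<lambda>_. 1" and g = g, OF Uo[OF QF] B(1)[OF conjunct1[OF t[OF QF]]] zero_less_one gU e3])
      fix F2 :: "((real^'n) \<times> real) set"
      assume a: "finite F2"
        "\<And>c h. (c, h) \<in> F2 \<Longrightarrow> h > 0 \<and> acell c (h *\<^sub>R B (t Q)) \<subseteq> U Q \<and> (\<exists>x\<in>U Q. acell c (h *\<^sub>R B (t Q)) \<subseteq> ball x 1)"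
        "disjoint_family_on (\<lambda>(c, h). ocell c (h *\<^sub>R B (t Q))) F2"
        "integral (U Q - (\<Union>(c, h)\<in>F2. acell c (h *\<^sub>R B (t Q)))) g < \<epsilon>3"
      show ?thesis
        by (intro exI[of _ F2] conjI a allI impI) (use a(2) in blast)+
    qed assumption+
  qed
  then obtain F2 where F2: "\<And>Q. Q \<in> F1 \<Longrightarrow> finite (F2 Q)"
    "\<And>Q c h. Q \<in> F1 \<Longrightarrow> (c, h) \<in> F2 Q \<Longrightarrow> h > 0 \<and> acell c (h *\<^sub>R B (t Q)) \<subseteq> U Q"
    "\<And>Q. Q \<in> F1 \<Longrightarrow> disjoint_family_on (\<lambda>(c, h). ocell c (h *\<^sub>R B (t Q))) (F2 Q)"
    "\<And>Q. Q \<in> F1 \<Longrightarrow> integral (U Q - (\<Union>(c, h)\<in>F2 Q. acell c (h *\<^sub>R B (t Q)))) g < \<epsilon>3"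
    by metis
  define F where "F = (\<Union>Q\<in>F1. (\<lambda>(c, h). (c, h *\<^sub>R B (t Q), h, w (t Q))) ` F2 Q)"
  have good: "good_cell \<epsilon> a M h w0" if "(a, M, h, w0) \<in> F" for a M h w0
  proof -
    obtain Q where QF: "Q \<in> F1" and ah: "(a, h) \<in> F2 Q" and M: "M = h *\<^sub>R B (t Q)" and w0: "w0 = w (t Q)"
      using \<open>(a, M, h, w0) \<in> F\<close> by (auto simp: F_def)
    let ?x = "t Q"
    have x: "?x \<in> C" and VB: "V Q \<subseteq> ball ?x (d ?x)" using t[OF QF] by auto
    have h: "h > 0" and AU: "acell a M \<subseteq> U Q" using F2(2)[OF QF ah] M by auto
    have AB: "acell a M \<subseteq> ball ?x (d ?x)" using AU UV VB by blast
    have AC: "acell a M \<subseteq> C" using AU UV Q[OF QF] by blast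
    have c: "cellb M h w0 = \<bar>det M\<bar> * G ?x" unfolding M w0 by (rule cellb_eq[OF x B(3)[OF x] h])
    have quad: "(1 - \<epsilon>) * (h\<^sup>2 / 2 * (norm (y - y'))\<^sup>2) \<le> f x - (f z + Df z \<bullet> (x - z)) \<and>
       f x - (f z + Df z \<bullet> (x - z)) \<le> (1 + \<epsilon>) * (h\<^sup>2 / 2 * (norm (y - y'))\<^sup>2)"
      if y: "y \<in> ucube" "y' \<in> ucube" and xz: "x = a + M *v y" "z = a + M *v y'" for y y' x z
    proof -
      have xA: "x \<in> acell a M" "z \<in> acell a M" using y xz by (auto simp: acell_def)
      obtain s where s: "0 < s" "s < 1"
        "f x = f z + Df z \<bullet> (x - z) + (x - z) \<bullet> (D2f (z + s *\<^sub>R (x - z)) *v (x - z)) / 2"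
        using taylor2[of x z] xA AC by blast
      \<comment> \<open>The cell is convex, so the intermediate point of Taylor's formula lies in
        it, where the Hessian is controlled.\<close>
      have "z + s *\<^sub>R (x - z) \<in> acell a M"
        using convexD[OF convex_acell xA(2,1), of "1 - s" s] s by (simp add: algebra_simps)
      then have "z + s *\<^sub>R (x - z) \<in> ball ?x (d ?x)" using AB by blast
      from ctl[OF x this, unfolded controlled_def] have b: "(1 - \<epsilon>) * ((x - z) \<bullet> (D2f ?x *v (x - z))) \<le> (x - z) \<bullet> (D2f (z + s *\<^sub>R (x - z)) *v (x - z))"
        "(x - z) \<bullet> (D2f (z + s *\<^sub>R (x - z)) *v (x - z)) \<le> (1 + \<epsilon>) * ((x - z) \<bullet> (D2f ?x *v (x - z)))" by auto
      have "x - z = B ?x *v (h *\<^sub>R (y - y'))"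
        unfolding xz M by (simp add: scaleR_matrix_vector_assoc[symmetric] linear_scale[OF matrix_vector_mul_linear]
            matrix_vector_mult_diff_distrib scaleR_diff_right)
      then have "(x - z) \<bullet> (D2f ?x *v (x - z)) = h\<^sup>2 * (norm (y - y'))\<^sup>2"
        using B(2)[OF x, of "h *\<^sub>R (y - y')"] by (simp add: power_mult_distrib)
      then show ?thesis using b s(3) by (simp add: field_simps)
    qed
    show ?thesis
      unfolding good_cell_def Let_def
    proof (intro conjI ballI)
      show "acell a M \<subseteq> C" by (rule AC)
      show "h > 0" by (rule h)
      show "w0 > 0" using w[OF x] w0 by simp
      show "invertible M" unfolding M using h B(1)[OF x] by (intro scaleR_invertible) auto
      fix y y' :: "real^'n" assume "y \<in> ucube" "y' \<in> ucube"
      from quad[OF this refl refl]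
      show "(1 - \<epsilon>) * (h\<^sup>2 / 2 * (norm (y - y'))\<^sup>2) \<le> f (a + M *v y) - (f (a + M *v y') + Df (a + M *v y') \<bullet> (a + M *v y - (a + M *v y')))"
        "f (a + M *v y) - (f (a + M *v y') + Df (a + M *v y') \<bullet> (a + M *v y - (a + M *v y'))) \<le> (1 + \<epsilon>) * (h\<^sup>2 / 2 * (norm (y - y'))\<^sup>2)"
        by blast+
    next
      fix x assume "x \<in> acell a M"
      then have "x \<in> ball ?x (d ?x)" using AB by blast
      from ctl[OF x this, unfolded controlled_def] have b: "(1 - \<epsilon>) * w ?x \<le> w x" "w x \<le> (1 + \<epsilon>) * w ?x"
        "(1 - \<epsilon>) * G ?x \<le> G x" "G x \<le> (1 + \<epsilon>) * G ?x" by auto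
      show "(1 - \<epsilon>) * w0 \<le> w x" "w x \<le> (1 + \<epsilon>) * w0" using b w0 by auto
      show "(1 - \<epsilon>) * cellb M h w0 \<le> \<bar>det M\<bar> * G x" "\<bar>det M\<bar> * G x \<le> (1 + \<epsilon>) * cellb M h w0"
        using mult_left_mono[OF b(3), of "\<bar>det M\<bar>"] mult_left_mono[OF b(4), of "\<bar>det M\<bar>"] unfolding c
        by (simp_all add: mult_ac)
    qed
  qed
  have disj: "disjoint_family_on (\<lambda>(a, M, h, w0). ocell a M) F"
    unfolding disjoint_family_on_def
  proof (intro ballI impI)
    fix P P' assume PP: "P \<in> F" "P' \<in> F" "P \<noteq> P'"
    obtain Q c h where 1: "Q \<in> F1" "(c, h) \<in> F2 Q" "P = (c, h *\<^sub>R B (t Q), h, w (t Q))"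
      using PP(1) by (auto simp: F_def)
    obtain Q' c' h' where 2: "Q' \<in> F1" "(c', h') \<in> F2 Q'" "P' = (c', h' *\<^sub>R B (t Q'), h', w (t Q'))"
      using PP(2) by (auto simp: F_def)
    have "ocell c (h *\<^sub>R B (t Q)) \<inter> ocell c' (h' *\<^sub>R B (t Q')) = {}"
    proof (cases "Q = Q'")
      case True
      then have "(c, h) \<noteq> (c', h')" using 1 2 PP(3) by auto
      then show ?thesis
        using F2(3)[OF 1(1)] 1(2) 2(2) True unfolding disjoint_family_on_def by fastforce
    next
      case False
      then have "U Q \<inter> U Q' = {}"
        using F1(3) 1(1) 2(1) unfolding disjoint_family_on_def U_def by (auto simp: case_prod_beta)
      moreover have "ocell c (h *\<^sub>R B (t Q)) \<subseteq> U Q" "ocell c' (h' *\<^sub>R B (t Q')) \<subseteq> U Q'"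
        using F2(2)[OF 1(1,2)] F2(2)[OF 2(1,2)] ocell_subset by (metis subset_trans)+
      ultimately show ?thesis by blast
    qed
    then show "(case P of (a, M, h, w0) \<Rightarrow> ocell a M) \<inter> (case P' of (a, M, h, w0) \<Rightarrow> ocell a M) = {}"
      using 1(3) 2(3) by simp
  qed
  have finF: "finite F" using F1(1) F2(1) by (auto simp: F_def)
  define X where "X Q = V Q - (\<Union>(c, h)\<in>F2 Q. acell c (h *\<^sub>R B (t Q)))" for Q
  define X0 where "X0 = C - (\<Union>Q\<in>F1. V Q)"
  define Y where "Y = C - (\<Union>(a, M, h, w0)\<in>F. acell a M)"
  have acl: "acell a M \<in> sets lebesgue" for a and M :: "real^'n^'n"
    using compact_imp_closed[OF compact_acell[of a M]] by auto
  have Csets: "C \<in> sets lebesgue" using C(1) by auto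
  have Xs: "X Q \<in> sets lebesgue" if "Q \<in> F1" for Q
    unfolding X_def V_def using F2(1)[OF that]
    by (intro sets.Diff acl sets.finite_UN) (auto intro: acl simp: case_prod_beta)
  have X0s: "X0 \<in> sets lebesgue" unfolding X0_def V_def using F1(1)
    by (intro sets.Diff Csets sets.finite_UN acl)
  have Ys: "Y \<in> sets lebesgue" unfolding Y_def using finF
    by (intro sets.Diff Csets sets.finite_UN) (auto intro: acl)
  have XC: "X Q \<subseteq> C" if "Q \<in> F1" for Q using Q[OF that] by (auto simp: X_def)
  \<comment> \<open>A point outside all cells lies outside all cubes or in the uncovered part of
    some cube.\<close>
  have "integral Y g \<le> integral X0 g + (\<Sum>Q\<in>F1. integral (X Q) g)"
  proof (rule integral_le_remainder_plus_sum_cover[OF F1(1)])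
    show "Y \<subseteq> X0 \<union> (\<Union>Q\<in>F1. X Q)"
    proof
      fix x assume x: "x \<in> Y"
      show "x \<in> X0 \<union> (\<Union>Q\<in>F1. X Q)"
      proof (cases "\<exists>Q\<in>F1. x \<in> V Q")
        case True
        then obtain Q where Q: "Q \<in> F1" "x \<in> V Q" by blast
        then have "x \<in> X Q" using x by (force simp: X_def Y_def F_def)
        then show ?thesis using Q by blast
      qed (use x in \<open>auto simp: X0_def Y_def\<close>)
    qed
    show "g integrable_on Y" by (rule sub[OF _ Ys]) (auto simp: Y_def)
    show "g integrable_on X0" by (rule sub[OF _ X0s]) (auto simp: X0_def)
    show "g integrable_on X Q" if "Q \<in> F1" for Q by (rule sub[OF XC[OF that] Xs[OF that]])
    show "0 \<le> g x" if "x \<in> X0" for x using that by (intro g0) (simp add: X0_def)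
    show "0 \<le> g x" if "Q \<in> F1" "x \<in> X Q" for Q x using XC[OF that(1)] that(2) by (intro g0) blast
  qed
  also have "\<dots> \<le> \<epsilon>2 / 2 + (\<Sum>Q\<in>F1. \<epsilon>3)"
  proof (intro add_mono sum_mono)
    show "integral X0 g \<le> \<epsilon>2 / 2" using F1(4) by (simp add: X0_def V_def case_prod_beta)
    fix Q assume QF: "Q \<in> F1"
    \<comment> \<open>The closed cube may be replaced by the open one, its faces being null.\<close>
    have "integral (X Q) g = integral (U Q - (\<Union>(c, h)\<in>F2 Q. acell c (h *\<^sub>R B (t Q)))) g"
      using UV[of Q] by (intro integral_spike_set)
        (auto intro!: negligible_subset[OF negligible_acell_diff[of "fst Q" "snd Q *\<^sub>R mat 1"]] simp: X_def V_def U_def)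
    then show "integral (X Q) g \<le> \<epsilon>3" using F2(4)[OF QF] by simp
  qed
  also have "\<dots> < \<epsilon>2"
  proof -
    have "real (card F1) * \<epsilon>3 < \<epsilon>2 / 2" using e2 by (simp add: \<epsilon>3_def field_simps)
    then show ?thesis by simp
  qed
  finally have "integral Y g < \<epsilon>2" .
  then show thesis using that[OF finF good disj] unfolding Y_def g_def by blast
qed

end

section \<open>Lower bound on one cell\<close>

definition affmax :: "((real^'n) \<times> real) set \<Rightarrow> real^'n \<Rightarrow> real" where
  "affmax A x = Max ((\<lambda>(a, b). a \<bullet> x + b) ` A)"

lemma affmax_attained:
  assumes "finite A" "A \<noteq> {}"
  obtains a b where "(a, b) \<in> A" "affmax A x = a \<bullet> x + b"
proof -
  have "affmax A x \<in> (\<lambda>(a, b). a \<bullet> x + b) ` A" unfolding affmax_def using assms by (intro Max_in) auto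
  then show ?thesis using that by auto
qed

lemma affmax_ge: "finite A \<Longrightarrow> (a, b) \<in> A \<Longrightarrow> a \<bullet> x + b \<le> affmax A x"
  unfolding affmax_def by (intro Max_ge) auto

lemma continuous_on_affmax:
  assumes "finite A" "A \<noteq> {}"
  shows "continuous_on S (affmax A)"
  using assms
proof (induction rule: finite_ne_induct)
  case (singleton \<psi>)
  then show ?case
    unfolding affmax_def[abs_def] by (cases \<psi>) (auto intro!: continuous_intros)
next
  case (insert \<psi> F)
  have "affmax (insert \<psi> F) = (\<lambda>x. max (fst \<psi> \<bullet> x + snd \<psi>) (affmax F x))"
    using insert(1,2) by (simp add: affmax_def fun_eq_iff case_prod_beta)
  then show ?case
    using insert by (auto intro!: continuous_intros continuous_on_max)
qed

text \<open>The concentric copy of ratio \<theta>; in cube coordinates it keeps the distance (1 -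
  \<theta>) / 2 from the faces.\<close>

definition icell :: "real \<Rightarrow> real^'n \<Rightarrow> real^'n^'n \<Rightarrow> (real^'n) set" where
  "icell \<theta> a M = (\<lambda>y. a + M *v y) ` (\<lambda>y. (\<chi> i. (1 - \<theta>) / 2) + \<theta> *\<^sub>R y) ` ucube"

lemma icell_subset:
  assumes "0 < \<theta>" "\<theta> < 1"
  shows "icell \<theta> a M \<subseteq> ocell a M"
proof -
  have "(\<chi> i. (1 - \<theta>) / 2) + \<theta> *\<^sub>R y \<in> box 0 (\<chi> i. 1)" if "y \<in> ucube" for y :: "real^'n"
    unfolding mem_box_cart
  proof
    fix i
    have "0 \<le> y $ i" "y $ i \<le> 1" using that by (auto simp: ucube_def mem_box_cart)
    moreover define t where "t = \<theta> * y $ i"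
    ultimately have "0 \<le> t" "t \<le> \<theta>" using assms by (auto simp: mult_left_le)
    then have "0 < (1 - \<theta>) / 2 + t" "(1 - \<theta>) / 2 + t < 1" using assms by (simp_all add: field_simps)
    then show "(0::real^'n) $ i < ((\<chi> i. (1 - \<theta>) / 2) + \<theta> *\<^sub>R y) $ i \<and> ((\<chi> i. (1 - \<theta>) / 2) + \<theta> *\<^sub>R y) $ i < (\<chi> i. 1) $ i"
      by (simp add: t_def)
  qed
  then show ?thesis unfolding icell_def ocell_def by (intro image_mono) auto
qed

context convex_C2
begin

text \<open>The bound is imposed on \<open>C\<close> only, so every family that is admissible on the
  whole domain is included.\<close>

definition minorants :: "((real^'n) \<times> real) set \<Rightarrow> bool" where
  "minorants A \<longleftrightarrow> finite A \<and> A \<noteq> {} \<and> (\<forall>(a, b)\<in>A. \<forall>x\<in>C. a \<bullet> x + b \<le> f x)"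

lemma minorants_le:
  assumes A: "minorants A" and x: "x \<in> C"
  shows "affmax A x \<le> f x"
proof -
  have "finite A" "A \<noteq> {}" using A by (auto simp: minorants_def)
  then obtain a b where "(a, b) \<in> A" "affmax A x = a \<bullet> x + b" by (rule affmax_attained)
  then show ?thesis using A x unfolding minorants_def by fastforce
qed

lemma continuous_on_f: "continuous_on C f"
  using der1 by (meson has_derivative_continuous continuous_at_imp_continuous_on)

text \<open>The variational inequality at a minimum over a convex set: from \<open>z\<close> towards
  any point of \<open>V\<close>, the difference of \<open>f\<close> and the affine function cannot
  decrease to first order.\<close>

lemma first_order_minimum:
  assumes V: "convex V" "V \<subseteq> C" "z \<in> V" "x \<in> V"
    and min: "\<And>v. v \<in> V \<Longrightarrow> f z - (\<alpha> \<bullet> z + \<beta>) \<le> f v - (\<alpha> \<bullet> v + \<beta>)"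
  shows "0 \<le> (Df z - \<alpha>) \<bullet> (x - z)"
proof (rule ccontr)
  assume "\<not> ?thesis"
  then have neg: "(Df z - \<alpha>) \<bullet> (x - z) < 0" by simp
  have "((\<lambda>t. f (z + t *\<^sub>R (x - z)) - t * (\<alpha> \<bullet> (x - z))) has_real_derivative
      Df (z + 0 *\<^sub>R (x - z)) \<bullet> (x - z) - \<alpha> \<bullet> (x - z)) (at 0)"
    using V by (intro DERIV_diff deriv_along) (auto intro!: derivative_eq_intros)
  then have "((\<lambda>t. f (z + t *\<^sub>R (x - z)) - t * (\<alpha> \<bullet> (x - z))) has_real_derivative (Df z - \<alpha>) \<bullet> (x - z)) (at 0)"
    by (simp add: inner_diff_left)
  from DERIV_neg_dec_right[OF this neg] obtain d where d: "d > 0"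
    "\<And>t. 0 < t \<Longrightarrow> t < d \<Longrightarrow> f (z + t *\<^sub>R (x - z)) - t * (\<alpha> \<bullet> (x - z)) < f z" by auto
  define t where "t = min (d / 2) 1"
  have t: "0 < t" "t < d" "t \<le> 1" using d(1) by (auto simp: t_def)
  have "z + t *\<^sub>R (x - z) \<in> V"
    using convexD[OF V(1,3,4), of "1 - t" t] t by (simp add: algebra_simps)
  from min[OF this] have "f z \<le> f (z + t *\<^sub>R (x - z)) - t * (\<alpha> \<bullet> (x - z))"
    by (simp add: inner_add_right)
  then show False using d(2)[OF t(1,2)] by simp
qed

text \<open>At an interior point a short step against \<open>Df z - \<alpha>\<close> stays in
  \<open>V\<close>, and the variational inequality for this step forces the difference to
  vanish.\<close>

lemma interior_minimum:
  assumes V: "convex V" "V \<subseteq> C" "O' \<subseteq> V" "open O'" "z \<in> O'"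
    and min: "\<And>v. v \<in> V \<Longrightarrow> f z - (\<alpha> \<bullet> z + \<beta>) \<le> f v - (\<alpha> \<bullet> v + \<beta>)"
  shows "Df z = \<alpha>"
proof -
  obtain e where e: "e > 0" "cball z e \<subseteq> O'" using V(4,5) open_contains_cball by blast
  define g where "g = Df z - \<alpha>"
  define s where "s = e / (norm g + 1)"
  have s: "s > 0" using e by (simp add: s_def add_nonneg_pos)
  have "s * norm g \<le> s * (norm g + 1)" using s by simp
  also have "\<dots> = e" by (simp add: s_def add_nonneg_eq_0_iff)
  finally have "z - s *\<^sub>R g \<in> cball z e" using s by (simp add: dist_norm)
  then have x: "z - s *\<^sub>R g \<in> V" using e V(3) by blast
  have zV: "z \<in> V" using V(3,5) by blast
  have "0 \<le> (Df z - \<alpha>) \<bullet> (z - s *\<^sub>R g - z)"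
    by (rule first_order_minimum[OF V(1,2) zV x min])
  then have "s * (g \<bullet> g) \<le> 0" by (simp add: g_def)
  then have "g \<bullet> g \<le> 0" using s by (simp add: mult_le_0_iff)
  then show ?thesis by (simp add: g_def) (metis inner_gt_zero_iff not_le right_minus_eq)
qed

end

context weighted_C2
begin

definition "r = 2 * p / n"

lemma r_pos: "r > 0" and q_r: "1 / q = 1 + r" "q * (1 + r) = 1"
proof -
  have "1 + r = (n + 2 * p) / n" using n_pos by (simp add: r_def add_divide_distrib)
  then show "1 / q = 1 + r" "q * (1 + r) = 1" using p n_pos by (simp_all add: q_def)
qed (use p n_pos in \<open>simp add: r_def\<close>)

lemma r_eq: "r = 2 * p / real CARD('n)"
  by (subst r_def) (simp add: n_eq)

lemma qmin_ge: "m > 0 \<Longrightarrow> \<delta> * real m powr (-r) \<le> qmin p m TYPE('n)"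
  using zador_limit(2)[OF p, of m, where 'n = 'n, folded \<delta>_eq r_eq]
  by (simp add: powr_minus divide_inverse[symmetric] field_simps)

lemma cellb_powr:
  assumes "good_cell \<epsilon> a M h w0"
  shows "cellb M h w0 powr (1 + r) = w0 * (h\<^sup>2 / 2) powr p * \<bar>det M\<bar>" "cellb M h w0 > 0"
proof -
  have "w0 > 0" "h > 0" "det M \<noteq> 0" using assms by (auto simp: good_cell_def invertible_det_nz)
  then have X: "w0 * (h\<^sup>2 / 2) powr p * \<bar>det M\<bar> > 0" by simp
  show "cellb M h w0 powr (1 + r) = w0 * (h\<^sup>2 / 2) powr p * \<bar>det M\<bar>" "cellb M h w0 > 0"
    unfolding cellb_def powr_powr q_r using powr_one[OF less_imp_le[OF X]] X by (auto simp only: powr_gt_zero)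
qed

definition integrand :: "((real^'n) \<times> real) set \<Rightarrow> real^'n \<Rightarrow> real" where
  "integrand A x = (f x - affmax A x) powr p * w x"

lemma integrand_nonneg: "x \<in> C \<Longrightarrow> 0 \<le> integrand A x"
  using w[of x] by (simp add: integrand_def)

lemma continuous_on_integrand:
  assumes "minorants A"
  shows "continuous_on C (integrand A)"
  unfolding integrand_def[abs_def]
  by (intro continuous_intros continuous_on_powr' w_cont continuous_on_f continuous_on_affmax)
    (use assms minorants_le[OF assms] p in \<open>auto simp: minorants_def\<close>)

text \<open>The tangents at a fixed \<open>x0\<close> and at \<open>x\<close> bound the increment of
  \<open>f\<close> from both sides by the gradient bound times the diameter.\<close>

lemma f_bounded:
  obtains K where "\<And>x. x \<in> C \<Longrightarrow> \<bar>f x\<bar> \<le> K"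
proof -
  obtain x0 where x0: "x0 \<in> C" using C(4) by blast
  obtain R where R: "\<And>x. x \<in> C \<Longrightarrow> norm x \<le> R" using C(3) unfolding bounded_iff by blast
  have "\<bar>f x\<bar> \<le> \<bar>f x0\<bar> + L * (R + R)" if x: "x \<in> C" for x
  proof -
    have d: "norm (x - x0) \<le> R + R" using R[OF x] R[OF x0] norm_triangle_ineq4[of x x0] by linarith
    have "0 \<le> R" using R[OF x0] norm_ge_zero[of x0] by linarith
    have b: "\<bar>Df y \<bullet> v\<bar> \<le> L * (R + R)" if "y \<in> C" "norm v \<le> R + R" for y v
    proof -
      have "\<bar>Df y \<bullet> v\<bar> \<le> norm (Df y) * norm v" by (rule Cauchy_Schwarz_ineq2)
      also have "\<dots> \<le> L * (R + R)"
        using Lip[OF that(1)] that(2) order_trans[OF norm_ge_zero Lip[OF that(1)]] by (intro mult_mono) auto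
      finally show ?thesis .
    qed
    show ?thesis
      using tangent_le(1)[OF x x0] tangent_le(1)[OF x0 x] b[OF x0, of "x - x0"] b[OF x, of "x0 - x"] d
      by (auto simp: norm_minus_commute)
  qed
  then show thesis by (rule that)
qed

lemma integrand_integrable:
  assumes A: "minorants A"
  shows "integrand A integrable_on C"
proof -
  obtain K where K: "\<And>x. x \<in> C \<Longrightarrow> \<bar>f x\<bar> \<le> K" by (rule f_bounded) blast
  have "compact (affmax A ` closure C)"
    using A C(3) by (intro compact_continuous_image continuous_on_affmax) (auto simp: minorants_def compact_closure)
  then obtain K' where "\<forall>v\<in>affmax A ` closure C. norm v \<le> K'"
    using compact_imp_bounded bounded_iff by blast
  then have K': "\<bar>affmax A x\<bar> \<le> K'" if "x \<in> C" for x
    using that closure_subset[of C] by auto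
  show ?thesis
  proof (rule integrable_continuous_bounded[OF continuous_on_integrand[OF A] _ const_integrable])
    fix x assume x: "x \<in> C"
    have "(f x - affmax A x) powr p \<le> (K + K') powr p"
      using K[OF x] K'[OF x] minorants_le[OF A x] p by (intro powr_mono2) auto
    then show "\<bar>integrand A x\<bar> \<le> (K + K') powr p * W"
      using w[OF x] by (auto simp: integrand_def abs_mult intro!: mult_mono)
  qed
qed

lemma integrand_integrable_subset:
  assumes "minorants A" "X \<subseteq> C" "X \<in> sets lebesgue"
  shows "integrand A integrable_on X"
  by (rule integrable_on_subset_nonneg[OF integrand_integrable integrand_nonneg]) (use assms in auto)

text \<open>Push each affine minorant up inside the cell: it is then at least as good as touching at the
  minimiser \<open>z\<close> of \<open>f - \<psi>\<close> over the cell. A minimiser in the interior makes the slope of \<open>\<psi>\<close> a gradient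
  from that cell, and a minimiser on the boundary is far from \<open>icell\<close>, where a fixed net does better.\<close>

lemma cell_lower_bound:
  assumes good: "good_cell \<epsilon> a M h w0" and e: "0 < \<epsilon>" "\<epsilon> < 1" and \<theta>: "0 < \<theta>" "\<theta> < 1"
  obtains N where "N > 0" "\<And>A. minorants A \<Longrightarrow>
    (1 - \<epsilon>) powr (1 + p) * \<theta> powr (n + 2 * p) * \<delta> *
      (cellb M h w0 powr (1 + r) * real (card {\<psi>\<in>A. fst \<psi> \<in> Df ` ocell a M} + N) powr (-r))
     \<le> integral (icell \<theta> a M) (integrand A)"
proof -
  have acC: "acell a M \<subseteq> C" and h: "h > 0" and w0: "w0 > 0" and M: "invertible M"
    and quad: "\<And>y y'. y \<in> ucube \<Longrightarrow> y' \<in> ucube \<Longrightarrow> (1 - \<epsilon>) * (h\<^sup>2 / 2 * (norm (y - y'))\<^sup>2) \<le>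
      f (a + M *v y) - (f (a + M *v y') + Df (a + M *v y') \<bullet> ((a + M *v y) - (a + M *v y')))"
    and wlow: "\<And>x. x \<in> acell a M \<Longrightarrow> (1 - \<epsilon>) * w0 \<le> w x"
    using good unfolding good_cell_def Let_def by blast+
  define \<eta> where "\<eta> = (1 - \<theta>) / 2"
  have \<eta>: "\<eta> > 0" using \<theta> by (simp add: \<eta>_def)
  define c :: "real^'n" where "c = (\<chi> i. \<eta>)"
  define inner where "inner = (\<lambda>y. c + \<theta> *\<^sub>R y) ` (ucube :: (real^'n) set)"
  have inner_cbox: "inner = cbox c (c + \<theta> *\<^sub>R (\<chi> i. 1))"
    unfolding inner_def by (rule affine_image_ucube[OF \<theta>(1)])
  have inner_comp: "\<eta> \<le> y $ i \<and> y $ i \<le> 1 - \<eta>" if "y \<in> inner" for y i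
    using that unfolding inner_cbox mem_box_cart c_def \<eta>_def by (auto simp: field_simps dest: spec[of _ i])
  have inner_sub: "inner \<subseteq> ucube"
  proof
    fix y assume "y \<in> inner"
    then have "0 \<le> y $ i \<and> y $ i \<le> 1" for i using inner_comp[of y i] \<eta> by linarith
    then show "y \<in> ucube" by (simp add: ucube_def mem_box_cart)
  qed
  have ic: "icell \<theta> a M = (\<lambda>y. a + M *v y) ` inner"
    by (simp add: icell_def inner_def c_def \<eta>_def)
  \<comment> \<open>This net depends on \<theta> but not on the family \<open>A\<close>; its size is
    the constant \<open>N\<close>.\<close>
  obtain T where T: "finite T" "(ucube :: (real^'n) set) \<subseteq> (\<Union>x\<in>T. ball x \<eta>)"
    using ucube_basics(1) \<eta> unfolding compact_eq_totally_bounded by blast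
  have Tne: "T \<noteq> {}" using T ucube_basics(4) by blast
  show thesis
  proof (rule that)
    show "card T > 0" using T Tne by (simp add: card_gt_0_iff)
    fix A assume A: "minorants A"
    have Afin: "finite A" "A \<noteq> {}" and Ale: "\<And>\<alpha> \<beta> x. (\<alpha>, \<beta>) \<in> A \<Longrightarrow> x \<in> C \<Longrightarrow> \<alpha> \<bullet> x + \<beta> \<le> f x"
      using A by (auto simp: minorants_def)
    have "\<exists>y\<in>ucube. \<forall>v\<in>acell a M. f (a + M *v y) - (fst \<psi> \<bullet> (a + M *v y) + snd \<psi>) \<le> f v - (fst \<psi> \<bullet> v + snd \<psi>)" for \<psi>
    proof -
      have "continuous_on (acell a M) (\<lambda>x. f x - (fst \<psi> \<bullet> x + snd \<psi>))"
        by (intro continuous_intros continuous_on_subset[OF continuous_on_f acC])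
      moreover have "acell a M \<noteq> {}" using ucube_basics(3) by (simp add: acell_def)
      ultimately obtain z where "z \<in> acell a M" "\<forall>v\<in>acell a M. f z - (fst \<psi> \<bullet> z + snd \<psi>) \<le> f v - (fst \<psi> \<bullet> v + snd \<psi>)"
        using continuous_attains_inf[OF compact_acell] by blast
      then show ?thesis by (auto simp: acell_def)
    qed
    then obtain Y where Y: "\<And>\<psi>. Y \<psi> \<in> ucube"
      and Ymin: "\<And>\<psi> v. v \<in> acell a M \<Longrightarrow> f (a + M *v Y \<psi>) - (fst \<psi> \<bullet> (a + M *v Y \<psi>) + snd \<psi>) \<le> f v - (fst \<psi> \<bullet> v + snd \<psi>)"
      by metis
    define A1 where "A1 = {\<psi>\<in>A. fst \<psi> \<in> Df ` ocell a M}"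
    define S where "S = Y ` A1 \<union> T"
    have S: "finite S" "S \<noteq> {}" using T Tne Afin by (auto simp: S_def A1_def)
    have "card S \<le> card (Y ` A1) + card T" unfolding S_def by (rule card_Un_le)
    also have "card (Y ` A1) \<le> card A1" using Afin by (intro card_image_le) (auto simp: A1_def)
    finally have cS: "card S \<le> card A1 + card T" by simp
    \<comment> \<open>A minimiser off the open cube has a coordinate 0 or 1, hence is at least
      \<eta> away from every point of the inner cube.\<close>
    have Yor: "Y \<psi> \<in> Y ` A1 \<or> (\<forall>y\<in>inner. \<eta> \<le> norm (y - Y \<psi>))" if \<psi>: "\<psi> \<in> A" for \<psi>
    proof (cases "Y \<psi> \<in> box 0 (\<chi> i. 1)")
      case True
      then have "a + M *v Y \<psi> \<in> ocell a M" by (auto simp: ocell_def)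
      from interior_minimum[OF convex_acell acC ocell_subset open_ocell[OF M] this Ymin]
      have "fst \<psi> \<in> Df ` ocell a M" using \<open>a + M *v Y \<psi> \<in> ocell a M\<close> by (metis imageI)
      then show ?thesis using \<psi> by (auto simp: A1_def)
    next
      case False
      then obtain i where i: "\<not> (0 < Y \<psi> $ i \<and> Y \<psi> $ i < 1)" by (auto simp: mem_box_cart)
      have "\<eta> \<le> norm (y - Y \<psi>)" if y: "y \<in> inner" for y
      proof -
        have "\<eta> \<le> \<bar>(y - Y \<psi>) $ i\<bar>" using inner_comp[OF y, of i] i by auto
        also have "\<dots> \<le> norm (y - Y \<psi>)" by (rule component_le_norm_cart)
        finally show ?thesis .
      qed
      then show ?thesis by blast
    qed
    define \<kappa> where "\<kappa> = (1 - \<epsilon>) * (h\<^sup>2 / 2)"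
    have \<kappa>: "\<kappa> > 0" using e h by (simp add: \<kappa>_def)
    have pt: "\<kappa> powr p * ((1 - \<epsilon>) * w0) * min_dist_powr p S y \<le> integrand A (a + M *v y)" if y: "y \<in> inner" for y
    proof -
      define x where "x = a + M *v y"
      have yu: "y \<in> ucube" using y inner_sub by blast
      have x: "x \<in> acell a M" "x \<in> C" using yu acC by (auto simp: acell_def x_def)
      obtain \<alpha> \<beta> where \<psi>: "(\<alpha>, \<beta>) \<in> A" "affmax A x = \<alpha> \<bullet> x + \<beta>" by (rule affmax_attained[OF Afin])
      define z where "z = a + M *v Y (\<alpha>, \<beta>)"
      have z: "z \<in> acell a M" "z \<in> C" using Y acC by (auto simp: acell_def z_def)
      have zmin: "f z - (\<alpha> \<bullet> z + \<beta>) \<le> f v - (\<alpha> \<bullet> v + \<beta>)" if "v \<in> acell a M" for v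
        using Ymin[OF that, of "(\<alpha>, \<beta>)"] by (simp add: z_def)
      \<comment> \<open>At \<open>x\<close> the tangent at \<open>z\<close> dominates the affine
        minorant: the minorant is below \<open>f\<close> at \<open>z\<close>, and the variational
        inequality compares the slopes towards \<open>x\<close>. So the minorant leaves at least the
        gap of that tangent.\<close>
      have "\<kappa> * (norm (y - Y (\<alpha>, \<beta>)))\<^sup>2 \<le> f x - (f z + Df z \<bullet> (x - z))"
        using quad[OF yu Y] unfolding x_def z_def \<kappa>_def by (simp only: mult.assoc)
      also have "\<dots> \<le> f x - (\<alpha> \<bullet> x + \<beta>)"
        using first_order_minimum[OF convex_acell acC z(1) x(1) zmin] Ale[OF \<psi>(1) z(2)]
        by (simp add: inner_diff_left inner_diff_right)
      finally have low: "\<kappa> * (norm (y - Y (\<alpha>, \<beta>)))\<^sup>2 \<le> f x - affmax A x" using \<psi> by simp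
      \<comment> \<open>A minimiser that is far from \<open>y\<close> is replaced by a net point
        within \<eta> of \<open>y\<close>, which only lessens the distance.\<close>
      obtain s where s: "s \<in> S" "norm (y - s) \<le> norm (y - Y (\<alpha>, \<beta>))"
      proof (cases "Y (\<alpha>, \<beta>) \<in> Y ` A1")
        case True
        then show ?thesis by (intro that[of "Y (\<alpha>, \<beta>)"]) (auto simp: S_def)
      next
        case False
        then have far: "\<eta> \<le> norm (y - Y (\<alpha>, \<beta>))" using Yor[OF \<psi>(1)] y by blast
        obtain t where t: "t \<in> T" "y \<in> ball t \<eta>" using T(2) yu by blast
        then have "norm (y - t) \<le> \<eta>" by (simp add: dist_norm norm_minus_commute)
        then show ?thesis using far t by (intro that[of t]) (auto simp: S_def)
      qed
      have "min_dist_powr p S y \<le> norm (y - s) powr (2 * p)" by (rule min_dist_powr_le[OF S(1) s(1)])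
      also have "\<dots> \<le> norm (y - Y (\<alpha>, \<beta>)) powr (2 * p)" using s p by (intro powr_mono2) auto
      also have "\<dots> = ((norm (y - Y (\<alpha>, \<beta>)))\<^sup>2) powr p"
      proof (cases "norm (y - Y (\<alpha>, \<beta>)) = 0")
        case False
        then have "(norm (y - Y (\<alpha>, \<beta>)))\<^sup>2 = norm (y - Y (\<alpha>, \<beta>)) powr 2" by (simp add: powr_numeral)
        then show ?thesis by (simp only: powr_powr)
      qed simp
      finally have "\<kappa> powr p * min_dist_powr p S y \<le> \<kappa> powr p * ((norm (y - Y (\<alpha>, \<beta>)))\<^sup>2) powr p"
        by (rule mult_left_mono) simp
      also have "\<dots> = (\<kappa> * (norm (y - Y (\<alpha>, \<beta>)))\<^sup>2) powr p" using \<kappa> by (simp add: powr_mult)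
      also have "\<dots> \<le> (f x - affmax A x) powr p" using low \<kappa> p by (intro powr_mono2) auto
      finally have "\<kappa> powr p * min_dist_powr p S y * ((1 - \<epsilon>) * w0) \<le> (f x - affmax A x) powr p * w x"
        using wlow[OF x(1)] e w0 by (intro mult_mono) auto
      then show ?thesis by (simp add: integrand_def x_def mult_ac)
    qed
    have innerC: "(\<lambda>y. a + M *v y) ` inner \<subseteq> C" using acC inner_sub by (auto simp: acell_def)
    have cont: "continuous_on inner (\<lambda>y. integrand A (a + M *v y))"
      by (rule continuous_on_compose2[OF continuous_on_integrand[OF A] affine_continuous innerC])
    have abs: "(\<lambda>y. integrand A (a + M *v y)) absolutely_integrable_on inner"
      using cont unfolding inner_cbox by (rule absolutely_integrable_continuous)
    \<comment> \<open>Undoing the inner scaling may move points out of the unit cube, which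
      \<open>qmin_le_qerr\<close> allows.\<close>
    define S' where "S' = (\<lambda>s. (1 / \<theta>) *\<^sub>R (s - c)) ` S"
    have S': "finite S'" "S' \<noteq> {}" "S = (\<lambda>s. c + \<theta> *\<^sub>R s) ` S'" "card S' \<le> card A1 + card T"
    proof -
      show "finite S'" "S' \<noteq> {}" using S by (auto simp: S'_def)
      show "S = (\<lambda>s. c + \<theta> *\<^sub>R s) ` S'" using \<theta> by (simp add: S'_def image_image)
      show "card S' \<le> card A1 + card T" using card_image_le[OF S(1)] cS unfolding S'_def by (meson le_trans)
    qed
    have Tpos: "card A1 + card T > 0" using T Tne by (simp add: card_gt_0_iff)
    have "\<theta> powr (n + 2 * p) * (\<delta> * real (card A1 + card T) powr (-r)) \<le> \<theta> powr (n + 2 * p) * qerr p S'"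
      using qmin_ge[OF Tpos] qmin_le_qerr[OF S'(1,2,4) p] by (intro mult_left_mono) auto
    also have "\<dots> = integral inner (min_dist_powr p S)"
      using integral_min_dist_powr_scale[OF \<theta>(1) S'(1,2) p, of c] unfolding S'(3)[symmetric] inner_def n_eq by simp
    finally have 1: "\<theta> powr (n + 2 * p) * (\<delta> * real (card A1 + card T) powr (-r)) \<le> integral inner (min_dist_powr p S)" .
    have "\<kappa> powr p * ((1 - \<epsilon>) * w0) * integral inner (min_dist_powr p S)
        = integral inner (\<lambda>y. \<kappa> powr p * ((1 - \<epsilon>) * w0) * min_dist_powr p S y)"
      by simp
    also have "\<dots> \<le> integral inner (\<lambda>y. integrand A (a + M *v y))"
    proof (rule integral_le[OF _ _ pt])
      show "(\<lambda>y. \<kappa> powr p * ((1 - \<epsilon>) * w0) * min_dist_powr p S y) integrable_on inner"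
        unfolding inner_cbox by (intro integrable_on_mult_right min_dist_powr_integrable S p)
      show "(\<lambda>y. integrand A (a + M *v y)) integrable_on inner"
        using abs by (simp add: absolutely_integrable_on_def)
    qed
    finally have 2: "\<kappa> powr p * ((1 - \<epsilon>) * w0) * integral inner (min_dist_powr p S) \<le> integral inner (\<lambda>y. integrand A (a + M *v y))" .
    have 3: "integral (icell \<theta> a M) (integrand A) = \<bar>det M\<bar> * integral inner (\<lambda>y. integrand A (a + M *v y))"
      unfolding ic by (rule integral_affine_image(2)[OF _ _ M abs]) (auto simp: inner_cbox)
    have e4: "\<kappa> powr p = (1 - \<epsilon>) powr p * (h\<^sup>2 / 2) powr p" by (simp only: \<kappa>_def powr_mult)
    have e5: "(1 - \<epsilon>) powr (1 + p) = (1 - \<epsilon>) * (1 - \<epsilon>) powr p" using e by (simp add: powr_add)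
    have "(1 - \<epsilon>) powr (1 + p) * \<theta> powr (n + 2 * p) * \<delta> *
      (cellb M h w0 powr (1 + r) * real (card A1 + card T) powr (-r))
      = \<bar>det M\<bar> * (\<kappa> powr p * ((1 - \<epsilon>) * w0) * (\<theta> powr (n + 2 * p) * (\<delta> * real (card A1 + card T) powr (-r))))"
      unfolding cellb_powr(1)[OF good] e4 e5 by (simp only: mult_ac)
    also have "\<dots> \<le> \<bar>det M\<bar> * (\<kappa> powr p * ((1 - \<epsilon>) * w0) * integral inner (min_dist_powr p S))"
      using 1 e w0 by (intro mult_left_mono) auto
    also have "\<dots> \<le> integral (icell \<theta> a M) (integrand A)"
      unfolding 3 using 2 by (intro mult_left_mono) auto
    finally show "(1 - \<epsilon>) powr (1 + p) * \<theta> powr (n + 2 * p) * \<delta> *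
      (cellb M h w0 powr (1 + r) * real (card {\<psi>\<in>A. fst \<psi> \<in> Df ` ocell a M} + card T) powr (-r))
     \<le> integral (icell \<theta> a M) (integrand A)" unfolding A1_def .
  qed
qed

end

section \<open>Global lower bound\<close>

context convex_C2
begin

definition tangents :: "(real^'n) set \<Rightarrow> ((real^'n) \<times> real) set" where
  "tangents S = (\<lambda>s. (Df s, f s - Df s \<bullet> s)) ` S"

lemma minorants_tangents: "finite S \<Longrightarrow> S \<noteq> {} \<Longrightarrow> S \<subseteq> C \<Longrightarrow> minorants (tangents S)"
  using tangent_le(1) by (fastforce simp: minorants_def tangents_def inner_diff_right)

lemma card_tangents: "finite S \<Longrightarrow> card (tangents S) \<le> card S"
  unfolding tangents_def by (rule card_image_le)

lemma affmax_tangents_ge: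
  "finite S \<Longrightarrow> s \<in> S \<Longrightarrow> f s + Df s \<bullet> (x - s) \<le> affmax (tangents S) x"
  using affmax_ge[of "tangents S" "Df s" "f s - Df s \<bullet> s" x] by (auto simp: tangents_def inner_diff_right)

end

context weighted_C2
begin

type_synonym 'm cell = "(real^'m) \<times> (real^'m^'m) \<times> real \<times> real"

abbreviation AC :: "'n cell \<Rightarrow> (real^'n) set" where "AC P \<equiv> acell (fst P) (fst (snd P))"
abbreviation OC :: "'n cell \<Rightarrow> (real^'n) set" where "OC P \<equiv> ocell (fst P) (fst (snd P))"
abbreviation IC :: "real \<Rightarrow> 'n cell \<Rightarrow> (real^'n) set" where "IC \<theta> P \<equiv> icell \<theta> (fst P) (fst (snd P))"
abbreviation b :: "'n cell \<Rightarrow> real" where "b P \<equiv> cellb (fst (snd P)) (fst (snd (snd P))) (snd (snd (snd P)))"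
abbreviation good :: "real \<Rightarrow> 'n cell \<Rightarrow> bool" where
  "good \<epsilon> P \<equiv> good_cell \<epsilon> (fst P) (fst (snd P)) (fst (snd (snd P))) (snd (snd (snd P)))"

definition J :: real where "J = integral C G"

lemma cell_sets: "acell a M \<in> sets lebesgue" "invertible M \<Longrightarrow> ocell a M \<in> sets lebesgue"
  for a and M :: "real^'n^'n"
  using compact_imp_closed[OF compact_acell[of a M]] open_ocell[of M a] by auto

lemma good_cell_G_integral:
  assumes good: "good_cell \<epsilon> a M h w0"
  shows "integral (acell a M) G \<le> (1 + \<epsilon>) * cellb M h w0"
    and "(1 - \<epsilon>) * cellb M h w0 \<le> integral (ocell a M) G"
proof -
  have acC: "acell a M \<subseteq> C" and M: "invertible M"
    and Gb: "\<And>x. x \<in> acell a M \<Longrightarrow> (1 - \<epsilon>) * cellb M h w0 \<le> \<bar>det M\<bar> * G x \<and> \<bar>det M\<bar> * G x \<le> (1 + \<epsilon>) * cellb M h w0"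
    using good unfolding good_cell_def by blast+
  have d: "\<bar>det M\<bar> > 0" using M by (simp add: invertible_det_nz)
  have Gi: "G integrable_on X" if "X \<subseteq> C" "X \<in> sets lebesgue" for X
    by (rule integrable_on_subset_nonneg[OF G_integrable less_imp_le[OF G_pos] that])
  have ci: "(\<lambda>x. c::real) integrable_on X" if "X \<subseteq> C" "X \<in> sets lebesgue" for X c
  proof -
    have "(\<lambda>x. 1::real) integrable_on X" by (rule integrable_on_subset_nonneg[OF const_integrable _ that]) simp
    from integrable_on_mult_right[OF this, of c] show ?thesis by simp
  qed
  have oC: "ocell a M \<subseteq> C" using ocell_subset acC by blast
  have "integral (acell a M) G \<le> integral (acell a M) (\<lambda>x. (1 + \<epsilon>) * cellb M h w0 / \<bar>det M\<bar> * 1)"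
    using Gb d by (intro integral_le Gi ci cell_sets acC) (auto simp: field_simps)
  also have "\<dots> = (1 + \<epsilon>) * cellb M h w0"
    using d cell_volume(1)[OF M, of a] by (subst integral_mult_right) simp
  finally show "integral (acell a M) G \<le> (1 + \<epsilon>) * cellb M h w0" .
  have "(1 - \<epsilon>) * cellb M h w0 = integral (ocell a M) (\<lambda>x. (1 - \<epsilon>) * cellb M h w0 / \<bar>det M\<bar> * 1)"
    using d cell_volume(2)[OF M, of a] by (subst integral_mult_right) simp
  also have "\<dots> \<le> integral (ocell a M) G"
    using Gb d ocell_subset[of a M] by (intro integral_le Gi ci cell_sets oC M) (auto simp: field_simps)
  finally show "(1 - \<epsilon>) * cellb M h w0 \<le> integral (ocell a M) G" .
qed

text \<open>The numbers \<open>b P\<close> form a Riemann sum of \<open>G\<close>, up to factors 1 -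
  \<epsilon> and 1 + \<epsilon>. The closed cells cover most of \<open>C\<close> and bound the sum
  from below; the open cells are disjoint and bound it from above.\<close>

lemma cell_packing:
  assumes e: "0 < \<epsilon>" and e2: "0 < \<epsilon>2"
  obtains F :: "'n cell set" where "finite F" "\<And>P. P \<in> F \<Longrightarrow> good \<epsilon> P" "disjoint_family_on OC F"
    "integral (C - (\<Union>P\<in>F. AC P)) (\<lambda>x. 1) < \<epsilon>2"
    "J - \<epsilon>2 \<le> (1 + \<epsilon>) * (\<Sum>P\<in>F. b P)" "(1 - \<epsilon>) * (\<Sum>P\<in>F. b P) \<le> J"
proof -
  obtain F :: "'n cell set" where F: "finite F" "\<And>a M h w0. (a, M, h, w0) \<in> F \<Longrightarrow> good_cell \<epsilon> a M h w0"
    "disjoint_family_on (\<lambda>(a, M, h, w0). ocell a M) F"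
    "integral (C - (\<Union>(a, M, h, w0)\<in>F. acell a M)) (\<lambda>x. 1 + G x) < \<epsilon>2"
    by (rule packing[OF e e2]) blast
  have good: "good \<epsilon> P" if "P \<in> F" for P using F(2)[of "fst P" "fst (snd P)" "fst (snd (snd P))" "snd (snd (snd P))"] that by simp
  have disj: "disjoint_family_on OC F" using F(3) unfolding case_prod_unfold .
  define Y where "Y = C - (\<Union>P\<in>F. AC P)"
  have left: "integral Y (\<lambda>x. 1 + G x) < \<epsilon>2" using F(4) unfolding case_prod_unfold Y_def .
  have acC: "AC P \<subseteq> C" "invertible (fst (snd P))" if "P \<in> F" for P using good[OF that] by (auto simp: good_cell_def)
  have Ys: "Y \<in> sets lebesgue" unfolding Y_def using F(1) C(1)
    by (intro sets.Diff sets.finite_UN cell_sets) auto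
  have YC: "Y \<subseteq> C" by (auto simp: Y_def)
  have Gi: "G integrable_on X" if "X \<subseteq> C" "X \<in> sets lebesgue" for X
    by (rule integrable_on_subset_nonneg[OF G_integrable less_imp_le[OF G_pos] that])
  have c1: "(\<lambda>x. 1::real) integrable_on Y"
    by (rule integrable_on_subset_nonneg[OF const_integrable _ YC Ys]) simp
  have i0: "0 \<le> integral Y G" using YC G_pos by (intro integral_nonneg Gi YC Ys) (auto intro: less_imp_le)
  have i1: "0 \<le> integral Y (\<lambda>x. 1::real)" by (intro integral_nonneg c1) simp
  have split: "integral Y (\<lambda>x. 1 + G x) = integral Y (\<lambda>x. 1) + integral Y G"
    by (rule integral_add[OF c1 Gi[OF YC Ys]])
  have "J \<le> integral Y G + (\<Sum>P\<in>F. integral (AC P) G)"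
    unfolding J_def
  proof (rule integral_le_remainder_plus_sum_cover[OF F(1) _ G_integrable Gi[OF YC Ys]])
    show "C \<subseteq> Y \<union> (\<Union>P\<in>F. AC P)" by (auto simp: Y_def)
    show "G integrable_on AC P" if "P \<in> F" for P by (rule Gi[OF acC(1)[OF that] cell_sets(1)])
    show "0 \<le> G x" if "x \<in> Y" for x using G_pos[of x] YC that by (meson less_imp_le subsetD)
    show "0 \<le> G x" if "P \<in> F" "x \<in> AC P" for P x
      using G_pos[of x] acC(1)[OF that(1)] that(2) by (meson less_imp_le subsetD)
  qed
  also have "\<dots> \<le> \<epsilon>2 + (\<Sum>P\<in>F. (1 + \<epsilon>) * b P)"
    using left split i1 by (intro add_mono sum_mono good_cell_G_integral good) auto
  finally have 1: "J - \<epsilon>2 \<le> (1 + \<epsilon>) * (\<Sum>P\<in>F. b P)" by (simp add: sum_distrib_left)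
  have "(1 - \<epsilon>) * (\<Sum>P\<in>F. b P) \<le> (\<Sum>P\<in>F. integral (OC P) G)"
    unfolding sum_distrib_left by (intro sum_mono good_cell_G_integral(2) good)
  also have "\<dots> \<le> J" unfolding J_def
  proof (rule sum_integral_le_disjoint[OF F(1) _ disj G_integrable])
    show OC: "OC P \<subseteq> C" if "P \<in> F" for P using acC(1)[OF that] ocell_subset by (rule subset_trans[rotated])
    show "G integrable_on OC P" if "P \<in> F" for P by (rule Gi[OF OC[OF that] cell_sets(2)[OF acC(2)[OF that]]])
    show "0 \<le> G x" if "x \<in> C" for x using G_pos[OF that] by simp
  qed
  finally have 2: "(1 - \<epsilon>) * (\<Sum>P\<in>F. b P) \<le> J" .
  show thesis
    by (rule that[OF F(1) good disj _ 1 2]) (use left split i0 in \<open>auto simp: Y_def\<close>)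
qed

lemma \<delta>_nonneg: "0 \<le> \<delta>"
  unfolding \<delta>_eq by (rule zador_limit(3)[OF p])

text \<open>\<open>N\<close> depends neither on \<open>A\<close> nor on \<open>m\<close>, so it is
  harmless in the limit. As \<open>Df\<close> is injective and the open cells are disjoint, a slope
  is a gradient from at most one cell; the counts over all cells therefore add up to at most
  \<open>m\<close>, and \<open>power_mean_sum\<close> applies.\<close>

lemma lower_bound:
  assumes e: "0 < \<epsilon>" "\<epsilon> < 1" "\<epsilon> < J"
  obtains N :: nat where "\<And>A m. minorants A \<Longrightarrow> card A \<le> m \<Longrightarrow>
    (1 - \<epsilon>) powr (1 + p) * (1 - \<epsilon>) powr (n + 2 * p) * \<delta> *
      (((J - \<epsilon>) / (1 + \<epsilon>)) powr (1 + r) * (real m + real N) powr (-r)) \<le> integral C (integrand A)"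
proof -
  define K where "K = (1 - \<epsilon>) powr (1 + p) * (1 - \<epsilon>) powr (n + 2 * p) * \<delta>"
  have K: "K \<ge> 0" using \<delta>_nonneg by (simp add: K_def)
  obtain F where F: "finite F" "\<And>P. P \<in> F \<Longrightarrow> good \<epsilon> P" "disjoint_family_on OC F"
    "J - \<epsilon> \<le> (1 + \<epsilon>) * (\<Sum>P\<in>F. b P)"
    by (rule cell_packing[OF e(1,1)]) blast
  \<comment> \<open>The inner cells have ratio 1 - \<epsilon>, so that a single parameter governs
    all losses.\<close>
  have th: "0 < 1 - \<epsilon>" "1 - \<epsilon> < 1" using e by auto
  define A1 where "A1 A P = {\<psi>\<in>A. fst \<psi> \<in> Df ` OC P}" for A :: "((real^'n) \<times> real) set" and P :: "'n cell"
  have "\<exists>N>0. \<forall>A. minorants A \<longrightarrow> K * (b P powr (1 + r) * real (card (A1 A P) + N) powr (-r)) \<le> integral (IC (1 - \<epsilon>) P) (integrand A)"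
    if P: "P \<in> F" for P
    unfolding A1_def K_def by (rule cell_lower_bound[OF F(2)[OF P] e(1,2) th]) blast
  then obtain N where N: "\<And>P. P \<in> F \<Longrightarrow> N P > 0"
    "\<And>P A. P \<in> F \<Longrightarrow> minorants A \<Longrightarrow> K * (b P powr (1 + r) * real (card (A1 A P) + N P) powr (-r)) \<le> integral (IC (1 - \<epsilon>) P) (integrand A)"
    by metis
  have acC: "AC P \<subseteq> C" "invertible (fst (snd P))" if "P \<in> F" for P using F(2)[OF that] by (auto simp: good_cell_def)
  have icO: "IC (1 - \<epsilon>) P \<subseteq> OC P" for P by (rule icell_subset[OF th])
  have icC: "IC (1 - \<epsilon>) P \<subseteq> C" if "P \<in> F" for P using icO acC(1)[OF that] ocell_subset by (meson subset_trans)
  have icdisj: "disjoint_family_on (IC (1 - \<epsilon>)) F"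
    using F(3) icO unfolding disjoint_family_on_def by blast
  have ics: "IC (1 - \<epsilon>) P \<in> sets lebesgue" for P
  proof -
    have "compact (IC (1 - \<epsilon>) P)"
      unfolding icell_def by (intro compact_continuous_image affine_continuous continuous_intros ucube_basics)
    from compact_imp_closed[OF this] show ?thesis by auto
  qed
  show thesis
  proof (rule that)
    fix A m assume A: "minorants A" and m: "card A \<le> m"
    have Afin: "finite A" "A \<noteq> {}" using A by (auto simp: minorants_def)
    then have mpos: "m > 0" using m by (metis card_gt_0_iff less_le_trans)
    have "(\<Sum>P\<in>F. card (A1 A P)) = card (\<Union>P\<in>F. A1 A P)"
    proof (rule card_UN_disjoint[symmetric])
      show "\<forall>P\<in>F. \<forall>Q\<in>F. P \<noteq> Q \<longrightarrow> A1 A P \<inter> A1 A Q = {}"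
      proof (intro ballI impI)
        fix P Q assume PQ: "P \<in> F" "Q \<in> F" "P \<noteq> Q"
        have "OC P \<inter> OC Q = {}" using F(3) PQ unfolding disjoint_family_on_def by blast
        moreover have "OC P \<subseteq> C" "OC Q \<subseteq> C" using acC(1)[OF PQ(1)] acC(1)[OF PQ(2)] ocell_subset by (meson subset_trans)+
        ultimately have "Df ` OC P \<inter> Df ` OC Q = {}" using inj_on_image_Int[OF inj_Df, of "OC P" "OC Q"] by simp
        then show "A1 A P \<inter> A1 A Q = {}" by (auto simp: A1_def)
      qed
    qed (use F(1) Afin in \<open>auto simp: A1_def\<close>)
    also have "\<dots> \<le> card A" using Afin by (intro card_mono) (auto simp: A1_def)
    finally have "(\<Sum>P\<in>F. card (A1 A P)) \<le> m" using m by simp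
    then have "real (\<Sum>P\<in>F. card (A1 A P) + N P) \<le> real m + real (sum N F)"
      by (simp only: sum.distrib of_nat_add)
    then have cnt: "(\<Sum>P\<in>F. real (card (A1 A P) + N P)) \<le> real m + real (sum N F)" by simp
    have "(J - \<epsilon>) / (1 + \<epsilon>) \<le> (\<Sum>P\<in>F. b P)" using F(4) e by (simp add: field_simps)
    then have "((J - \<epsilon>) / (1 + \<epsilon>)) powr (1 + r) \<le> (\<Sum>P\<in>F. b P) powr (1 + r)"
      using e r_pos by (intro powr_mono2) auto
    then have "K * (((J - \<epsilon>) / (1 + \<epsilon>)) powr (1 + r) * (real m + real (sum N F)) powr (-r))
        \<le> K * ((\<Sum>P\<in>F. b P) powr (1 + r) * (real m + real (sum N F)) powr (-r))"
      using K by (intro mult_left_mono mult_right_mono) auto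
    also have "\<dots> \<le> K * (\<Sum>P\<in>F. b P powr (1 + r) * real (card (A1 A P) + N P) powr (-r))"
    proof (intro mult_left_mono K power_mean_sum[OF F(1) _ _ cnt _ r_pos])
      show "0 < b P" if "P \<in> F" for P using cellb_powr(2)[OF F(2)[OF that]] .
      show "0 < real (card (A1 A P) + N P)" if "P \<in> F" for P using N(1)[OF that] by simp
      show "0 < real m + real (sum N F)" using mpos by linarith
    qed
    also have "\<dots> \<le> (\<Sum>P\<in>F. integral (IC (1 - \<epsilon>) P) (integrand A))"
      unfolding sum_distrib_left by (intro sum_mono N(2) A)
    also have "\<dots> \<le> integral C (integrand A)"
      by (rule sum_integral_le_disjoint[OF F(1) icC icdisj integrand_integrable[OF A] _ integrand_nonneg])
        (auto intro: integrand_integrable_subset[OF A icC ics])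
    finally show "(1 - \<epsilon>) powr (1 + p) * (1 - \<epsilon>) powr (n + 2 * p) * \<delta> *
      (((J - \<epsilon>) / (1 + \<epsilon>)) powr (1 + r) * (real m + real (sum N F)) powr (-r)) \<le> integral C (integrand A)"
      unfolding K_def .
  qed
qed

text \<open>The tangents at the images of \<open>S\<close> leave on the cell at most \<kappa> times
  the squared distance to \<open>S\<close> in cube coordinates. Further points of \<open>T\<close>
  only raise the maximum, so one family serves all cells at once.\<close>

lemma cell_upper_bound:
  assumes good: "good_cell \<epsilon> a M h w0" and e: "0 < \<epsilon>" and S: "S \<subseteq> ucube" "finite S" "S \<noteq> {}"
    and T: "finite T" "T \<subseteq> C" "(\<lambda>y. a + M *v y) ` S \<subseteq> T"
  shows "integral (acell a M) (integrand (tangents T)) \<le> (1 + \<epsilon>) powr (1 + p) * cellb M h w0 powr (1 + r) * qerr p S"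
proof -
  have acC: "acell a M \<subseteq> C" and h: "h > 0" and w0: "w0 > 0" and M: "invertible M"
    and quad: "\<And>y y'. y \<in> ucube \<Longrightarrow> y' \<in> ucube \<Longrightarrow>
      f (a + M *v y) - (f (a + M *v y') + Df (a + M *v y') \<bullet> ((a + M *v y) - (a + M *v y'))) \<le> (1 + \<epsilon>) * (h\<^sup>2 / 2 * (norm (y - y'))\<^sup>2)"
    and wup: "\<And>x. x \<in> acell a M \<Longrightarrow> w x \<le> (1 + \<epsilon>) * w0"
    using good unfolding good_cell_def Let_def by blast+
  let ?A = "tangents T"
  have Tne: "T \<noteq> {}" using S T by blast
  have A: "minorants ?A" by (rule minorants_tangents[OF T(1) Tne T(2)])
  define \<kappa> where "\<kappa> = (1 + \<epsilon>) * (h\<^sup>2 / 2)"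
  have \<kappa>: "\<kappa> > 0" using e h by (simp add: \<kappa>_def)
  have pt: "integrand ?A (a + M *v y) \<le> \<kappa> powr p * ((1 + \<epsilon>) * w0) * min_dist_powr p S y" if y: "y \<in> ucube" for y
  proof -
    define x where "x = a + M *v y"
    have x: "x \<in> acell a M" "x \<in> C" using y acC by (auto simp: acell_def x_def)
    have up: "f x - affmax ?A x \<le> \<kappa> * (norm (y - s))\<^sup>2" if s: "s \<in> S" for s
    proof -
      have "a + M *v s \<in> T" using s T(3) by blast
      from affmax_tangents_ge[OF T(1) this, of x]
      have "f x - affmax ?A x \<le> f x - (f (a + M *v s) + Df (a + M *v s) \<bullet> (x - (a + M *v s)))" by simp
      also have "\<dots> \<le> \<kappa> * (norm (y - s))\<^sup>2"
        using quad[OF y, of s] s S(1) unfolding x_def \<kappa>_def by (auto simp only: mult.assoc)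
      finally show ?thesis .
    qed
    have "(f x - affmax ?A x) powr p / \<kappa> powr p \<le> min_dist_powr p S y"
    proof (rule min_dist_powr_ge[OF S(2,3)])
      fix s assume s: "s \<in> S"
      have "(f x - affmax ?A x) powr p \<le> (\<kappa> * (norm (y - s))\<^sup>2) powr p"
        using up[OF s] minorants_le[OF A x(2)] p by (intro powr_mono2) auto
      also have "\<dots> = \<kappa> powr p * ((norm (y - s))\<^sup>2) powr p" by (rule powr_mult)
      also have "((norm (y - s))\<^sup>2) powr p = norm (y - s) powr (2 * p)"
      proof (cases "norm (y - s) = 0")
        case False
        then have "(norm (y - s))\<^sup>2 = norm (y - s) powr 2" by (simp add: powr_numeral)
        then show ?thesis by (simp only: powr_powr)
      qed simp
      finally show "(f x - affmax ?A x) powr p / \<kappa> powr p \<le> norm (y - s) powr (2 * p)"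
        using \<kappa> by (simp add: field_simps)
    qed
    then have "(f x - affmax ?A x) powr p \<le> \<kappa> powr p * min_dist_powr p S y"
      using \<kappa> by (simp add: field_simps)
    then have "(f x - affmax ?A x) powr p * w x \<le> \<kappa> powr p * min_dist_powr p S y * ((1 + \<epsilon>) * w0)"
      using wup[OF x(1)] w[OF x(2)] \<kappa> min_dist_powr_nonneg[OF S(2,3)] by (intro mult_mono) auto
    then show ?thesis by (simp add: integrand_def x_def mult_ac)
  qed
  have imC: "(\<lambda>y. a + M *v y) ` ucube \<subseteq> C" using acC by (simp add: acell_def)
  have cont: "continuous_on ucube (\<lambda>y. integrand ?A (a + M *v y))"
    by (rule continuous_on_compose2[OF continuous_on_integrand[OF A] affine_continuous imC])
  have abs: "(\<lambda>y. integrand ?A (a + M *v y)) absolutely_integrable_on ucube"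
    using cont unfolding ucube_def by (rule absolutely_integrable_continuous)
  have "integral (acell a M) (integrand ?A) = \<bar>det M\<bar> * integral ucube (\<lambda>y. integrand ?A (a + M *v y))"
    unfolding acell_def by (rule integral_affine_image(2)[OF ucube_basics(5,6) M abs])
  also have "\<dots> \<le> \<bar>det M\<bar> * integral ucube (\<lambda>y. \<kappa> powr p * ((1 + \<epsilon>) * w0) * min_dist_powr p S y)"
    using abs by (intro mult_left_mono integral_le pt integrable_on_mult_right min_dist_powr_integrable S p)
      (auto simp: absolutely_integrable_on_def)
  also have "\<dots> = \<bar>det M\<bar> * (\<kappa> powr p * ((1 + \<epsilon>) * w0) * qerr p S)"
    by (simp add: qerr_def)
  also have "\<dots> = (1 + \<epsilon>) powr (1 + p) * cellb M h w0 powr (1 + r) * qerr p S"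
  proof -
    have 4: "\<kappa> powr p = (1 + \<epsilon>) powr p * (h\<^sup>2 / 2) powr p" by (simp only: \<kappa>_def powr_mult)
    have 5: "(1 + \<epsilon>) powr (1 + p) = (1 + \<epsilon>) * (1 + \<epsilon>) powr p" using e by (simp add: powr_add)
    show ?thesis unfolding cellb_powr(1)[OF good] 4 5 by (simp only: mult_ac)
  qed
  finally show ?thesis .
qed

end

section \<open>Global upper bound\<close>

text \<open>Rounding down loses at most 1, which is at most \<epsilon> * (t * m) once t * m reaches
  1 / \<epsilon>.\<close>

lemma eventually_floor_ge:
  fixes t \<epsilon> :: real
  assumes "t > 0" "\<epsilon> > 0"
  shows "\<forall>\<^sub>F m in sequentially. K \<le> nat \<lfloor>t * real m\<rfloor> \<and> (1 - \<epsilon>) * (t * real m) \<le> real (nat \<lfloor>t * real m\<rfloor>)"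
proof (rule eventually_mono[OF eventually_ge_at_top[of "nat \<lceil>(real K + 1 / \<epsilon>) / t\<rceil>"]])
  fix m assume "nat \<lceil>(real K + 1 / \<epsilon>) / t\<rceil> \<le> m"
  then have "(real K + 1 / \<epsilon>) / t \<le> real m" by linarith
  then have *: "real K + 1 / \<epsilon> \<le> t * real m" using assms by (simp add: field_simps)
  moreover have "0 < 1 / \<epsilon>" using assms by simp
  ultimately have "real K \<le> t * real m" "1 / \<epsilon> \<le> t * real m" by linarith+
  moreover have "1 \<le> \<epsilon> * (t * real m)" using \<open>1 / \<epsilon> \<le> t * real m\<close> assms by (simp add: field_simps)
  then have "(1 - \<epsilon>) * (t * real m) \<le> t * real m - 1" by (simp only: left_diff_distrib)
  ultimately show "K \<le> nat \<lfloor>t * real m\<rfloor> \<and> (1 - \<epsilon>) * (t * real m) \<le> real (nat \<lfloor>t * real m\<rfloor>)"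
    by (auto simp: le_nat_iff le_floor_iff) linarith
qed

lemma qmin_less_attained:
  assumes "qmin p m TYPE('n::finite) < c"
  shows "\<exists>S::(real^'n) set. S \<subseteq> ucube \<and> finite S \<and> card S = m \<and> qerr p S < c"
proof -
  let ?X = "{S::(real^'n) set. S \<subseteq> ucube \<and> finite S \<and> card S = m}"
  have "qerr p ` ?X \<noteq> {}" using qmin_admissible_nonempty by (simp only: image_is_empty not_False_eq_True)
  from cInf_lessD[OF this assms[unfolded qmin_def]] show ?thesis by auto
qed

context weighted_C2
begin

text \<open>About \<epsilon> * m tangents form the uniform net, and cell \<open>P\<close> receives
  the share (1 - \<epsilon>) * b P / B, which is proportional to \<open>b P\<close> as in the
  equality case of \<open>power_mean_sum\<close>. The factor (1 - \<epsilon>)^(-2r) has two sources,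
  the part reserved for the net and the rounding. The constant \<open>c\<close> is the same for all
  \<epsilon>, so the last summand vanishes with \<epsilon>.\<close>

lemma upper_bound:
  obtains c where "\<And>\<epsilon>. 0 < \<epsilon> \<Longrightarrow> \<epsilon> < 1 \<Longrightarrow> \<forall>\<^sub>F m in sequentially. \<exists>T. T \<subseteq> C \<and> finite T \<and> T \<noteq> {} \<and> card T \<le> m \<and>
    real m powr r * integral C (integrand (tangents T))
      \<le> (1 + \<epsilon>) powr (1 + p) * (\<delta> + \<epsilon>) * (1 - \<epsilon>) powr (-2 * r) * (J / (1 - \<epsilon>)) powr (1 + r) + c * \<epsilon>"
proof -
  obtain c0 where c0: "c0 > 0" and net: "\<And>m. m > 0 \<Longrightarrow> \<exists>S. S \<subseteq> C \<and> finite S \<and> S \<noteq> {} \<and> card S \<le> m \<and>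
    (\<forall>x\<in>C. \<exists>s\<in>S. f x - (f s + Df s \<bullet> (x - s)) \<le> c0 * real m powr (- 2 / real CARD('n)))"
    by (rule tangent_net) blast
  have W: "W > 0" using C(4) w by force
  show thesis
  proof (rule that)
    fix \<epsilon> :: real assume e: "0 < \<epsilon>" "\<epsilon> < 1"
    \<comment> \<open>The net has at least \<epsilon> * m / 2 tangents available, which costs a
      factor (\<epsilon> / 2)^(-r); the uncovered volume is chosen to cancel it and to leave
      \<epsilon>.\<close>
    define \<epsilon>2 where "\<epsilon>2 = \<epsilon> * (\<epsilon> / 2) powr r"
    have e2: "\<epsilon>2 > 0" using e by (simp add: \<epsilon>2_def)
    obtain F :: "'n cell set" where F: "finite F" "\<And>P. P \<in> F \<Longrightarrow> good \<epsilon> P"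
      "integral (C - (\<Union>P\<in>F. AC P)) (\<lambda>x. 1::real) < \<epsilon>2" "(1 - \<epsilon>) * (\<Sum>P\<in>F. b P) \<le> J"
      by (rule cell_packing[OF e(1) e2]) blast
    define B where "B = (\<Sum>P\<in>F. b P)"
    have bpos: "b P > 0" if "P \<in> F" for P using cellb_powr(2)[OF F(2)[OF that]] .
    have Bpos: "B > 0" if "P \<in> F" for P
      unfolding B_def using that F(1) bpos by (intro sum_pos) auto
    have B0: "B \<ge> 0" unfolding B_def using bpos by (intro sum_nonneg) (auto intro: less_imp_le)
    define t where "t P = (1 - \<epsilon>) * b P / B" for P
    define k where "k P m = nat \<lfloor>t P * real m\<rfloor>" for P m
    define k0 where "k0 m = nat \<lfloor>\<epsilon> * real m\<rfloor>" for m
    have tpos: "t P > 0" if "P \<in> F" for P using e bpos[OF that] Bpos[OF that] by (simp add: t_def)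
    have "\<forall>\<^sub>F m in sequentially. real m powr r * qmin p m TYPE('n) < \<delta> + \<epsilon>"
      using zador_limit(1)[OF p, where 'n = 'n, folded \<delta>_eq r_eq] e by (intro order_tendstoD(2)) auto
    then obtain K where K: "\<And>m. m \<ge> K \<Longrightarrow> real m powr r * qmin p m TYPE('n) < \<delta> + \<epsilon>"
      unfolding eventually_sequentially by blast
    have ev1: "\<forall>\<^sub>F m in sequentially. \<forall>P\<in>F. max K 1 \<le> k P m \<and> (1 - \<epsilon>) * (t P * real m) \<le> real (k P m)"
      unfolding k_def using F(1) tpos e by (intro eventually_ball_finite ballI eventually_floor_ge) auto
    have ev2: "\<forall>\<^sub>F m in sequentially. 1 \<le> k0 m \<and> (1 - 1/2) * (\<epsilon> * real m) \<le> real (k0 m)"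
      unfolding k0_def using e by (intro eventually_floor_ge) auto
    show "\<forall>\<^sub>F m in sequentially. \<exists>T. T \<subseteq> C \<and> finite T \<and> T \<noteq> {} \<and> card T \<le> m \<and>
      real m powr r * integral C (integrand (tangents T))
      \<le> (1 + \<epsilon>) powr (1 + p) * (\<delta> + \<epsilon>) * (1 - \<epsilon>) powr (-2 * r) * (J / (1 - \<epsilon>)) powr (1 + r) + c0 powr p * W * \<epsilon>"
      using ev1 ev2 eventually_gt_at_top[of 0]
    proof eventually_elim
      case (elim m)
      have m: "real m > 0" using elim by simp
      obtain S0 where S0: "S0 \<subseteq> C" "finite S0" "S0 \<noteq> {}" "card S0 \<le> k0 m"
        "\<And>x. x \<in> C \<Longrightarrow> \<exists>s\<in>S0. f x - (f s + Df s \<bullet> (x - s)) \<le> c0 * real (k0 m) powr (- 2 / real CARD('n))"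
      proof -
        have "k0 m > 0" using elim by simp
        from net[OF this] show ?thesis using that by (elim exE conjE) (metis (no_types, lifting))
      qed
      have "\<exists>S::(real^'n) set. S \<subseteq> ucube \<and> finite S \<and> S \<noteq> {} \<and> card S = k P m \<and> qerr p S \<le> (\<delta> + \<epsilon>) * real (k P m) powr (-r)"
        if P: "P \<in> F" for P
      proof -
        have kP: "K \<le> k P m" "0 < k P m" using elim P by auto
        have "qmin p (k P m) TYPE('n) < (\<delta> + \<epsilon>) * real (k P m) powr (-r)"
          using K[OF kP(1)] kP(2) by (simp add: powr_minus field_simps)
        then obtain S :: "(real^'n) set" where "S \<subseteq> ucube" "finite S" "card S = k P m"
          "qerr p S < (\<delta> + \<epsilon>) * real (k P m) powr (-r)"
          using qmin_less_attained by blast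
        then show ?thesis using kP(2) by (intro exI[of _ S]) auto
      qed
      then obtain S :: "'n cell \<Rightarrow> (real^'n) set" where S: "\<And>P. P \<in> F \<Longrightarrow> S P \<subseteq> ucube" "\<And>P. P \<in> F \<Longrightarrow> finite (S P)"
        "\<And>P. P \<in> F \<Longrightarrow> S P \<noteq> {}" "\<And>P. P \<in> F \<Longrightarrow> card (S P) = k P m"
        "\<And>P. P \<in> F \<Longrightarrow> qerr p (S P) \<le> (\<delta> + \<epsilon>) * real (k P m) powr (-r)"
        by metis
      define im where "im P = (\<lambda>y. fst P + fst (snd P) *v y) ` S P" for P
      define T where "T = S0 \<union> (\<Union>P\<in>F. im P)"
      have acC: "AC P \<subseteq> C" if "P \<in> F" for P using F(2)[OF that] by (auto simp: good_cell_def)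
      have imC: "im P \<subseteq> C" if "P \<in> F" for P
        using S(1)[OF that] acC[OF that] unfolding im_def acell_def by blast
      have "finite (im P)" if "P \<in> F" for P using S(2)[OF that] by (simp add: im_def)
      then have T: "finite T" "T \<subseteq> C" "T \<noteq> {}" unfolding T_def using S0(1-3) F(1) imC by blast+
      have "card T \<le> card S0 + card (\<Union>P\<in>F. im P)" unfolding T_def by (rule card_Un_le)
      also have "card (\<Union>P\<in>F. im P) \<le> (\<Sum>P\<in>F. card (im P))" by (rule card_UN_le[OF F(1)])
      also have "(\<Sum>P\<in>F. card (im P)) \<le> (\<Sum>P\<in>F. k P m)"
        unfolding im_def using S(2,4) by (intro sum_mono) (metis card_image_le)
      finally have "card T \<le> card S0 + (\<Sum>P\<in>F. k P m)" by simp
      then have "card T \<le> k0 m + (\<Sum>P\<in>F. k P m)" using S0(4) by simp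
      then have "real (card T) \<le> real (k0 m + (\<Sum>P\<in>F. k P m))" by (simp only: of_nat_le_iff)
      then have "real (card T) \<le> real (k0 m) + (\<Sum>P\<in>F. real (k P m))" by simp
      also have "\<dots> \<le> \<epsilon> * real m + (\<Sum>P\<in>F. t P * real m)"
      proof -
        have "0 \<le> t P * real m" if "P \<in> F" for P using tpos[OF that] by simp
        then show ?thesis unfolding k_def k0_def using e by (intro add_mono sum_mono of_nat_floor) simp_all
      qed
      also have "(\<Sum>P\<in>F. t P * real m) \<le> (1 - \<epsilon>) * real m"
      \<comment> \<open>Without cells the total \<open>B\<close> is 0, and the quotient cannot be
        cancelled.\<close>
      proof (cases "F = {}")
        case False
        then have "B > 0" using Bpos by blast
        have "(\<Sum>P\<in>F. t P * real m) = (1 - \<epsilon>) * B / B * real m"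
          unfolding t_def by (simp only: B_def sum_distrib_left sum_distrib_right sum_divide_distrib)
        then show ?thesis using \<open>B > 0\<close> by simp
      qed (use e in auto)
      finally have "real (card T) \<le> real m" by (simp add: algebra_simps)
      then have cardT: "card T \<le> m" by simp
      let ?A = "tangents T"
      have A: "minorants ?A" by (rule minorants_tangents[OF T(1,3,2)])
      define Y where "Y = C - (\<Union>P\<in>F. AC P)"
      have YC: "Y \<subseteq> C" by (auto simp: Y_def)
      have Ys: "Y \<in> sets lebesgue" unfolding Y_def using F(1) C(1)
        by (intro sets.Diff sets.finite_UN cell_sets) auto
      have c1: "(\<lambda>x. 1::real) integrable_on Y"
        by (rule integrable_on_subset_nonneg[OF const_integrable _ YC Ys]) simp
      define \<eta> where "\<eta> = c0 powr p * W * real (k0 m) powr (-r)"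
      have \<eta>: "\<eta> \<ge> 0" using W by (simp add: \<eta>_def)
      \<comment> \<open>On the uncovered part the net tangents, whose base points belong to
        \<open>T\<close>, bound the integrand uniformly, however large the Hessian is there.\<close>
      have ptY: "integrand ?A x \<le> \<eta> * 1" if "x \<in> Y" for x
      proof -
        have x: "x \<in> C" using that YC by blast
        obtain s where s: "s \<in> S0" "f x - (f s + Df s \<bullet> (x - s)) \<le> c0 * real (k0 m) powr (- 2 / real CARD('n))"
          using S0(5)[OF x] by blast
        have "f s + Df s \<bullet> (x - s) \<le> affmax ?A x" using s(1) by (intro affmax_tangents_ge T) (simp add: T_def)
        then have "(f x - affmax ?A x) powr p \<le> (c0 * real (k0 m) powr (- 2 / real CARD('n))) powr p"
          using s(2) minorants_le[OF A x] p by (intro powr_mono2) auto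
        also have "\<dots> = c0 powr p * real (k0 m) powr (-r)"
          by (simp add: powr_mult powr_powr r_eq)
        finally have "(f x - affmax ?A x) powr p * w x \<le> c0 powr p * real (k0 m) powr (-r) * W"
          using w[OF x] by (intro mult_mono) auto
        then show ?thesis unfolding integrand_def \<eta>_def by (simp only: mult_ac mult_1_right)
      qed
      have iY: "integral Y (integrand ?A) \<le> \<eta> * \<epsilon>2"
      proof -
        have "integral Y (integrand ?A) \<le> integral Y (\<lambda>x. \<eta> * 1)"
          by (intro integral_le ptY integrable_on_mult_right c1 integrand_integrable_subset[OF A YC Ys])
        also have "\<dots> = \<eta> * integral Y (\<lambda>x. 1)" by (rule integral_mult_right)
        also have "\<dots> \<le> \<eta> * \<epsilon>2" using F(3) \<eta> by (intro mult_left_mono) (auto simp: Y_def)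
        finally show ?thesis .
      qed
      have mY: "real m powr r * (\<eta> * \<epsilon>2) \<le> c0 powr p * W * \<epsilon>"
      proof -
        have k0: "\<epsilon> / 2 * real m \<le> real (k0 m)" using elim by simp
        then have "real (k0 m) powr (-r) \<le> (\<epsilon> / 2 * real m) powr (-r)"
          using e m r_pos by (intro powr_mono2') auto
        also have "\<dots> = (\<epsilon> / 2) powr (-r) * real m powr (-r)" by (rule powr_mult)
        finally have "real (k0 m) powr (-r) * ((\<epsilon> / 2) powr r * real m powr r) \<le> (\<epsilon> / 2) powr (-r) * real m powr (-r) * ((\<epsilon> / 2) powr r * real m powr r)"
          by (rule mult_right_mono) simp
        also have "\<dots> = 1" using e m by (simp add: powr_minus field_simps)
        finally have "c0 powr p * W * \<epsilon> * (real (k0 m) powr (-r) * ((\<epsilon> / 2) powr r * real m powr r)) \<le> c0 powr p * W * \<epsilon> * 1"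
          using W e by (intro mult_left_mono) auto
        then show ?thesis unfolding \<eta>_def \<epsilon>2_def by (simp only: mult_ac mult_1_right)
      qed
      define Z where "Z = (1 + \<epsilon>) powr (1 + p) * (\<delta> + \<epsilon>) * (1 - \<epsilon>) powr (-2 * r)"
      have Z: "Z \<ge> 0" using e \<delta>_nonneg by (simp add: Z_def)
      have cellP: "real m powr r * integral (AC P) (integrand ?A) \<le> Z * B powr r * b P" if P: "P \<in> F" for P
      proof -
        have q0: "(\<delta> + \<epsilon>) \<ge> 0" using e \<delta>_nonneg by simp
        have "(1 - \<epsilon>) * (t P * real m) \<le> real (k P m)" using elim P by blast
        then have "real (k P m) powr (-r) \<le> ((1 - \<epsilon>) * (t P * real m)) powr (-r)"
          using e m tpos[OF P] r_pos by (intro powr_mono2') auto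
        also have "(1 - \<epsilon>) * (t P * real m) = (1 - \<epsilon>) * (1 - \<epsilon>) * b P / B * real m"
          by (simp add: t_def)
        also have "\<dots> powr (-r) = (1 - \<epsilon>) powr (-r) * (1 - \<epsilon>) powr (-r) * b P powr (-r) / B powr (-r) * real m powr (-r)"
          by (simp only: powr_mult powr_divide)
        also have "\<dots> = (1 - \<epsilon>) powr (-2 * r) * b P powr (-r) * B powr r * real m powr (-r)"
          using Bpos[OF P] by (simp add: powr_add[symmetric] powr_minus field_simps)
        finally have kb: "real (k P m) powr (-r) \<le> (1 - \<epsilon>) powr (-2 * r) * b P powr (-r) * B powr r * real m powr (-r)" .
        have "integral (AC P) (integrand ?A) \<le> (1 + \<epsilon>) powr (1 + p) * b P powr (1 + r) * qerr p (S P)"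
          by (rule cell_upper_bound[OF F(2)[OF P] e(1) S(1)[OF P] S(2)[OF P] S(3)[OF P] T(1,2)])
            (use P in \<open>auto simp: T_def im_def\<close>)
        also have "\<dots> \<le> (1 + \<epsilon>) powr (1 + p) * b P powr (1 + r) * ((\<delta> + \<epsilon>) * real (k P m) powr (-r))"
          using S(5)[OF P] by (intro mult_left_mono) auto
        also have "\<dots> \<le> (1 + \<epsilon>) powr (1 + p) * b P powr (1 + r) * ((\<delta> + \<epsilon>) *
            ((1 - \<epsilon>) powr (-2 * r) * b P powr (-r) * B powr r * real m powr (-r)))"
          using kb q0 by (intro mult_left_mono) auto
        also have "\<dots> = Z * B powr r * (b P powr (1 + r) * b P powr (-r)) * real m powr (-r)"
          unfolding Z_def by (simp only: mult_ac)
        \<comment> \<open>With the proportional share the powers of \<open>b P\<close> reduce to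
          \<open>b P\<close> itself, so the sum over the cells becomes B^(1 + r).\<close>
        also have "b P powr (1 + r) * b P powr (-r) = b P"
          using bpos[OF P] by (simp add: powr_add[symmetric])
        finally have "real m powr r * integral (AC P) (integrand ?A) \<le> real m powr r * (Z * B powr r * b P * real m powr (-r))"
          by (rule mult_left_mono) simp
        also have "\<dots> = Z * B powr r * b P" using m by (simp add: powr_minus field_simps)
        finally show ?thesis .
      qed
      have "integral C (integrand ?A) \<le> integral Y (integrand ?A) + (\<Sum>P\<in>F. integral (AC P) (integrand ?A))"
      proof (rule integral_le_remainder_plus_sum_cover[OF F(1) _ integrand_integrable[OF A] integrand_integrable_subset[OF A YC Ys]])
        show "C \<subseteq> Y \<union> (\<Union>P\<in>F. AC P)" by (auto simp: Y_def)
        show "integrand ?A integrable_on AC P" if "P \<in> F" for P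
          by (rule integrand_integrable_subset[OF A acC[OF that] cell_sets(1)])
        show "0 \<le> integrand ?A x" if "x \<in> Y" for x using integrand_nonneg YC that by blast
        show "0 \<le> integrand ?A x" if "P \<in> F" "x \<in> AC P" for P x
          using integrand_nonneg acC[OF that(1)] that(2) by blast
      qed
      then have "real m powr r * integral C (integrand ?A)
          \<le> real m powr r * (integral Y (integrand ?A) + (\<Sum>P\<in>F. integral (AC P) (integrand ?A)))"
        by (rule mult_left_mono) simp
      also have "\<dots> = real m powr r * integral Y (integrand ?A) + (\<Sum>P\<in>F. real m powr r * integral (AC P) (integrand ?A))"
        by (simp only: distrib_left sum_distrib_left)
      also have "\<dots> \<le> c0 powr p * W * \<epsilon> + (\<Sum>P\<in>F. Z * B powr r * b P)"
      proof (intro add_mono sum_mono cellP)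
        show "real m powr r * integral Y (integrand ?A) \<le> c0 powr p * W * \<epsilon>"
          using mY mult_left_mono[OF iY, of "real m powr r"] by simp
      qed
      also have "(\<Sum>P\<in>F. Z * B powr r * b P) = Z * B powr (1 + r)"
        using B0 by (simp add: sum_distrib_left[symmetric] B_def[symmetric] powr_add)
      also have "Z * B powr (1 + r) \<le> Z * (J / (1 - \<epsilon>)) powr (1 + r)"
        using F(4) e Z B0 r_pos by (intro mult_left_mono powr_mono2) (auto simp: B_def field_simps)
      finally show ?case
        using T cardT unfolding Z_def by (intro exI[of _ T]) (auto simp: add.commute)
    qed
  qed
qed

end

section \<open>The asymptotic formula\<close>

context weighted_C2
begin

lemma J_nonneg: "0 \<le> J"
  unfolding J_def by (intro integral_nonneg G_integrable less_imp_le[OF G_pos])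

text \<open>\<open>E\<close> stands for the infimum over the admissible families. Their class lies
  between the tangent families at points of \<open>C\<close> and all families of minorants on
  \<open>C\<close>, and only these two comparisons enter.\<close>

lemma limit_from_bounds:
  fixes E :: "nat \<Rightarrow> real"
  assumes low: "\<And>m B. m > 0 \<Longrightarrow> (\<And>A. minorants A \<Longrightarrow> card A \<le> m \<Longrightarrow> B \<le> integral C (integrand A)) \<Longrightarrow> B \<le> E m"
    and up: "\<And>m T. T \<subseteq> C \<Longrightarrow> finite T \<Longrightarrow> T \<noteq> {} \<Longrightarrow> card T \<le> m \<Longrightarrow> E m \<le> integral C (integrand (tangents T))"
  shows "(\<lambda>m. real m powr r * E m) \<longlonglongrightarrow> \<delta> * J powr (1 + r)"
proof (rule order_tendstoI)
  fix c assume c: "c < \<delta> * J powr (1 + r)"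
  show "\<forall>\<^sub>F m in sequentially. c < real m powr r * E m"
  \<comment> \<open>\<open>lower_bound\<close> requires \<epsilon> < J; for J = 0 it is enough that
    the errors are nonnegative.\<close>
  proof (cases "J = 0")
    case True
    then have "c < 0" using c by simp
    have nn: "0 \<le> real m powr r * E m" if "m > 0" for m
    proof -
      have "0 \<le> E m" by (rule low[OF that]) (intro integral_nonneg integrand_integrable integrand_nonneg)
      then show ?thesis by simp
    qed
    show ?thesis
      by (rule eventually_mono[OF eventually_gt_at_top[of 0]]) (rule less_le_trans[OF \<open>c < 0\<close> nn])
  next
    case False
    then have J: "J > 0" using J_nonneg by simp
    define lo where "lo \<epsilon> = (1 - \<epsilon>) powr (1 + p) * (1 - \<epsilon>) powr (n + 2 * p) * \<delta> * ((J - \<epsilon>) / (1 + \<epsilon>)) powr (1 + r)" for \<epsilon>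
    have "(lo \<longlongrightarrow> (1 - 0) powr (1 + p) * (1 - 0) powr (n + 2 * p) * \<delta> * ((J - 0) / (1 + 0)) powr (1 + r)) (at_right 0)"
      unfolding lo_def by (intro tendsto_intros) (use J in auto)
    then have "(lo \<longlongrightarrow> \<delta> * J powr (1 + r)) (at_right 0)" by simp
    then have "\<forall>\<^sub>F \<epsilon> in at_right 0. c < lo \<epsilon>" using c by (rule order_tendstoD(1))
    moreover have "\<forall>\<^sub>F \<epsilon> in at_right 0. \<epsilon> \<in> {0<..<min 1 J}"
      using J by (intro eventually_at_right_less eventually_at_rightI[of 0 "min 1 J"]) auto
    ultimately have "\<forall>\<^sub>F \<epsilon> in at_right 0. c < lo \<epsilon> \<and> \<epsilon> \<in> {0<..<min 1 J}" by (rule eventually_conj)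
    from eventually_happens'[OF trivial_limit_at_right_real this]
    obtain \<epsilon> where "c < lo \<epsilon> \<and> \<epsilon> \<in> {0<..<min 1 J}" ..
    then have e: "c < lo \<epsilon>" "0 < \<epsilon>" "\<epsilon> < 1" "\<epsilon> < J" by auto
    obtain N :: nat where N: "\<And>A m. minorants A \<Longrightarrow> card A \<le> m \<Longrightarrow>
      (1 - \<epsilon>) powr (1 + p) * (1 - \<epsilon>) powr (n + 2 * p) * \<delta> *
      (((J - \<epsilon>) / (1 + \<epsilon>)) powr (1 + r) * (real m + real N) powr (-r)) \<le> integral C (integrand A)"
      by (rule lower_bound[OF e(2,3,4)]) blast
    have Em: "lo \<epsilon> * (real m / (real m + real N)) powr r \<le> real m powr r * E m" if m: "m > 0" for m
    proof -
      have "lo \<epsilon> * (real m + real N) powr (-r) \<le> E m"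
      proof (rule low[OF m])
        fix A assume A: "minorants A" "card A \<le> m"
        show "lo \<epsilon> * (real m + real N) powr (-r) \<le> integral C (integrand A)"
          using N[OF A] unfolding lo_def by (simp only: mult.assoc)
      qed
      then have "real m powr r * (lo \<epsilon> * (real m + real N) powr (-r)) \<le> real m powr r * E m"
        by (rule mult_left_mono) simp
      then show ?thesis by (simp add: powr_divide powr_minus field_simps)
    qed
    \<comment> \<open>The fixed number \<open>N\<close> of extra points disappears as m
      grows.\<close>
    have "(\<lambda>m. real m / (real m + real N)) \<longlonglongrightarrow> 1"
    proof -
      have "(\<lambda>m. inverse (1 + real N * (1 / real m))) \<longlonglongrightarrow> inverse (1 + real N * 0)"
        by (intro tendsto_intros lim_1_over_n) auto
      moreover have "\<forall>\<^sub>F m in sequentially. inverse (1 + real N * (1 / real m)) = real m / (real m + real N)"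
        by (intro eventually_mono[OF eventually_gt_at_top[of 0]]) (simp add: field_simps)
      ultimately show ?thesis using Lim_transform_eventually by fastforce
    qed
    then have "(\<lambda>m. lo \<epsilon> * (real m / (real m + real N)) powr r) \<longlonglongrightarrow> lo \<epsilon> * 1 powr r"
      by (intro tendsto_intros) auto
    then have "\<forall>\<^sub>F m in sequentially. c < lo \<epsilon> * (real m / (real m + real N)) powr r"
      using e by (intro order_tendstoD(1)) auto
    then show ?thesis
      using eventually_gt_at_top[of 0] by eventually_elim (rule less_le_trans[OF _ Em])
  qed
next
  fix c assume c: "\<delta> * J powr (1 + r) < c"
  obtain c0 where c0: "\<And>\<epsilon>. 0 < \<epsilon> \<Longrightarrow> \<epsilon> < 1 \<Longrightarrow> \<forall>\<^sub>F m in sequentially. \<exists>T. T \<subseteq> C \<and> finite T \<and> T \<noteq> {} \<and> card T \<le> m \<and>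
    real m powr r * integral C (integrand (tangents T))
      \<le> (1 + \<epsilon>) powr (1 + p) * (\<delta> + \<epsilon>) * (1 - \<epsilon>) powr (-2 * r) * (J / (1 - \<epsilon>)) powr (1 + r) + c0 * \<epsilon>"
    by (rule upper_bound) blast
  \<comment> \<open>The power of J / (1 - \<epsilon>) is split, so that the limit rule for powers
    meets the nonzero base 1 - \<epsilon> even if J = 0.\<close>
  define hi where "hi \<epsilon> = (1 + \<epsilon>) powr (1 + p) * (\<delta> + \<epsilon>) * (1 - \<epsilon>) powr (-2 * r) * (J powr (1 + r) / (1 - \<epsilon>) powr (1 + r)) + c0 * \<epsilon>" for \<epsilon>
  have "(hi \<longlongrightarrow> (1 + 0) powr (1 + p) * (\<delta> + 0) * (1 - 0) powr (-2 * r) * (J powr (1 + r) / (1 - 0) powr (1 + r)) + c0 * 0) (at_right 0)"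
    unfolding hi_def by (intro tendsto_intros) auto
  then have "(hi \<longlongrightarrow> \<delta> * J powr (1 + r)) (at_right 0)" by simp
  then have "\<forall>\<^sub>F \<epsilon> in at_right 0. hi \<epsilon> < c" using c by (rule order_tendstoD(2))
  moreover have "\<forall>\<^sub>F \<epsilon> in at_right 0. \<epsilon> \<in> {0<..<1::real}"
    by (rule eventually_at_rightI[of 0 1]) auto
  ultimately have "\<forall>\<^sub>F \<epsilon> in at_right 0. hi \<epsilon> < c \<and> \<epsilon> \<in> {0<..<1}" by (rule eventually_conj)
  from eventually_happens'[OF trivial_limit_at_right_real this]
  obtain \<epsilon> where "hi \<epsilon> < c \<and> \<epsilon> \<in> {0<..<1}" ..
  then have e: "hi \<epsilon> < c" "0 < \<epsilon>" "\<epsilon> < 1" by auto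
  show "\<forall>\<^sub>F m in sequentially. real m powr r * E m < c"
    using c0[OF e(2,3)]
  proof eventually_elim
    case (elim m)
    then obtain T where T: "T \<subseteq> C" "finite T" "T \<noteq> {}" "card T \<le> m"
      "real m powr r * integral C (integrand (tangents T)) \<le> hi \<epsilon>"
      unfolding hi_def powr_divide by blast
    have "real m powr r * E m \<le> real m powr r * integral C (integrand (tangents T))"
      by (intro mult_left_mono up T) simp
    then show ?case using T(5) e(1) by linarith
  qed
qed

end

text \<open>Without semicontinuity, compactness alone gives no minimum. On a simplex spanned by an
  affine basis of \<open>D\<close> the function is bounded above. Reflecting a point of
  \<open>D\<close> in a relative interior point of the simplex, with a small factor, lands in the
  simplex, and convexity along this segment gives a bound from below. A constant minorant thus
  exists even for a domain without interior, where there are no tangents.\<close>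

lemma convex_on_compact_bounded_below:
  fixes g :: "'a::euclidean_space \<Rightarrow> real"
  assumes g: "convex_on D g" and D: "compact D"
  shows "\<exists>B. \<forall>x\<in>D. B \<le> g x"
proof (cases "D = {}")
  case False
  have cD: "convex D" using g by (rule convex_on_imp_convex)
  obtain S where S: "S \<subseteq> D" "\<not> affine_dependent S" "affine hull D = affine hull S"
    using affine_basis_exists by blast
  have Sne: "S \<noteq> {}" using S(3) False by auto
  have Sfin: "finite S" by (rule aff_independent_finite[OF S(2)])
  define P where "P = convex hull S"
  have PD: "P \<subseteq> D" unfolding P_def using S(1) cD by (rule hull_minimal)
  define U where "U = Max (g ` S)"
  have "\<forall>x\<in>P. g x \<le> U"
    unfolding P_def
  proof (rule convex_on_convex_hull_bound)
    show "convex_on (convex hull S) g" using convex_on_subset[OF g PD] by (simp add: P_def)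
    show "\<forall>x\<in>S. g x \<le> U" using Sfin by (simp add: U_def)
  qed
  then have U: "g x \<le> U" if "x \<in> P" for x using that by blast
  have "rel_interior P \<noteq> {}" using Sne rel_interior_eq_empty[of P] by (simp add: P_def)
  then obtain x0 e where x0: "x0 \<in> P" "e > 0" "ball x0 e \<inter> affine hull P \<subseteq> P"
    by (auto simp: mem_rel_interior_ball)
  have aP: "affine hull P = affine hull D" by (simp add: P_def S(3))
  obtain R where R: "\<And>x. x \<in> D \<Longrightarrow> norm (x - x0) \<le> R" "R > 0"
  proof -
    obtain R where R: "R > 0" "\<And>x. x \<in> D \<Longrightarrow> norm x \<le> R"
      using compact_imp_bounded[OF D] unfolding bounded_pos by blast
    show thesis
    proof (rule that[of "R + R"])
      fix x assume "x \<in> D"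
      then show "norm (x - x0) \<le> R + R"
        using R(2)[of x] R(2)[of x0] x0(1) PD norm_triangle_ineq4[of x x0] by fastforce
    qed (use R in simp)
  qed
  \<comment> \<open>The factor brings the reflected point within e / 2 of \<open>x0\<close> for
    every \<open>x\<close> in \<open>D\<close>.\<close>
  define s where "s = e / (2 * R)"
  have s: "s > 0" using R x0 by (simp add: s_def)
  have "((1 + s) * g x0 - U) / s \<le> g x" if x: "x \<in> D" for x
  proof -
    define y where "y = (1 + s) *\<^sub>R x0 + (- s) *\<^sub>R x"
    have "x0 \<in> affine hull D" "x \<in> affine hull D" using x x0(1) PD by (auto intro: hull_inc)
    then have ya: "y \<in> affine hull D" unfolding y_def by (intro mem_affine) auto
    have "x0 - y = s *\<^sub>R (x - x0)" by (simp add: y_def algebra_simps)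
    then have "dist x0 y = s * norm (x - x0)" using s by (simp add: dist_norm)
    also have "\<dots> \<le> s * R" using R(1)[OF x] s by (intro mult_left_mono) auto
    also have "\<dots> < e" using R x0 by (simp add: s_def)
    finally have "y \<in> ball x0 e" by simp
    then have yP: "y \<in> P" using x0(3) ya aP by blast
    have "x0 = (1 - s / (1 + s)) *\<^sub>R y + (s / (1 + s)) *\<^sub>R x"
    proof -
      have "1 - s / (1 + s) = 1 / (1 + s)" using s by (simp add: field_simps)
      moreover have "(1 / (1 + s)) *\<^sub>R y = x0 - (s / (1 + s)) *\<^sub>R x"
        unfolding y_def scaleR_add_right scaleR_scaleR using s by simp
      ultimately show ?thesis by simp
    qed
    then have "g x0 \<le> (1 - s / (1 + s)) * g y + s / (1 + s) * g x"
      using convex_onD[OF g, of "s / (1 + s)" y x] s yP PD x by auto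
    also have "\<dots> \<le> (1 - s / (1 + s)) * U + s / (1 + s) * g x"
      using U[OF yP] s by (intro add_right_mono mult_left_mono) (auto simp: field_simps)
    finally have "(1 + s) * g x0 \<le> (1 + s) * ((1 - s / (1 + s)) * U + s / (1 + s) * g x)"
      using s by (intro mult_left_mono) auto
    also have "\<dots> = U + s * g x"
    proof -
      have "(1 + s) * (1 - s / (1 + s)) = 1" "(1 + s) * (s / (1 + s)) = s" using s by (simp_all add: field_simps)
      then show ?thesis by (simp only: distrib_left mult.assoc[symmetric] mult_1_left)
    qed
    finally show ?thesis using s by (simp add: field_simps)
  qed
  then show ?thesis by blast
qed auto

section \<open>From extended-valued functions to real ones\<close>

lemma convex_ext_real:
  fixes u :: "'a::real_vector \<Rightarrow> ereal"
  assumes cv: "convex_ext u" and m: "\<forall>x. u x \<noteq> -\<infinity>"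
  shows "convex_on (edom u) (\<lambda>x. real_of_ereal (u x))"
proof -
  have fin: "u x = ereal (real_of_ereal (u x))" if "x \<in> edom u" for x
    using that m by (cases "u x") (auto simp: edom_def)
  have key: "u ((1 - t) *\<^sub>R x + t *\<^sub>R y) \<le> ereal ((1 - t) * real_of_ereal (u x) + t * real_of_ereal (u y))"
    if "x \<in> edom u" "y \<in> edom u" "0 \<le> t" "t \<le> 1" for x y t
  proof -
    have "u ((1 - t) *\<^sub>R x + t *\<^sub>R y) \<le> ereal (1 - t) * u x + ereal t * u y"
      using cv that unfolding convex_ext_def by blast
    also have "\<dots> = ereal (1 - t) * ereal (real_of_ereal (u x)) + ereal t * ereal (real_of_ereal (u y))"
      using fin that by metis
    finally show ?thesis by simp
  qed
  have dom: "(1 - t) *\<^sub>R x + t *\<^sub>R y \<in> edom u" if "x \<in> edom u" "y \<in> edom u" "0 \<le> t" "t \<le> 1" for x y t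
    using key[OF that] unfolding edom_def by (auto intro: le_less_trans)
  show ?thesis
  proof (rule convex_onI)
    show "convex (edom u)" unfolding convex_alt using dom by blast
    fix t :: real and x y assume a: "0 < t" "t < 1" "x \<in> edom u" "y \<in> edom u"
    have "ereal (real_of_ereal (u ((1 - t) *\<^sub>R x + t *\<^sub>R y))) \<le> ereal ((1 - t) * real_of_ereal (u x) + t * real_of_ereal (u y))"
      using key[of x y t] fin[OF dom[of x y t]] a by simp
    then show "real_of_ereal (u ((1 - t) *\<^sub>R x + t *\<^sub>R y)) \<le> (1 - t) * real_of_ereal (u x) + t * real_of_ereal (u y)"
      by simp
  qed
qed

lemma poly_lower_affmax:
  assumes m: "\<forall>x. u x \<noteq> -\<infinity>"
  shows "poly_lower u k = affmax ` {A. finite A \<and> A \<noteq> {} \<and> card A \<le> k \<and> (\<forall>x\<in>edom u. affmax A x \<le> real_of_ereal (u x))}"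
proof -
  have le: "ereal c \<le> u x \<longleftrightarrow> c \<le> real_of_ereal (u x)" if "x \<in> edom u" for x c
    using that m by (cases "u x") (auto simp: edom_def)
  show ?thesis (is "_ = affmax ` ?R")
  proof (intro equalityI subsetI)
    fix l assume "l \<in> poly_lower u k"
    then obtain A where A: "finite A" "A \<noteq> {}" "card A \<le> k"
      "\<And>x. l x = Max ((\<lambda>(a, b). a \<bullet> x + b) ` A)" "\<And>x. x \<in> edom u \<Longrightarrow> ereal (l x) \<le> u x"
      unfolding poly_lower_def by blast
    then have "l = affmax A" by (simp add: fun_eq_iff affmax_def)
    moreover have "A \<in> ?R" using A le calculation by simp
    ultimately show "l \<in> affmax ` ?R" by blast
  next
    fix l assume "l \<in> affmax ` ?R"
    then obtain A where "A \<in> ?R" "l = affmax A" by blast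
    then show "l \<in> poly_lower u k"
      unfolding poly_lower_def
      by (intro CollectI exI[of _ A] conjI allI ballI) (simp_all add: le affmax_def[symmetric])
  qed
qed

section \<open>Gradients and tangents up to the boundary of the domain\<close>

lemma has_derivative_along:
  fixes g :: "'a::real_inner \<Rightarrow> real"
  assumes "(g has_derivative (\<lambda>h. D \<bullet> h)) (at x)"
  shows "((\<lambda>t. g (x + t *\<^sub>R h)) has_real_derivative D \<bullet> h) (at 0)"
proof -
  have "((\<lambda>t. x + t *\<^sub>R h) has_derivative (\<lambda>s. s *\<^sub>R h)) (at 0)"
    by (auto intro!: derivative_eq_intros)
  from has_derivative_compose[OF this, of g "\<lambda>h. D \<bullet> h"] assms
  show ?thesis by (simp add: has_field_derivative_def mult_commute_abs)
qed

text \<open>A gradient longer than \<open>L\<close> would make \<open>g\<close> grow in its own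
  direction faster than \<open>L\<close> permits.\<close>

lemma gradient_norm_le_lipschitz:
  fixes g :: "'a::real_inner \<Rightarrow> real"
  assumes L: "L-lipschitz_on S g" and S: "open S" "x \<in> S"
    and d: "(g has_derivative (\<lambda>h. D \<bullet> h)) (at x)"
  shows "norm D \<le> L"
proof (rule ccontr)
  assume "\<not> norm D \<le> L"
  then have gt: "L < norm D" by simp
  have L0: "0 \<le> L" by (rule lipschitz_on_nonneg[OF L])
  have der: "((\<lambda>t. g (x + t *\<^sub>R D) - t * (L * norm D)) has_real_derivative D \<bullet> D - L * norm D) (at 0)"
    by (intro DERIV_diff has_derivative_along d) (auto intro!: derivative_eq_intros)
  have pos: "D \<bullet> D - L * norm D > 0"
  proof -
    have "L * norm D < norm D * norm D" using gt L0 by (intro mult_strict_right_mono) auto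
    then show ?thesis by (simp add: dot_square_norm power2_eq_square)
  qed
  from DERIV_pos_inc_right[OF der pos]
  obtain d1 where d1: "d1 > 0" "\<And>t. 0 < t \<Longrightarrow> t < d1 \<Longrightarrow> g x < g (x + t *\<^sub>R D) - t * (L * norm D)" by auto
  obtain e where e: "e > 0" "cball x e \<subseteq> S" using S open_contains_cball by blast
  define t where "t = min (d1 / 2) (e / norm D)"
  have nD: "norm D > 0" using gt L0 by linarith
  have t: "0 < t" "t < d1" "t * norm D \<le> e"
    using d1(1) e(1) nD by (auto simp: t_def min_less_iff_disj min_def field_simps)
  have "x + t *\<^sub>R D \<in> S" using e(2) t by (auto simp: dist_norm)
  from lipschitz_onD[OF L this S(2)] have "g (x + t *\<^sub>R D) - g x \<le> L * (t * norm D)"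
    using t by (simp add: dist_norm)
  then show False using d1(2)[OF t(1,2)] by (simp add: algebra_simps)
qed

text \<open>Differentiability is used at \<open>s\<close> only, so the bound reaches boundary points
  of \<open>D\<close>. Along the segment from \<open>s\<close> to \<open>x\<close> the derivative at
  \<open>s\<close> cannot exceed the chord slope g x - g s.\<close>

lemma convex_on_tangent_le:
  fixes g :: "'a::real_inner \<Rightarrow> real"
  assumes g: "convex_on D g" and s: "s \<in> D" and x: "x \<in> D"
    and d: "(g has_derivative (\<lambda>h. Dg \<bullet> h)) (at s)"
  shows "g s + Dg \<bullet> (x - s) \<le> g x"
proof (rule ccontr)
  assume "\<not> ?thesis"
  then have gt: "Dg \<bullet> (x - s) - (g x - g s) > 0" by simp
  have "((\<lambda>t. g (s + t *\<^sub>R (x - s)) - t * (g x - g s)) has_real_derivative Dg \<bullet> (x - s) - (g x - g s)) (at 0)"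
    by (intro DERIV_diff has_derivative_along d) (auto intro!: derivative_eq_intros)
  from DERIV_pos_inc_right[OF this gt]
  obtain d1 where d1: "d1 > 0" "\<And>t. 0 < t \<Longrightarrow> t < d1 \<Longrightarrow> g s < g (s + t *\<^sub>R (x - s)) - t * (g x - g s)" by auto
  define t where "t = min (d1 / 2) 1"
  have t: "0 < t" "t < d1" "t \<le> 1" using d1(1) by (auto simp: t_def)
  have "g ((1 - t) *\<^sub>R s + t *\<^sub>R x) \<le> (1 - t) * g s + t * g x"
    using convex_onD[OF g _ _ s x, of t] t by auto
  moreover have "(1 - t) *\<^sub>R s + t *\<^sub>R x = s + t *\<^sub>R (x - s)" by (simp add: algebra_simps)
  ultimately show False using d1(2)[OF t(1,2)] by (simp add: algebra_simps)
qed

theorem theorem1: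
  fixes p :: real
    and u :: "real^'n \<Rightarrow> ereal"
    and Du :: "real^'n \<Rightarrow> real^'n"
    and D2u :: "real^'n \<Rightarrow> real^'n^'n"
    and \<omega> :: "real^'n \<Rightarrow> real \<Rightarrow> real"
  assumes p: "p > 0"
    and u_not_minf: "\<forall>x. u x \<noteq> -\<infinity>"
    and u_convex: "convex_ext u"
    and dom_compact: "compact (edom u)"
    and u_lipschitz: "\<exists>L. L-lipschitz_on (interior (edom u)) (\<lambda>x. real_of_ereal (u x))"
    and u_C2: "C2_plus_on (\<lambda>x. real_of_ereal (u x)) Du D2u (interior (edom u))"
    and \<omega>_cont: "continuous_on UNIV (\<lambda>z. \<omega> (fst z) (snd z))"
    and \<omega>_pos: "\<forall>x t. \<omega> x t > 0"
  shows "(\<lambda>m. real m powr (2 * p / real CARD('n)) * approx_error p u m \<omega>)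
     \<longlonglongrightarrow> zador_delta p TYPE('n) / 2 powr p *
        (integral (edom u) (\<lambda>x. det (D2u x) powr (p / (real CARD('n) + 2 * p))
            * \<omega> x (real_of_ereal (u x)) powr (real CARD('n) / (real CARD('n) + 2 * p))))
          powr ((real CARD('n) + 2 * p) / real CARD('n))"
proof -
  define D where "D = edom u"
  define C where "C = interior D"
  define f where "f x = real_of_ereal (u x)" for x
  define w where "w x = \<omega> x (f x)" for x
  define \<A> where "\<A> m = {A. finite A \<and> A \<noteq> {} \<and> card A \<le> m \<and> (\<forall>x\<in>D. affmax A x \<le> f x)}" for m
  have fconv: "convex_on D f" unfolding D_def f_def by (rule convex_ext_real[OF u_convex u_not_minf])
  then have Dconv: "convex D" by (rule convex_on_imp_convex)
  have CD: "C \<subseteq> D" by (simp add: C_def interior_subset)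
  \<comment> \<open>The frontier of a convex set is null, also when the interior is empty; so all
    integrals can be taken over \<open>C\<close>.\<close>
  have neg: "negligible (D - C)"
    using negligible_convex_frontier[OF Dconv] closure_subset[of D]
    by (auto simp: C_def frontier_def intro: negligible_subset)
  have intDC: "integral D g = integral C g" for g :: "real^'n \<Rightarrow> real"
    using CD by (intro integral_spike_set) (auto intro: negligible_subset[OF neg])
  define E where "E m = approx_error p u m \<omega>" for m
  have E: "E m = Inf ((\<lambda>A. integral C (\<lambda>x. (f x - affmax A x) powr p * w x)) ` \<A> m)" for m
    unfolding E_def approx_error_def poly_lower_affmax[OF u_not_minf] image_image
      D_def[symmetric] f_def[symmetric] \<A>_def[symmetric] w_def[symmetric] intDC ..
  \<comment> \<open>For m = 0 no family is admissible and the infimum runs over the empty set, but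
    the limit sees only m > 0.\<close>
  have \<A>ne: "\<A> m \<noteq> {}" if m: "m > 0" for m
  proof -
    obtain B where "\<forall>x\<in>D. B \<le> f x"
      using convex_on_compact_bounded_below[OF fconv] dom_compact by (auto simp: D_def)
    then have "{(0, B)} \<in> \<A> m" using m by (auto simp: \<A>_def affmax_def)
    then show ?thesis by blast
  qed
  define n where "n = real CARD('n)"
  define rhs where "rhs = integral C (\<lambda>x. det (D2u x) powr (p / (n + 2 * p)) * w x powr (n / (n + 2 * p)))"
  have "(\<lambda>m. real m powr (2 * p / n) * E m) \<longlonglongrightarrow> zador_delta p TYPE('n) / 2 powr p * rhs powr ((n + 2 * p) / n)"
  \<comment> \<open>A domain without interior is null, and both sides vanish.\<close>
  proof (cases "C = {}")
    case True
    have "E m = 0" if "m > 0" for m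
    proof -
      have "(\<lambda>A. integral C (\<lambda>x. (f x - affmax A x) powr p * w x)) ` \<A> m = {0}"
        using \<A>ne[OF that] True by auto
      then show ?thesis unfolding E by simp
    qed
    then have "\<forall>\<^sub>F m in sequentially. real m powr (2 * p / n) * E m = 0"
      by (intro eventually_mono[OF eventually_gt_at_top[of 0]]) auto
    moreover have "rhs = 0" using True by (simp add: rhs_def)
    ultimately show ?thesis by (simp add: tendsto_eventually)
  next
    case False
    obtain L where L: "L-lipschitz_on C f" using u_lipschitz by (auto simp: C_def D_def f_def[abs_def])
    have C2: "C2_plus_on f Du D2u C" using u_C2 by (simp add: C_def D_def f_def[abs_def])
    have bC: "bounded C" using compact_imp_bounded[OF dom_compact] CD bounded_subset unfolding D_def by blast
    have oC: "open C" by (simp add: C_def)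
    have cC: "convex C" unfolding C_def by (rule convex_interior[OF Dconv])
    have der: "(f has_derivative (\<lambda>h. Du x \<bullet> h)) (at x)" if "x \<in> C" for x
      using C2 that by (simp add: C2_plus_on_def)
    have cont_f: "continuous_on C f" using L by (rule lipschitz_on_continuous_on)
    have bf: "bounded (f ` C)" by (rule bounded_uniformly_continuous_image[OF lipschitz_on_uniformly_continuous[OF L] bC])
    have cont_w: "continuous_on C w"
    proof -
      have "continuous_on C (\<lambda>x. (x, f x))" by (intro continuous_intros cont_f)
      from continuous_on_compose2[OF \<omega>_cont this] show ?thesis by (simp add: w_def[abs_def])
    qed
    obtain W where W: "\<And>x. x \<in> C \<Longrightarrow> w x \<le> W"
    proof -
      \<comment> \<open>By the Lipschitz condition \<open>f\<close> is bounded on \<open>C\<close>,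
        so its graph lies in a compact set, on which \<omega> is bounded.\<close>
      have "compact (closure C \<times> closure (f ` C))" using bC bf by (intro compact_Times) auto
      then have "compact ((\<lambda>z. \<omega> (fst z) (snd z)) ` (closure C \<times> closure (f ` C)))"
        by (intro compact_continuous_image continuous_on_subset[OF \<omega>_cont]) auto
      from compact_imp_bounded[OF this, unfolded bounded_iff]
      obtain W where W: "\<forall>v \<in> (\<lambda>z. \<omega> (fst z) (snd z)) ` (closure C \<times> closure (f ` C)). norm v \<le> W" ..
      have "w x \<le> W" if "x \<in> C" for x
      proof -
        have "(x, f x) \<in> closure C \<times> closure (f ` C)"
          using that closure_subset[of C] closure_subset[of "f ` C"] by auto
        from bspec[OF W imageI[OF this]] show ?thesis by (simp add: w_def)
      qed
      then show thesis by (rule that)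
    qed
    interpret weighted_C2 f Du D2u C L p w W n "zador_delta p TYPE('n)"
    proof unfold_locales
      show "norm (Du x) \<le> L" if "x \<in> C" for x
        by (rule gradient_norm_le_lipschitz[OF L oC that der[OF that]])
      show "0 < w x \<and> w x \<le> W" if "x \<in> C" for x using W[OF that] \<omega>_pos by (simp add: w_def)
    qed (use oC cC bC False C2 p cont_w in \<open>auto simp: n_def\<close>)
    have int: "(\<lambda>x. (f x - affmax A x) powr p * w x) = integrand A" for A
      by (simp add: integrand_def fun_eq_iff)
    have minor: "minorants A" if "A \<in> \<A> m" for A m
      unfolding minorants_def
    proof (intro conjI)
      show fin: "finite A" and "A \<noteq> {}" using that by (simp_all add: \<A>_def)
      have "a \<bullet> x + b \<le> f x" if "(a, b) \<in> A" "x \<in> C" for a b x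
        using affmax_ge[OF fin that(1), of x] \<open>A \<in> \<A> m\<close> CD that(2) by (force simp: \<A>_def)
      then show "\<forall>(a, b)\<in>A. \<forall>x\<in>C. a \<bullet> x + b \<le> f x" by blast
    qed
    have bdd: "bdd_below ((\<lambda>A. integral C (integrand A)) ` \<A> m)" for m
      by (intro bdd_belowI[of _ 0]) (auto intro!: integral_nonneg integrand_integrable integrand_nonneg dest: minor)
    have "(\<lambda>m. real m powr r * E m) \<longlonglongrightarrow> zador_delta p TYPE('n) * J powr (1 + r)"
    proof (rule limit_from_bounds)
      fix m B assume m: "0 < m" and *: "\<And>A. minorants A \<Longrightarrow> card A \<le> m \<Longrightarrow> B \<le> integral C (integrand A)"
      show "B \<le> E m"
        unfolding E int using \<A>ne[OF m] minor * by (intro cInf_greatest) (auto simp: \<A>_def)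
    next
      fix m T assume T: "T \<subseteq> C" "finite T" "T \<noteq> {}" "card T \<le> m"
      \<comment> \<open>Admissibility concerns all of \<open>D\<close>; at points outside
        \<open>C\<close>, where \<open>f\<close> need not be differentiable, the tangent bound comes
        from convexity.\<close>
      have "affmax (tangents T) x \<le> f x" if x: "x \<in> D" for x
      proof -
        have "finite (tangents T)" "tangents T \<noteq> {}" using T by (auto simp: tangents_def)
        then obtain \<alpha> \<beta> where "(\<alpha>, \<beta>) \<in> tangents T" "affmax (tangents T) x = \<alpha> \<bullet> x + \<beta>" by (rule affmax_attained)
        then obtain s where s: "s \<in> T" "affmax (tangents T) x = f s + Du s \<bullet> (x - s)"
          by (auto simp: tangents_def inner_diff_right)
        then show ?thesis using convex_on_tangent_le[OF fconv _ x der] T CD by (metis subsetD)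
      qed
      then have "tangents T \<in> \<A> m"
        using T card_tangents[OF T(2)] by (auto simp: \<A>_def tangents_def)
      then show "E m \<le> integral C (integrand (tangents T))"
        unfolding E int by (intro cInf_lower bdd) auto
    qed
    moreover have "zador_delta p TYPE('n) * J powr (1 + r) = zador_delta p TYPE('n) / 2 powr p * rhs powr ((n + 2 * p) / n)"
    proof -
      have "J = 2 powr (- p * q) * rhs"
        unfolding J_def rhs_def G_def[abs_def] q_def by (simp add: mult.assoc)
      then have "J powr (1 + r) = 2 powr (- p * q * (1 + r)) * rhs powr (1 + r)"
        by (simp only: powr_mult powr_powr)
      also have "- p * q * (1 + r) = - p" using q_r(2) by (simp add: mult.assoc)
      finally have "J powr (1 + r) = rhs powr (1 + r) / 2 powr p" by (simp add: powr_minus divide_inverse)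
      moreover have "(n + 2 * p) / n = 1 + r" using n_pos by (simp add: r_def add_divide_distrib)
      ultimately show ?thesis by simp
    qed
    ultimately show ?thesis by (simp add: r_def)
  qed
  then show ?thesis
    unfolding E_def rhs_def n_def w_def f_def intDC[symmetric] D_def .
qed

end
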